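(* Let $q\in(0,1)$, $N\ge 1$, and consider the $N$-particle $q$-TAZRP with rates $a_x(1-q^k)$ started from $Y=(y_1,\dots,y_N)\in\mathbb{W}_N$. Let $1\le n\le N$, $M\in\mathbb{Z}$ and $t>0$. Then, with $b_x$, $B_r$, $c_S(n)$, $\tilde c_S(n)$, $I$ as defined in the context, $$\mathbb{P}_Y(x_n(t)>M)=\sum_{r=n}^N(-1)^r\sum_{\substack{S=\{s_1,\dots,s_r\}\subseteq\{1,\dots,N\}\\ |S|=r}}c_S(n)\,\frac{1}{(2\pi i)^r}\oint_C\frac{dw_{s_1}}{w_{s_1}}\cdots\oint_C\frac{dw_{s_r}}{w_{s_r}}\;I(w_{s_1},\dots,w_{s_r};M,t),$$ where $C$ is a positively oriented circle centred at $0$ and enclosing all $b_k$, $k\in\mathbb{Z}$; and $$\mathbb{P}_Y(x_{N-n+1}(t)\le M)=\sum_{r=n}^N q^{-rN}\sum_{\substack{S=\{s_1,\dots,s_r\}\subseteq\{1,\dots,N\}\\ |S|=r}}\tilde c_S(n)\,\frac{1}{(2\pi i)^r}\oint_{\tilde C_1}\frac{dw_{s_1}}{w_{s_1}}\cdots\oint_{\tilde C_r}\frac{dw_{s_r}}{w_{s_r}}\;I(w_{s_1},\dots,w_{s_r};M,t),$$ where each $\tilde C_j$ is a positively oriented simple closed curve which encloses all $b_k$ but does not enclose $0$, and $\tilde C_j$ encloses $q\tilde C_i$ whenever $j>i$. In both formulas the elements of $S$ are listed in increasing order $s_1<\dots<s_r$.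
   Context: Model. Let $q\in(0,1)$ and let $(a_x)_{x\in\mathbb{Z}}$ be positive numbers all lying in a compact subset of $(0,\infty)$; put $b_x=(1-q)a_x$. The $N$-particle $q$-TAZRP (with site dependent rates) is the continuous-time Markov process of $N$ particles on $\mathbb{Z}$ in which, for each site $x$ occupied by $k\ge1$ particles, one particle jumps from $x$ to $x+1$ at rate $a_x(1-q^k)$, all exponential clocks being independent. The state is $X(t)=(x_1(t),\dots,x_N(t))\in\mathbb{W}_N:=\{(i_1,\dots,i_N)\in\mathbb{Z}^N: i_1\ge i_2\ge\cdots\ge i_N\}$, so $x_m(t)$ is the position of the $m$-th rightmost particle. (Among the particles at a site, the one with smallest label jumps, and it becomes the one with largest label at $x+1$.) $\mathbb{P}_Y$ is the law of the process with $X(0)=Y$. Notation. $[m]_q!=\prod_{k=1}^m\frac{1-q^k}{1-q}$ (with $[0]_q!=1$), and ${n\brack k}_q=\frac{[n]_q!}{[k]_q!\,[n-k]_q!}$. For $f$ defined on $\mathbb{Z}$, the extended product is $$\prod_{k=m}^{n}{}^{'}f(k)=\begin{cases}\prod_{k=m}^nf(k)& n\ge m,\\ 1& n=m-1,\\ \prod_{k=n+1}^{m-1}\frac1{f(k)}& n<m-1.\end{cases}$$ Let $$B_r(w_1,\dots,w_r)=\prod_{1\le i<j\le r}\frac{w_i-w_j}{qw_i-w_j}.$$ For $S=\{s_1,\dots,s_r\}\subseteq\{1,\dots,N\}$ with $|S|=r\ge n$, $$c_S(n)=(-1)^nq^{\frac{n(n-1)}2-nr+\sum_{i=1}^rs_i}{r-1\brack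 n-1}_q,\qquad \tilde c_S(n)=(-1)^nq^{\frac{n(n-1)}2+\frac{r(r-1)}2+\sum_{i=1}^rs_i}{r-1\brack n-1}_q,$$ $$I(w_{s_1},\dots,w_{s_r};M,t)=B_r(w_{s_1},\dots,w_{s_r})\prod_{i=1}^r\left[\prod_{k=y_{s_i}}^{M}{}^{'}\left(\frac{b_k}{b_k-w_{s_i}}\right)e^{-w_{s_i}t}\right].$$ *)

theory Defs
  imports "HOL-Probability.Probability" "HOL-Complex_Analysis.Complex_Analysis"
begin

text \<open>\<open>Q\<close> is a generator matrix: off the diagonal \<open>Q x y\<close> is the jump rate from \<open>x\<close> to \<open>y\<close>, and
  its rows sum to \<open>0\<close>.\<close>

definition transition_function ::
    "'s set \<Rightarrow> ('s \<Rightarrow> 's \<Rightarrow> real) \<Rightarrow> (real \<Rightarrow> 's \<Rightarrow> 's pmf) \<Rightarrow> bool" where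
  "transition_function E Q p \<longleftrightarrow>
     (\<forall>t\<ge>0. \<forall>x\<in>E. set_pmf (p t x) \<subseteq> E) \<and>
     (\<forall>x\<in>E. p 0 x = return_pmf x) \<and>
     (\<forall>s\<ge>0. \<forall>t\<ge>0. \<forall>x\<in>E. p (s + t) x = bind_pmf (p s x) (p t)) \<and>
     (\<forall>x\<in>E. \<forall>y\<in>E. ((\<lambda>t. pmf (p t x) y) has_real_derivative Q x y) (at_right 0))"

text \<open>A process on \<open>P\<close> with almost surely right-continuous (for the discrete topology on \<open>E\<close>)
  paths, started from \<open>y\<close>, which is a time-homogeneous Markov process with generator \<open>Q\<close>. The last
  equation is \<open>P(X(t\<^sub>m + s) = z | X(t\<^sub>0) = x\<^sub>0, \<dots>, X(t\<^sub>m) = x\<^sub>m) = p\<^sub>s(x\<^sub>m, z)\<close>, multiplied out so that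
  conditioning on null events is harmless.\<close>

definition markov_jump_process ::
    "'s set \<Rightarrow> ('s \<Rightarrow> 's \<Rightarrow> real) \<Rightarrow> 's \<Rightarrow> 'w measure \<Rightarrow> (real \<Rightarrow> 'w \<Rightarrow> 's) \<Rightarrow> bool" where
  "markov_jump_process E Q y P X \<longleftrightarrow>
     prob_space P \<and>
     (\<forall>t\<ge>0. X t \<in> measurable P (count_space E)) \<and>
     (AE \<omega> in P. X 0 \<omega> = y) \<and>
     (AE \<omega> in P. \<forall>t\<ge>0. eventually (\<lambda>s. X s \<omega> = X t \<omega>) (at_right t)) \<and>
     (\<exists>p. transition_function E Q p \<and>
       (\<forall>(m::nat) (t::nat \<Rightarrow> real) x s z.
          0 \<le> t 0 \<longrightarrow> mono_on {..m} t \<longrightarrow> x \<in> {..m} \<rightarrow> E \<longrightarrow> 0 \<le> s \<longrightarrow> z \<in> E \<longrightarrow>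
          measure P {\<omega> \<in> space P. (\<forall>i\<le>m. X (t i) \<omega> = x i) \<and> X (t m + s) \<omega> = z} =
          measure P {\<omega> \<in> space P. \<forall>i\<le>m. X (t i) \<omega> = x i} * pmf (p s (x m)) z))"

text \<open>Configurations are functions on \<open>{1..N}\<close>, extended by \<open>undefined\<close>.\<close>

definition weyl_chamber :: "nat \<Rightarrow> (nat \<Rightarrow> int) set" where
  "weyl_chamber N =
     {x \<in> {1..N} \<rightarrow>\<^sub>E UNIV. \<forall>i\<in>{1..N}. \<forall>j\<in>{1..N}. i \<le> j \<longrightarrow> x j \<le> x i}"

definition labels_at :: "nat \<Rightarrow> (nat \<Rightarrow> int) \<Rightarrow> int \<Rightarrow> nat set" where
  "labels_at N x z = {i \<in> {1..N}. x i = z}"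

text \<open>The particle with smallest label at \<open>z\<close> moves to \<open>z + 1\<close>; by monotonicity of \<open>x\<close> it is then
  the one with largest label at \<open>z + 1\<close>.\<close>

definition jump_from :: "nat \<Rightarrow> (nat \<Rightarrow> int) \<Rightarrow> int \<Rightarrow> nat \<Rightarrow> int" where
  "jump_from N x z = x(Min (labels_at N x z) := z + 1)"

definition jump_rate :: "real \<Rightarrow> (int \<Rightarrow> real) \<Rightarrow> nat \<Rightarrow> (nat \<Rightarrow> int) \<Rightarrow> int \<Rightarrow> real" where
  "jump_rate q a N x z = a z * (1 - q ^ card (labels_at N x z))"

definition qtazrp_generator ::
    "real \<Rightarrow> (int \<Rightarrow> real) \<Rightarrow> nat \<Rightarrow> (nat \<Rightarrow> int) \<Rightarrow> (nat \<Rightarrow> int) \<Rightarrow> real" where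
  "qtazrp_generator q a N x x' =
     (\<Sum>z\<in>x ` {1..N}. jump_rate q a N x z * (of_bool (x' = jump_from N x z) - of_bool (x' = x)))"

definition qtazrp ::
    "real \<Rightarrow> (int \<Rightarrow> real) \<Rightarrow> nat \<Rightarrow> (nat \<Rightarrow> int) \<Rightarrow> 'w measure \<Rightarrow> (real \<Rightarrow> 'w \<Rightarrow> nat \<Rightarrow> int) \<Rightarrow> bool" where
  "qtazrp q a N Y P X \<longleftrightarrow>
     markov_jump_process (weyl_chamber N) (qtazrp_generator q a N) Y P X"

definition q_fact :: "real \<Rightarrow> nat \<Rightarrow> real" where
  "q_fact q m = (\<Prod>k=1..m. (1 - q ^ k) / (1 - q))"

definition q_binomial :: "real \<Rightarrow> nat \<Rightarrow> nat \<Rightarrow> real" where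
  "q_binomial q n k = q_fact q n / (q_fact q k * q_fact q (n - k))"

definition ext_prod :: "int \<Rightarrow> int \<Rightarrow> (int \<Rightarrow> complex) \<Rightarrow> complex" where
  "ext_prod m n f =
     (if n \<ge> m then \<Prod>k=m..n. f k
      else if n = m - 1 then 1
      else \<Prod>k=n+1..m-1. 1 / f k)"

definition coeff_c :: "real \<Rightarrow> nat \<Rightarrow> nat set \<Rightarrow> real" where
  "coeff_c q n S = (let r = card S in
     (-1) ^ n * q powi (int (n * (n - 1) div 2) - int (n * r) + int (\<Sum>s\<in>S. s))
       * q_binomial q (r - 1) (n - 1))"

definition coeff_c_tilde :: "real \<Rightarrow> nat \<Rightarrow> nat set \<Rightarrow> real" where
  "coeff_c_tilde q n S = (let r = card S in
     (-1) ^ n * q ^ (n * (n - 1) div 2 + r * (r - 1) div 2 + (\<Sum>s\<in>S. s))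
       * q_binomial q (r - 1) (n - 1))"

text \<open>The variables \<open>w\<^bsub>s\<^sub>1\<^esub>, \<dots>, w\<^bsub>s\<^sub>r\<^esub>\<close> are the entries \<open>w ! 0, \<dots>, w ! (r - 1)\<close> of a list.\<close>

definition B_fun :: "real \<Rightarrow> complex list \<Rightarrow> complex" where
  "B_fun q w = (\<Prod>j<length w. \<Prod>i<j. (w ! i - w ! j) / (of_real q * w ! i - w ! j))"

definition I_fun ::
    "real \<Rightarrow> (int \<Rightarrow> real) \<Rightarrow> (nat \<Rightarrow> int) \<Rightarrow> nat set \<Rightarrow> int \<Rightarrow> real \<Rightarrow> complex list \<Rightarrow> complex" where
  "I_fun q b Y S M t w = (let s = sorted_list_of_set S in
     B_fun q w * (\<Prod>i<card S.
       ext_prod (Y (s ! i)) M (\<lambda>k. of_real (b k) / (of_real (b k) - w ! i))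
         * exp (- (w ! i) * of_real t)))"

text \<open>The first path of the list belongs to the outermost integral and to the first variable.\<close>

fun iterated_contour_integral ::
    "(real \<Rightarrow> complex) list \<Rightarrow> (complex list \<Rightarrow> complex) \<Rightarrow> complex" where
  "iterated_contour_integral [] f = f []"
| "iterated_contour_integral (\<gamma> # \<gamma>s) f =
     contour_integral \<gamma> (\<lambda>z. iterated_contour_integral \<gamma>s (\<lambda>zs. f (z # zs)))"

text \<open>The normalised integral with respect to \<open>dw\<^sub>1/w\<^sub>1 \<dots> dw\<^sub>r/w\<^sub>r\<close>.\<close>

definition log_contour_integral ::
    "(real \<Rightarrow> complex) list \<Rightarrow> (complex list \<Rightarrow> complex) \<Rightarrow> complex" where
  "log_contour_integral \<gamma>s f =
     1 / (2 * of_real pi * \<i>) ^ length \<gamma>s *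
     iterated_contour_integral \<gamma>s (\<lambda>w. (\<Prod>i<length \<gamma>s. 1 / w ! i) * f w)"

definition positively_oriented_curve :: "(real \<Rightarrow> complex) \<Rightarrow> bool" where
  "positively_oriented_curve \<gamma> \<longleftrightarrow>
     valid_path \<gamma> \<and> simple_path \<gamma> \<and> pathfinish \<gamma> = pathstart \<gamma> \<and>
     (\<forall>z\<in>inside (path_image \<gamma>). winding_number \<gamma> z = 1)"

end

theory Submission
  imports Defs
begin

text \<open>Both sides of the first formula solve the backward equation in the initial configuration
  \<open>Y\<close>, whose bounded solutions are unique. Raising \<open>y\<^sub>s\<close> by one multiplies the integrand by
  \<open>(b - w\<^sub>s) / b\<close>, so the contour integrals solve the equation of independent particles, and this
  is the equation of the q-TAZRP because for \<open>y\<^sub>s = y\<^bsub>s+1\<^esub>\<close> the increments in these two coordinates have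
  ratio \<open>q\<close>. At time 0 the integrals are evaluated by residues at 0 and at infinity. They depend on \<open>Y\<close>
  only through the coordinates truncated at \<open>M + 1\<close>, hence are bounded.

  The second formula follows from the first one for \<open>N - n + 1\<close>: replacing the curves, from the
  outermost one inwards, by a large circle costs a residue at 0 in each variable, and the
  resulting coefficients agree by a \<open>q\<close>-binomial identity.\<close>

text \<open>In the cross factor (z - w) / (q z - w), with z the earlier variable, the pole in z is
  at w / q, outside a circle common to all variables, and the pole in w is at q z, inside it. So the
  first variable can be contracted to 0, and the last one expanded to infinity, without meeting a
  cross pole; the factor becomes 1 in both limits. This fits the order of the particles: Y is weakly
  decreasing, so the particles beyond M, whose integrands are entire, come first, and the others,
  whose integrands vanish at infinity for t = 0, come last. In a later variable the residue at 0
  costs 1 / q for each earlier variable, and the coefficients of the second formula compensate these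
  powers.

  Both coefficient identities are one computation: a sum over subsets with multiplicative weights is
  a product of commuting operators 1 - x E applied to a function of the cardinality, and Pascal's
  rule evaluates it factor by factor.

  The bound needed for uniqueness is available for configurations bounded below, a set that jumps to
  the right do not leave.\<close>

section \<open>Subset sums and q-binomial coefficients\<close>

text \<open>This is \<open>[r - 1, n - 1]\<^sub>q\<close>; the values for \<open>r = 0\<close> and \<open>n = 0\<close> are chosen such that
  \<open>q_pascal_Suc\<close> holds also at \<open>p = 0\<close> and \<open>n = 1\<close>.\<close>

definition q_pascal :: "real \<Rightarrow> nat \<Rightarrow> nat \<Rightarrow> real" where
  "q_pascal q r n =
     (if r = 0 \<or> n = 0 then of_bool (r = n) else if n \<le> r then q_binomial q (r - 1) (n - 1) else 0)"

lemma q_fact_Suc: "q_fact q (Suc n) = q_fact q n * ((1 - q ^ Suc n) / (1 - q))"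
  by (simp add: q_fact_def)

lemma q_fact_pos: "0 < q \<Longrightarrow> q < 1 \<Longrightarrow> 0 < q_fact q n"
  unfolding q_fact_def
  by (intro prod_pos) (auto intro!: divide_pos_pos simp: power_less_one_iff)

lemma q_binomial_0 [simp]: "0 < q \<Longrightarrow> q < 1 \<Longrightarrow> q_binomial q n 0 = 1"
  using q_fact_pos[of q n] by (simp add: q_binomial_def q_fact_def[of q 0])

lemma q_binomial_self [simp]: "0 < q \<Longrightarrow> q < 1 \<Longrightarrow> q_binomial q n n = 1"
  using q_fact_pos[of q n] by (simp add: q_binomial_def q_fact_def[of q 0])

lemma q_binomial_symmetric: "k \<le> n \<Longrightarrow> q_binomial q n (n - k) = q_binomial q n k"
  by (simp add: q_binomial_def mult.commute)

text \<open>With n = k + d + 1 the numerator splits as 1 - q^(n+1) = (1 - q^(d+1)) + q^(d+1) (1 -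
  q^(k+1)). For k = n the rule fails, because n - Suc k is truncated and
  \<open>q_binomial q n (Suc n)\<close> is not 0; \<open>q_pascal\<close> repairs this.\<close>

lemma q_binomial_Suc_Suc:
  assumes q: "0 < q" "q < 1" and "k < n"
  shows "q_binomial q (Suc n) (Suc k) = q_binomial q n (Suc k) + q ^ (n - k) * q_binomial q n k"
proof -
  obtain d where d: "n = Suc (k + d)"
    using \<open>k < n\<close> less_imp_Suc_add by blast
  have nz: "1 - q \<noteq> 0" "1 - q ^ Suc k \<noteq> 0" "1 - q ^ Suc d \<noteq> 0"
    using q power_less_one_iff[of q "Suc k"] power_less_one_iff[of q "Suc d"] by auto
  have pos: "q_fact q n \<noteq> 0" "q_fact q k \<noteq> 0" "q_fact q d \<noteq> 0"
    using q_fact_pos[OF q] by (metis less_irrefl)+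
  define A B where "A = 1 - q ^ Suc k" and "B = 1 - q ^ Suc d"
  have AB: "A \<noteq> 0" "B \<noteq> 0" using nz by (auto simp: A_def B_def)
  have fn: "q_fact q (Suc n) = q_fact q n * ((B + q ^ Suc d * A) / (1 - q))"
    by (simp add: q_fact_Suc A_def B_def d algebra_simps power_add)
  have fk: "q_fact q (Suc k) = q_fact q k * (A / (1 - q))" and fd: "q_fact q (Suc d) = q_fact q d * (B / (1 - q))"
    by (simp_all only: q_fact_Suc A_def B_def)
  have "n - k = Suc d" "n - Suc k = d" "Suc n - Suc k = Suc d" by (auto simp: d)
  then have "q_binomial q (Suc n) (Suc k) = q_fact q n * ((B + q ^ Suc d * A) / (1 - q)) / (q_fact q k * (A / (1 - q)) * (q_fact q d * (B / (1 - q))))"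
    and "q_binomial q n (Suc k) = q_fact q n / (q_fact q k * (A / (1 - q)) * q_fact q d)"
    and "q ^ (n - k) * q_binomial q n k = q ^ Suc d * (q_fact q n / (q_fact q k * (q_fact q d * (B / (1 - q)))))"
    unfolding q_binomial_def fn fk by (simp_all only: fd)
  then show ?thesis
    using nz(1) AB pos by (simp only:) (simp add: field_simps del: power_Suc)
qed

text \<open>The exponent is an integer because it can be negative; this happens only for n > p + 1,
  where both terms on the right vanish.\<close>

lemma q_pascal_Suc:
  assumes q: "0 < q" "q < 1" and n: "1 \<le> n"
  shows "q_pascal q (Suc p) n = q_pascal q p n + q powi (int p - int n + 1) * q_pascal q p (n - 1)"
proof -
  consider "n > Suc p" | "n = Suc p" | "n = 1" "1 \<le> p" | "2 \<le> n" "n \<le> p" using n by linarith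
  then show ?thesis
  proof cases
    case 1
    then show ?thesis by (auto simp: q_pascal_def)
  next
    case 2
    then show ?thesis using q by (auto simp: q_pascal_def)
  next
    case 3
    then show ?thesis using q by (auto simp: q_pascal_def)
  next
    case 4
    then obtain k l where kl: "n = Suc (Suc k)" "p = Suc l" "k < l"
      by (metis One_nat_def Suc_1 Suc_le_D Suc_le_lessD Suc_le_mono order_trans one_le_numeral)
    have "int p - int n + 1 = int (l - k)"
      using kl by simp
    then have "q powi (int p - int n + 1) = q ^ (l - k)"
      by (metis power_int_of_nat)
    then show ?thesis
      using q_binomial_Suc_Suc[OF q \<open>k < l\<close>] kl by (simp add: q_pascal_def)
  qed
qed

text \<open>The value at \<open>p\<close> of \<open>(\<Prod>s\<in>A. 1 - x s E) g\<close>, where \<open>E\<close> is the shift \<open>(E g) p = g (p + 1)\<close>.\<close>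

definition subset_sum :: "'b set \<Rightarrow> ('b \<Rightarrow> real) \<Rightarrow> (nat \<Rightarrow> real) \<Rightarrow> nat \<Rightarrow> real" where
  "subset_sum A x g p = (\<Sum>U\<in>Pow A. (\<Prod>s\<in>U. - x s) * g (p + card U))"

lemma sum_Pow_insert:
  assumes "finite A" "a \<notin> A"
  shows "(\<Sum>U\<in>Pow (insert a A). f U) = (\<Sum>U\<in>Pow A. f U) + (\<Sum>U\<in>Pow A. f (insert a U))"
proof -
  have "inj_on (insert a) (Pow A)" using assms by (auto simp: inj_on_def)
  then show ?thesis
    unfolding Pow_insert using assms
    by (subst sum.union_disjoint) (auto simp: sum.reindex)
qed

lemma subset_sum_empty [simp]: "subset_sum {} x g p = g p"
  by (simp add: subset_sum_def)

lemma subset_sum_insert: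
  assumes "finite A" "a \<notin> A"
  shows "subset_sum (insert a A) x g p = subset_sum A x g p - x a * subset_sum A x g (Suc p)"
proof -
  have "(\<Prod>s\<in>insert a U. - x s) * g (p + card (insert a U)) = - x a * ((\<Prod>s\<in>U. - x s) * g (Suc p + card U))"
    if "U \<in> Pow A" for U
  proof -
    have "finite U" "a \<notin> U" using that assms finite_subset by auto
    then show ?thesis by simp
  qed
  then show ?thesis
    unfolding subset_sum_def sum_Pow_insert[OF assms] by (simp add: sum_distrib_left sum_negf)
qed

lemma subset_sum_reindex:
  assumes h: "bij_betw h A B" and x: "\<And>s. s \<in> A \<Longrightarrow> x (h s) = y s"
  shows "subset_sum B x g p = subset_sum A y g p"
proof -
  have inj: "inj_on h A" and B: "B = h ` A" using h by (auto simp: bij_betw_def)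
  have bij: "bij_betw ((`) h) (Pow A) (Pow B)"
    using h by (rule bij_betw_Pow)
  show ?thesis
    unfolding subset_sum_def
  proof (rule sum.reindex_bij_betw[OF bij, symmetric, THEN trans], rule sum.cong)
    fix U assume U: "U \<in> Pow A"
    then have inj: "inj_on h U" using inj inj_on_subset by auto
    have "(\<Prod>s\<in>h ` U. - x s) = (\<Prod>s\<in>U. - y s)"
      using U x by (subst prod.reindex[OF inj]) (auto intro!: prod.cong)
    then show "(\<Prod>s\<in>h ` U. - x s) * g (p + card (h ` U)) = (\<Prod>s\<in>U. - y s) * g (p + card U)"
      by (simp add: card_image[OF inj])
  qed simp
qed

text \<open>The shift E annihilates the delta at 0, so each further factor 1 - x E leaves it
  fixed.\<close>

lemma subset_sum_Un_delta:
  assumes "finite A" "A \<inter> B = {}" "finite B" and B: "\<And>p. subset_sum B x g p = c * of_bool (p = 0)"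
  shows "subset_sum (A \<union> B) x g p = c * of_bool (p = 0)"
  using assms(1,2)
proof (induction A arbitrary: p)
  case empty
  then show ?case using B by simp
next
  case (insert a A)
  then have "a \<notin> A \<union> B" "finite (A \<union> B)" using \<open>finite B\<close> by auto
  then show ?case
    using insert by (simp add: subset_sum_insert)
qed

lemma triangle_Suc: "int (Suc m * (Suc m + 1) div 2) = int (m * (m + 1) div 2) + int m + 1"
  by simp

text \<open>By Pascal's rule \<open>1 - E\<close> lowers the second index of \<open>q_pascal\<close> up to a factor \<open>- q\<^bsup>p-n+1\<^esup>\<close>, and
  \<open>1 - q\<^bsup>-i\<^esup> E\<close> acts on \<open>q\<^bsup>ip\<^esup> g\<close> like \<open>1 - E\<close> on \<open>g\<close>.\<close>

lemma subset_sum_q_pascal: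
  assumes q: "0 < q" "q < 1" and "m \<le> n"
  shows "subset_sum {..<m} (\<lambda>i. q powi (- int i)) (\<lambda>p. q_pascal q p n) p =
     (-1) ^ m * q powi (int m * int p - int m * int n + int (m * (m + 1) div 2)) * q_pascal q p (n - m)"
  using \<open>m \<le> n\<close>
proof (induction m arbitrary: p)
  case 0
  then show ?case by simp
next
  case (Suc m)
  define e where "e = int m * int p - int m * int n + int (m * (m + 1) div 2)"
  have qp: "q powi (a + b) = q powi a * q powi b" for a b :: int
    using q by (simp add: power_int_add)
  have 1: "q powi (- int m) * q powi (int m * int (Suc p) - int m * int n + int (m * (m + 1) div 2)) = q powi e"
    unfolding qp[symmetric] e_def by (simp add: algebra_simps)
  have 2: "q powi (int (Suc m) * int p - int (Suc m) * int n + int (Suc m * (Suc m + 1) div 2))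
      = q powi e * q powi (int p - int (n - m) + 1)"
    unfolding qp[symmetric] e_def triangle_Suc using Suc.prems by (simp add: algebra_simps)
  have nm: "1 \<le> n - m" "n - m - 1 = n - Suc m" using Suc.prems by auto
  have "subset_sum {..<Suc m} (\<lambda>i. q powi (- int i)) (\<lambda>p. q_pascal q p n) p
     = (-1) ^ m * q powi e * q_pascal q p (n - m)
       - q powi (- int m) * ((-1) ^ m * q powi (int m * int (Suc p) - int m * int n + int (m * (m + 1) div 2)) * q_pascal q (Suc p) (n - m))"
    using Suc by (simp add: lessThan_Suc subset_sum_insert e_def del: of_nat_Suc)
  also have "\<dots> = (-1) ^ m * q powi e * q_pascal q p (n - m)
       - (-1) ^ m * (q powi (- int m) * q powi (int m * int (Suc p) - int m * int n + int (m * (m + 1) div 2))) * q_pascal q (Suc p) (n - m)"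
    by (simp only: mult_ac)
  also have "\<dots> = (-1) ^ m * q powi e * (q_pascal q p (n - m) - q_pascal q (Suc p) (n - m))"
    unfolding 1 by (simp add: algebra_simps)
  also have "\<dots> = (-1) ^ Suc m * (q powi e * q powi (int p - int (n - m) + 1)) * q_pascal q p (n - Suc m)"
    unfolding q_pascal_Suc[OF q nm(1)] nm(2) by simp
  finally show ?case unfolding 2 .
qed

text \<open>After n factors the second index has reached 0, where \<open>q_pascal\<close> is the
  delta at p = 0.\<close>

lemma subset_sum_q_pascal_full:
  assumes q: "0 < q" "q < 1"
  shows "subset_sum {..<n} (\<lambda>i. q powi (- int i)) (\<lambda>p. q_pascal q p n) p =
     ((-1) ^ n * q powi (- int (n * (n - 1) div 2))) * of_bool (p = 0)"
proof -
  have "- int n * int n + int (n * (n + 1) div 2) = - int (n * (n - 1) div 2)"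
  proof (induction n)
    case (Suc n)
    then show ?case by (cases n) (auto simp: algebra_simps)
  qed simp
  then show ?thesis
    unfolding subset_sum_q_pascal[OF q order_refl] by (cases "p = 0") (auto simp: q_pascal_def)
qed

section \<open>The coefficients of the two formulas as functions on the whole power set\<close>

definition signed_c :: "real \<Rightarrow> nat \<Rightarrow> nat set \<Rightarrow> real" where
  "signed_c q n S = (if n \<le> card S then (-1) ^ card S * coeff_c q n S else 0)"

definition scaled_c_tilde :: "real \<Rightarrow> nat \<Rightarrow> nat \<Rightarrow> nat set \<Rightarrow> real" where
  "scaled_c_tilde q N n S =
     (if n \<le> card S then q powi (- int (card S * N)) * coeff_c_tilde q n S else 0)"

lemma prod_power_int: "(q::real) \<noteq> 0 \<Longrightarrow> (\<Prod>s\<in>U. q powi f s) = q powi (\<Sum>s\<in>U. f s)"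
  by (induction U rule: infinite_finite_induct) (auto simp: power_int_add)

lemma signed_c_eq:
  assumes q: "0 < q" "q < 1" and n: "1 \<le> n"
  shows "signed_c q n S = (-1) ^ (n + card S) * q powi (int (n * (n - 1) div 2) - int n * int (card S) + int (\<Sum>S))
           * q_pascal q (card S) n"
  using n by (auto simp: signed_c_def coeff_c_def Let_def q_pascal_def power_add)

lemma scaled_c_tilde_eq:
  assumes q: "0 < q" "q < 1" and n: "1 \<le> n"
  shows "scaled_c_tilde q N n S = (-1) ^ n *
       q powi (int (n * (n - 1) div 2) + int (card S * (card S - 1) div 2) - int (card S * N) + int (\<Sum>S))
           * q_pascal q (card S) n"
proof (cases "n \<le> card S")
  case True
  have "q powi (- int (card S * N)) * q ^ (n * (n - 1) div 2 + card S * (card S - 1) div 2 + \<Sum>S)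
     = q powi (int (n * (n - 1) div 2) + int (card S * (card S - 1) div 2) - int (card S * N) + int (\<Sum>S))"
    unfolding power_int_of_nat[symmetric] using q
    by (subst power_int_add[symmetric]) (auto simp: algebra_simps)
  then show ?thesis
    using True n by (simp add: scaled_c_tilde_def coeff_c_tilde_def Let_def q_pascal_def)
qed (use n in \<open>auto simp: scaled_c_tilde_def q_pascal_def\<close>)

text \<open>This is the first formula at time 0, when exactly the particles 1..m are beyond M and
  the integral over S is the indicator that S is contained in {1..m}. The weights q^(s - n) for s =
  1..n are q^0, ..., q^-(n-1) in reverse order, so their factors already produce a delta at 0, which
  the factors for s > n preserve.\<close>

lemma sum_signed_c:
  assumes q: "0 < q" "q < 1" and n: "1 \<le> n"
  shows "(\<Sum>S\<in>Pow {1..m}. signed_c q n S) = of_bool (n \<le> m)"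
proof (cases "n \<le> m")
  case False
  have "signed_c q n S = 0" if "S \<in> Pow {1..m}" for S
  proof -
    have "card S \<le> m" using that card_mono[of "{1..m}" S] by auto
    then show ?thesis using False by (simp add: signed_c_def)
  qed
  then show ?thesis using False by simp
next
  case True
  let ?x = "\<lambda>s. q powi (int s - int n)" and ?C = "int (n * (n - 1) div 2)"
  have summand: "signed_c q n S = (-1) ^ n * q powi ?C * ((\<Prod>s\<in>S. - ?x s) * q_pascal q (0 + card S) n)"
    if "S \<in> Pow {1..m}" for S
  proof -
    have "finite S" using that finite_subset by auto
    have "(\<Prod>s\<in>S. - ?x s) = (-1) ^ card S * q powi (\<Sum>s\<in>S. int s - int n)"
      using q by (simp add: prod_uminus prod_power_int)
    also have "(\<Sum>s\<in>S. int s - int n) = int (\<Sum>S) - int n * int (card S)"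
      by (simp add: sum_subtractf)
    finally have 1: "(\<Prod>s\<in>S. - ?x s) = (-1) ^ card S * q powi (int (\<Sum>S) - int n * int (card S))" .
    have "q powi (?C - int n * int (card S) + int (\<Sum>S)) = q powi ?C * q powi (int (\<Sum>S) - int n * int (card S))"
      using q by (subst power_int_add[symmetric]) (auto simp: algebra_simps)
    then show ?thesis
      unfolding signed_c_eq[OF q n] 1 by (simp add: power_add)
  qed
  have bij: "bij_betw (\<lambda>i. n - i) {..<n} {1..n}"
    by (rule bij_betw_byWitness[where f' = "\<lambda>i. n - i"]) auto
  have "subset_sum {1..n} ?x (\<lambda>p. q_pascal q p n) p
      = ((-1) ^ n * q powi (- int (n * (n - 1) div 2))) * of_bool (p = 0)" for p
    unfolding subset_sum_q_pascal_full[OF q, symmetric]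
    by (rule subset_sum_reindex[OF bij]) simp
  then have "subset_sum ({n<..m} \<union> {1..n}) ?x (\<lambda>p. q_pascal q p n) 0
      = ((-1) ^ n * q powi (- int (n * (n - 1) div 2))) * of_bool ((0::nat) = 0)"
    by (intro subset_sum_Un_delta) auto
  moreover have "{n<..m} \<union> {1..n} = {1..m}" using True by auto
  moreover have "(\<Sum>S\<in>Pow {1..m}. signed_c q n S) = (-1) ^ n * q powi ?C * subset_sum {1..m} ?x (\<lambda>p. q_pascal q p n) 0"
    unfolding subset_sum_def sum_distrib_left by (intro sum.cong refl summand)
  ultimately have "(\<Sum>S\<in>Pow {1..m}. signed_c q n S)
      = (-1) ^ n * q powi ?C * ((-1) ^ n * q powi (- ?C))" by simp
  also have "\<dots> = ((-1) ^ n * (-1) ^ n) * (q powi ?C * q powi (- ?C))"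
    by (simp only: mult_ac)
  also have "q powi ?C * q powi (- ?C) = 1"
    using q by (subst power_int_add[symmetric]) auto
  also have "(-1::real) ^ n * (-1) ^ n = 1"
    by (simp add: power_mult_distrib[symmetric])
  finally show ?thesis using True by simp
qed

section \<open>Ranks, which count the earlier variables, and the coefficient identity for the second
  formula\<close>

definition rank_in :: "nat set \<Rightarrow> nat \<Rightarrow> nat" where
  "rank_in A s = card {a \<in> A. a < s}"

lemma rank_in_Un: "finite A \<Longrightarrow> finite B \<Longrightarrow> A \<inter> B = {} \<Longrightarrow> rank_in (A \<union> B) s = rank_in A s + rank_in B s"
  unfolding rank_in_def by (subst card_Un_disjoint[symmetric]) (auto intro!: arg_cong[where f=card])

lemma bij_betw_rank_in: "finite A \<Longrightarrow> bij_betw (rank_in A) A {..<card A}"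
proof (induction A rule: finite_linorder_max_induct)
  case empty
  then show ?case by (simp add: bij_betw_def)
next
  case (insert b A)
  then have "{a \<in> insert b A. a < b} = A" and "\<And>s. s \<in> A \<Longrightarrow> {a \<in> insert b A. a < s} = {a \<in> A. a < s}"
    by fastforce+
  then have 1: "rank_in (insert b A) b = card A" and 2: "\<And>s. s \<in> A \<Longrightarrow> rank_in (insert b A) s = rank_in A s"
    by (simp_all add: rank_in_def)
  have "b \<notin> A" using insert by auto
  have "bij_betw (rank_in (insert b A)) A {..<card A}"
    using insert.IH 2 by (simp cong: bij_betw_cong)
  then have "bij_betw (rank_in (insert b A)) (A \<union> {b}) ({..<card A} \<union> {card A})"
    by (rule bij_betw_combine) (auto simp: bij_betw_def 1)
  moreover have "A \<union> {b} = insert b A" "{..<card A} \<union> {card A} = {..<card (insert b A)}"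
    using insert \<open>b \<notin> A\<close> by auto
  ultimately show ?case by simp
qed

lemma sum_rank_in: "finite A \<Longrightarrow> (\<Sum>s\<in>A. rank_in A s) = card A * (card A - 1) div 2"
  using sum.reindex_bij_betw[OF bij_betw_rank_in, of A "\<lambda>i. i"]
  by (simp add: lessThan_atLeast0 Sum_Ico_nat)

lemma rank_in_complement:
  assumes "T \<subseteq> {1..N}" "s \<in> {1..N}"
  shows "rank_in T s + rank_in ({1..N} - T) s = s - 1"
proof -
  have "T \<union> ({1..N} - T) = {1..N}" using assms by auto
  moreover have "rank_in {1..N} s = s - 1"
  proof -
    have "{a \<in> {1..N}. a < s} = {1..<s}" using assms by auto
    then show ?thesis by (simp add: rank_in_def)
  qed
  ultimately show ?thesis
    using rank_in_Un[of T "{1..N} - T" s] assms(1) finite_subset by fastforce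
qed

text \<open>Doubling removes the division, so that relations between triangular numbers become
  polynomial identities.\<close>

lemma triangle_double: "2 * int (j * (j - 1) div 2) = int j * (int j - 1)"
proof -
  have "even (j * (j - 1))" by (cases j) auto
  then have "2 * (j * (j - 1) div 2) = j * (j - 1)" by simp
  then have "2 * int (j * (j - 1) div 2) = int (j * (j - 1))"
    by (metis of_nat_mult of_nat_numeral)
  also have "\<dots> = int j * (int j - 1)" by (cases j) (auto simp: algebra_simps)
  finally show ?thesis .
qed

lemma triangle_add: "int ((p + k) * (p + k - 1) div 2) =
    int (p * (p - 1) div 2) + int (k * (k - 1) div 2) + int p * int k"
  using triangle_double[of "p + k"] triangle_double[of p] triangle_double[of k]
  by (simp add: algebra_simps)

text \<open>K, C, B and D are triangular numbers given by their doubles; m, p and k stand for the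
  size of the complement of T, the size of T and N - n. The left side is the power of q collected
  from the sum over U, the right side the one in \<open>signed_c q (k + 1) T\<close>.\<close>

lemma exponent_identity:
  fixes k n p m :: int
  assumes "2 * K = k * (k + 1)" "2 * C = n * (n - 1)" "2 * B = p * (p - 1)" "2 * D = m * (m + 1)"
    and "k = m + p - n"
  shows "C + B - p * (n + k) + s + (m * p - m * n + D) = K - (k + 1) * p + s"
proof -
  have "2 * (C + B - p * (n + k) + s + (m * p - m * n + D)) = 2 * (K - (k + 1) * p + s)"
    unfolding distrib_left right_diff_distrib assms(1-4) by (simp add: assms(5) algebra_simps)
  then show ?thesis by simp
qed

text \<open>This is the coefficient of the circle integral over T after the deformation: T holds the
  variables kept on the circle, U those replaced by their residue at 0. With m = N - card T, the sum
  over U is (1 - q^0 E) ... (1 - q^-(m-1) E) applied to \<open>q_pascal\<close> at card T, up to a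
  prefactor. For m < n the second index drops to n - m, and the symmetry of the q-binomial gives the
  coefficient for N - n + 1. For m >= n the result is the delta at card T = 0, and T is too small
  for \<open>signed_c\<close>.\<close>

lemma sum_scaled_c_tilde:
  assumes q: "0 < q" "q < 1" and n: "1 \<le> n" "n \<le> N" and T: "T \<subseteq> {1..N}"
  shows "(\<Sum>U\<in>Pow ({1..N} - T). scaled_c_tilde q N n (T \<union> U) * (\<Prod>s\<in>U. - (q powi (- int (rank_in (T \<union> U) s)))))
     = of_bool (T = {}) - signed_c q (N - n + 1) T"
proof -
  define p m where "p = card T" and "m = N - p"
  let ?A = "{1..N} - T"
  have fin: "finite T" using T finite_subset by auto
  have pN: "p \<le> N" using card_mono[OF _ T] by (simp add: p_def)
  have cardA: "card ?A = m" using T fin by (simp add: card_Diff_subset m_def p_def)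
  let ?C = "int (n * (n - 1) div 2)"
  let ?e = "?C + int (p * (p - 1) div 2) - int (p * N) + int (\<Sum>T)"
  \<comment> \<open>In the total exponent for the union of T and U, the sum of U and the triangular
    number of card U cancel against the ranks; each s in U leaves only its rank in the complement of
    T, shifted by m - 1.\<close>
  let ?x = "\<lambda>s. q powi (int (rank_in ?A s) - (int m - 1))"
  have qp: "q powi (a + b) = q powi a * q powi b" for a b :: int
    using q by (simp add: power_int_add)
  have summand: "scaled_c_tilde q N n (T \<union> U) * (\<Prod>s\<in>U. - (q powi (- int (rank_in (T \<union> U) s))))
     = (-1) ^ n * q powi ?e * ((\<Prod>s\<in>U. - ?x s) * q_pascal q (p + card U) n)"
    if U: "U \<in> Pow ?A" for U
  proof -
    have finU: "finite U" and disj: "T \<inter> U = {}" using U finite_subset by auto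
    have cardU: "card (T \<union> U) = p + card U" using card_Un_disjoint[OF fin finU disj] by (simp add: p_def)
    have "int (rank_in (T \<union> U) s) = int s - 1 - int (rank_in ?A s) + int (rank_in U s)" if "s \<in> U" for s
    proof -
      have "s \<in> {1..N}" using that U by auto
      with rank_in_complement[OF T this] show ?thesis
        by (auto simp: rank_in_Un[OF fin finU disj])
    qed
    then have "(\<Sum>s\<in>U. int (rank_in (T \<union> U) s)) = (\<Sum>s\<in>U. int s) - int (card U) - (\<Sum>s\<in>U. int (rank_in ?A s)) + int (\<Sum>s\<in>U. rank_in U s)"
      by (simp add: sum.distrib sum_subtractf)
    then have S1: "(\<Sum>s\<in>U. int (rank_in (T \<union> U) s)) = int (\<Sum>U) - int (card U) - (\<Sum>s\<in>U. int (rank_in ?A s)) + int (card U * (card U - 1) div 2)"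
      unfolding sum_rank_in[OF finU] by simp
    have S2: "(\<Sum>s\<in>U. int (rank_in ?A s) - (int m - 1)) = (\<Sum>s\<in>U. int (rank_in ?A s)) - int (card U) * (int m - 1)"
      by (simp add: sum_subtractf)
    have "\<Sum>(T \<union> U) = \<Sum>T + \<Sum>U" using fin finU disj by (simp add: sum.union_disjoint)
    then have "(?C + int ((p + card U) * (p + card U - 1) div 2) - int ((p + card U) * N) + int (\<Sum>(T \<union> U))) + (- (\<Sum>s\<in>U. int (rank_in (T \<union> U) s)))
        = ?e + (\<Sum>s\<in>U. int (rank_in ?A s) - (int m - 1))"
      unfolding S1 S2 triangle_add using pN by (simp add: m_def of_nat_diff algebra_simps)
    then have E: "q powi (?C + int ((p + card U) * (p + card U - 1) div 2) - int ((p + card U) * N) + int (\<Sum>(T \<union> U))) * q powi (- (\<Sum>s\<in>U. int (rank_in (T \<union> U) s)))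
        = q powi ?e * q powi (\<Sum>s\<in>U. int (rank_in ?A s) - (int m - 1))"
      unfolding qp[symmetric] by (rule arg_cong)
    have P1: "(\<Prod>s\<in>U. - (q powi (- int (rank_in (T \<union> U) s)))) = (-1) ^ card U * q powi (- (\<Sum>s\<in>U. int (rank_in (T \<union> U) s)))"
      using q by (simp add: prod_uminus prod_power_int sum_negf del: of_nat_sum)
    have P2: "(\<Prod>s\<in>U. - ?x s) = (-1) ^ card U * q powi (\<Sum>s\<in>U. int (rank_in ?A s) - (int m - 1))"
      using q by (simp add: prod_uminus prod_power_int)
    show ?thesis
      unfolding scaled_c_tilde_eq[OF q n(1)] cardU P1 P2 using E by (simp only: mult_ac)
  qed
  have bij1: "bij_betw (\<lambda>i. m - 1 - i) {..<m} {..<m}"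
    by (rule bij_betw_byWitness[where f' = "\<lambda>i. m - 1 - i"]) auto
  \<comment> \<open>Reversing the rank turns the weights into q^-i with i < m.\<close>
  have bij: "bij_betw (\<lambda>s. m - 1 - rank_in ?A s) ?A {..<m}"
    using bij_betw_trans[OF bij_betw_rank_in[of ?A, unfolded cardA] bij1] by (simp add: o_def)
  have "subset_sum ?A ?x g j = subset_sum {..<m} (\<lambda>i. q powi (- int i)) g j" for g j
  proof (rule subset_sum_reindex[OF bij, symmetric])
    fix s assume "s \<in> ?A"
    then have "rank_in ?A s < m" using bij_betw_apply[OF bij_betw_rank_in, of ?A s] cardA by auto
    then show "q powi - int (m - 1 - rank_in ?A s) = ?x s"
      by (intro arg_cong[where f = "\<lambda>e. q powi e"]) auto
  qed
  moreover have "(\<Sum>U\<in>Pow ?A. scaled_c_tilde q N n (T \<union> U) * (\<Prod>s\<in>U. - (q powi (- int (rank_in (T \<union> U) s)))))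
     = (-1) ^ n * q powi ?e * subset_sum ?A ?x (\<lambda>p. q_pascal q p n) p"
    unfolding subset_sum_def sum_distrib_left by (intro sum.cong refl summand)
  ultimately have main: "(\<Sum>U\<in>Pow ?A. scaled_c_tilde q N n (T \<union> U) * (\<Prod>s\<in>U. - (q powi (- int (rank_in (T \<union> U) s)))))
     = (-1) ^ n * q powi ?e * subset_sum {..<m} (\<lambda>i. q powi (- int i)) (\<lambda>p. q_pascal q p n) p"
    by (simp only:)
  show ?thesis
  proof (cases "m < n")
    case True
    have D: "subset_sum {..<m} (\<lambda>i. q powi (- int i)) (\<lambda>p. q_pascal q p n) p
      = (-1) ^ m * q powi (int m * int p - int m * int n + int (m * (m + 1) div 2)) * q_pascal q p (n - m)"
      using True by (intro subset_sum_q_pascal[OF q]) simp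
    have p1: "1 \<le> p" using True n pN by (simp add: m_def)
    then have Tne: "T \<noteq> {}" by (auto simp: p_def)
    \<comment> \<open>Since m + p = N, the indices n - m - 1 and N - n add up to p - 1.\<close>
    have sym: "q_pascal q p (n - m) = q_pascal q p (N - n + 1)"
    proof -
      have "N - n = p - 1 - (n - m - 1)" "n - m - 1 \<le> p - 1" using True n pN p1 by (auto simp: m_def)
      then have "q_binomial q (p - 1) (N - n) = q_binomial q (p - 1) (n - m - 1)"
        using q_binomial_symmetric[of "n - m - 1" "p - 1" q] by simp
      then show ?thesis
        using True n pN p1 by (auto simp: q_pascal_def m_def)
    qed
    define k where "k = N - n"
    have mp: "m + p = n + k" using pN n by (simp add: m_def k_def)
    have kk: "2 * int ((k + 1) * (k + 1 - 1) div 2) = int k * (int k + 1)"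
      and nn: "2 * ?C = int n * (int n - 1)" and pp: "2 * int (p * (p - 1) div 2) = int p * (int p - 1)"
      and mm: "2 * int (m * (m + 1) div 2) = int m * (int m + 1)"
    proof -
      show "2 * int ((k + 1) * (k + 1 - 1) div 2) = int k * (int k + 1)" using triangle_double[of "k + 1"] by simp
      show "2 * ?C = int n * (int n - 1)" "2 * int (p * (p - 1) div 2) = int p * (int p - 1)"
        using triangle_double by auto
      have "2 * int (m * (m + 1) div 2) = 2 * int ((m + 1) * (m + 1 - 1) div 2)"
        by (simp only: add_diff_cancel_right' mult.commute)
      also have "\<dots> = int (m + 1) * (int (m + 1) - 1)" by (rule triangle_double)
      also have "\<dots> = int m * (int m + 1)" by (simp add: algebra_simps)
      finally show "2 * int (m * (m + 1) div 2) = int m * (int m + 1)" .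
    qed
    have ex: "?e + (int m * int p - int m * int n + int (m * (m + 1) div 2))
       = int ((k + 1) * (k + 1 - 1) div 2) - int (k + 1) * int p + int (\<Sum>T)"
    proof -
      have N: "int N = int n + int k" and k: "int k = int m + int p - int n" using mp n by (auto simp: k_def)
      show ?thesis
        unfolding of_nat_mult[of p] of_nat_mult[of "k + 1"] N of_nat_add of_nat_1
        by (rule exponent_identity[OF kk nn pp mm k])
    qed
    \<comment> \<open>By m + p = n + k, the numbers n + m and k + p have the same parity.\<close>
    have sgn: "(-1::real) ^ n * (-1) ^ m = - ((-1) ^ (k + 1 + p))"
    proof -
      have "(-1::real) ^ (k + 1 + p) * (-1) ^ (n + k) = (-1) ^ (k + k) * ((-1) ^ n * (-1) ^ p) * (-1)"
        by (simp add: power_add)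
      then have "(-1::real) ^ (k + 1 + p) * (-1) ^ (m + p) = - ((-1) ^ n * (-1) ^ p)"
        unfolding mp by (simp add: power_add power_mult_distrib[symmetric])
      then show ?thesis
        by (simp add: power_add minus_one_power_iff split: if_splits)
    qed
    have "(-1) ^ n * q powi ?e * ((-1) ^ m * q powi (int m * int p - int m * int n + int (m * (m + 1) div 2)) * q_pascal q p (n - m))
      = ((-1) ^ n * (-1) ^ m) * (q powi ?e * q powi (int m * int p - int m * int n + int (m * (m + 1) div 2))) * q_pascal q p (N - n + 1)"
      by (simp only: mult_ac sym)
    also have "\<dots> = - signed_c q (N - n + 1) T"
      unfolding sgn qp[symmetric] ex signed_c_eq[OF q le_add2] p_def[symmetric] k_def[symmetric] by simp
    finally show ?thesis unfolding main D using Tne by simp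
  next
    case False
    have "subset_sum ({n..<m} \<union> {..<n}) (\<lambda>i. q powi (- int i)) (\<lambda>p. q_pascal q p n) p
       = ((-1) ^ n * q powi (- ?C)) * of_bool (p = 0)"
      using subset_sum_q_pascal_full[OF q] by (intro subset_sum_Un_delta) auto
    moreover have "{n..<m} \<union> {..<n} = {..<m}" using False by auto
    ultimately have D: "subset_sum {..<m} (\<lambda>i. q powi (- int i)) (\<lambda>p. q_pascal q p n) p
       = ((-1) ^ n * q powi (- ?C)) * of_bool (p = 0)" by simp
    have "signed_c q (N - n + 1) T = 0"
      using False pN n by (simp add: signed_c_def p_def[symmetric] m_def)
    moreover have "(-1) ^ n * q powi ?C * ((-1) ^ n * q powi - ?C) = 1"
    proof -
      have 1: "q powi ?C * q powi (- ?C) = 1" unfolding qp[symmetric] by simp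
      have 2: "(-1::real) ^ n * (-1) ^ n = 1" by (simp add: power_mult_distrib[symmetric])
      have "(-1) ^ n * q powi ?C * ((-1) ^ n * q powi - ?C) = ((-1) ^ n * (-1) ^ n) * (q powi ?C * q powi - ?C)"
        by (simp only: mult_ac)
      then show ?thesis by (simp only: 1 2 mult_1)
    qed
    moreover have "p = 0 \<longleftrightarrow> T = {}" using fin by (simp add: p_def)
    ultimately show ?thesis unfolding main D by auto
  qed
qed

section \<open>The backward equation\<close>

text \<open>The mass of P outside D is weighted by probabilities, which lie between 0 and 1. Only
  entrywise derivatives of the transition function at 0 are given, so the Chapman-Kolmogorov sum is
  cut down to a finite D and the rest is controlled by its total mass.\<close>

lemma measure_bind_pmf_bounds:
  fixes P :: "'a pmf" and K :: "'a \<Rightarrow> 'b pmf"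
  assumes "finite D"
  shows "\<bar>measure (bind_pmf P K) A - (\<Sum>y\<in>D. pmf P y * measure (K y) A)\<bar> \<le> 1 - (\<Sum>y\<in>D. pmf P y)"
proof -
  let ?f = "\<lambda>y. measure (measure_pmf (K y)) A"
  have int: "integrable (measure_pmf P) ?f" "integrable (measure_pmf P) (\<lambda>y. ?f y * indicator D y)"
    "integrable (measure_pmf P) (\<lambda>y. ?f y * indicator (- D) y)" "integrable (measure_pmf P) (indicat_real (- D))"
    by (rule measure_pmf.integrable_const_bound[where B = 1]; auto simp: indicator_def)+
  have "emeasure (bind_pmf P K) A = (\<integral>\<^sup>+y. ennreal (?f y) \<partial>measure_pmf P)"
    unfolding emeasure_bind_pmf by (simp add: measure_pmf.emeasure_eq_measure)
  also have "\<dots> = ennreal (\<integral>y. ?f y \<partial>measure_pmf P)"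
    by (rule nn_integral_eq_integral[OF int(1)]) auto
  finally have "emeasure (bind_pmf P K) A = ennreal (\<integral>y. ?f y \<partial>measure_pmf P)" .
  then have "measure (bind_pmf P K) A = (\<integral>y. ?f y \<partial>measure_pmf P)"
    by (rule measure_eq_emeasure_eq_ennreal[rotated]) (auto intro!: integral_nonneg_AE)
  also have "\<dots> = (\<integral>y. ?f y * indicator D y + ?f y * indicator (- D) y \<partial>measure_pmf P)"
    by (intro Bochner_Integration.integral_cong) (auto simp: indicator_def)
  also have "\<dots> = (\<integral>y. ?f y * indicator D y \<partial>measure_pmf P) + (\<integral>y. ?f y * indicator (- D) y \<partial>measure_pmf P)"
    using int by simp
  also have "(\<integral>y. ?f y * indicator D y \<partial>measure_pmf P) = (\<Sum>y\<in>D. pmf P y * ?f y)"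
    using assms by (subst integral_measure_pmf_real[of D]) (auto simp: indicator_def mult.commute)
  finally have eq: "measure (bind_pmf P K) A - (\<Sum>y\<in>D. pmf P y * ?f y) = (\<integral>y. ?f y * indicator (- D) y \<partial>measure_pmf P)"
    by simp
  have "0 \<le> (\<integral>y. ?f y * indicator (- D) y \<partial>measure_pmf P)"
    by (intro integral_nonneg_AE) auto
  moreover have "(\<integral>y. ?f y * indicator (- D) y \<partial>measure_pmf P) \<le> (\<integral>y. indicator (- D) y \<partial>measure_pmf P)"
    by (rule integral_mono[OF int(3,4)]) (auto simp: indicator_def)
  moreover have "(\<integral>y. indicator (- D) y \<partial>measure_pmf P) = measure P (- D)" by simp
  moreover have "\<dots> = 1 - (\<Sum>y\<in>D. pmf P y)"
    using measure_pmf.prob_compl[of D P] assms by (simp add: measure_measure_pmf_finite Compl_eq_Diff_UNIV)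
  ultimately show ?thesis unfolding eq by linarith
qed

context
  fixes E :: "'s set" and Q p
  assumes tf: "transition_function E Q p"
begin

lemma transition_function_increment:
  assumes "finite D" "x \<in> D" "x \<in> E" "0 \<le> s" "0 \<le> t"
  shows "\<bar>measure (p (s + t) x) A - measure (p t x) A
      - (\<Sum>y\<in>D. (pmf (p s x) y - of_bool (y = x)) * measure (p t y) A)\<bar> \<le> 1 - (\<Sum>y\<in>D. pmf (p s x) y)"
proof -
  have "p (s + t) x = bind_pmf (p s x) (p t)"
    using tf assms unfolding transition_function_def by blast
  moreover have "(\<Sum>y\<in>D. (pmf (p s x) y - of_bool (y = x)) * measure (p t y) A)
     = (\<Sum>y\<in>D. pmf (p s x) y * measure (p t y) A) - measure (p t x) A"
  proof -
    have "(\<Sum>y\<in>D. of_bool (y = x) * measure (measure_pmf (p t y)) A) = measure (p t x) A"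
      using assms sum.delta[of D x "\<lambda>y. measure (measure_pmf (p t y)) A"]
      by (simp add: of_bool_def if_distrib[where f="\<lambda>c. c * _"] cong: if_cong)
    then show ?thesis by (simp add: left_diff_distrib sum_subtractf)
  qed
  ultimately show ?thesis
    using measure_bind_pmf_bounds[OF \<open>finite D\<close>, of "p s x" "p t" A] by simp
qed

lemma transition_function_derivative_0:
  assumes "x \<in> E" "y \<in> E"
  shows "((\<lambda>s. (pmf (p s x) y - of_bool (y = x)) / s) \<longlongrightarrow> Q x y) (at_right 0)"
proof -
  have "((\<lambda>s. pmf (p s x) y) has_real_derivative Q x y) (at_right 0)" "p 0 x = return_pmf x"
    using tf assms unfolding transition_function_def by auto
  then show ?thesis
    by (auto simp: has_field_derivative_iff pmf_return indicator_def of_bool_def split: if_splits)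
qed

lemma transition_function_stay:
  assumes "x \<in> E"
  shows "((\<lambda>s. pmf (p s x) x) \<longlongrightarrow> 1) (at_right 0)"
proof -
  have "((\<lambda>s. (pmf (p s x) x - of_bool (x = x)) / s * s) \<longlongrightarrow> Q x x * 0) (at_right 0)"
    by (intro tendsto_mult transition_function_derivative_0 assms) (auto intro: tendsto_ident_at)
  then have "((\<lambda>s. (pmf (p s x) x - of_bool (x = x)) / s * s + 1) \<longlongrightarrow> 0 + 1) (at_right 0)"
    by (intro tendsto_add) auto
  moreover have "\<forall>\<^sub>F s in at_right 0. (pmf (p s x) x - of_bool (x = x)) / s * s + 1 = pmf (p s x) x"
    unfolding eventually_at_right_field by (rule exI[of _ 1]) auto
  ultimately show ?thesis by (simp add: tendsto_cong)
qed

text \<open>For D = {x} both the error and the increment term are at most the probability of having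
  left x. The bound does not involve t, so it yields continuity from the left as well as from the
  right.\<close>

lemma transition_function_increment_le:
  assumes "x \<in> E" "0 \<le> s" "0 \<le> t"
  shows "\<bar>measure (p (s + t) x) A - measure (p t x) A\<bar> \<le> 2 * (1 - pmf (p s x) x)"
proof -
  let ?m = "measure (p t x) A"
  have "(1 - pmf (p s x) x) * ?m \<le> (1 - pmf (p s x) x) * 1"
    by (intro mult_left_mono) (auto simp: pmf_le_1)
  moreover have "0 \<le> (1 - pmf (p s x) x) * ?m" by (simp add: pmf_le_1)
  ultimately show ?thesis
    using transition_function_increment[of "{x}" x s t A] assms by (simp add: algebra_simps)
qed

lemma transition_function_tendsto_left:
  assumes "x \<in> E" "0 < t"
  shows "((\<lambda>s. measure (p (t - s) x) A) \<longlongrightarrow> measure (p t x) A) (at_right 0)"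
proof (rule Lim_transform2)
  show "((\<lambda>s. measure (p t x) A) \<longlongrightarrow> measure (p t x) A) (at_right 0)" by simp
  have *: "((\<lambda>s. 2 * (1 - pmf (p s x) x)) \<longlongrightarrow> 2 * (1 - 1)) (at_right 0)"
    by (intro tendsto_intros transition_function_stay assms)
  have "\<forall>\<^sub>F s in at_right 0. norm (measure (p t x) A - measure (p (t - s) x) A) \<le> 2 * (1 - pmf (p s x) x)"
    unfolding eventually_at_right_field
  proof (rule exI[of _ t], intro conjI allI impI)
    fix s assume "0 < s" "s < t"
    then show "norm (measure (p t x) A - measure (p (t - s) x) A) \<le> 2 * (1 - pmf (p s x) x)"
      using transition_function_increment_le[of x s "t - s" A] assms by simp
  qed (use assms in auto)
  then show "((\<lambda>s. measure (p t x) A - measure (p (t - s) x) A) \<longlongrightarrow> 0) (at_right 0)"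
    by (rule Lim_null_comparison) (use * in simp)
qed

lemma transition_function_tendsto_right:
  assumes "x \<in> E" "0 \<le> t"
  shows "((\<lambda>s. measure (p (s + t) x) A) \<longlongrightarrow> measure (p t x) A) (at_right 0)"
proof (rule Lim_transform2)
  show "((\<lambda>s. measure (p t x) A) \<longlongrightarrow> measure (p t x) A) (at_right 0)" by simp
  have *: "((\<lambda>s. 2 * (1 - pmf (p s x) x)) \<longlongrightarrow> 2 * (1 - 1)) (at_right 0)"
    by (intro tendsto_intros transition_function_stay assms)
  have "\<forall>\<^sub>F s in at_right 0. norm (measure (p t x) A - measure (p (s + t) x) A) \<le> 2 * (1 - pmf (p s x) x)"
    unfolding eventually_at_right_field
  proof (rule exI[of _ 1], intro conjI allI impI)
    fix s :: real assume "0 < s" "s < 1"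
    then show "norm (measure (p t x) A - measure (p (s + t) x) A) \<le> 2 * (1 - pmf (p s x) x)"
      using transition_function_increment_le[of x s t A] assms by (simp add: abs_minus_commute)
  qed auto
  then show "((\<lambda>s. measure (p t x) A - measure (p (s + t) x) A) \<longlongrightarrow> 0) (at_right 0)"
    by (rule Lim_null_comparison) (use * in simp)
qed

lemma transition_function_continuous:
  assumes "x \<in> E"
  shows "continuous_on {0..} (\<lambda>t. measure (p t x) A)"
  unfolding continuous_on_def
proof
  fix t :: real assume "t \<in> {0..}"
  have R: "((\<lambda>t. measure (p t x) A) \<longlongrightarrow> measure (p t x) A) (at_right t)"
    using transition_function_tendsto_right[OF assms, of t A] \<open>t \<in> {0..}\<close>
    by (subst filterlim_at_right_to_0) auto
  show "((\<lambda>t. measure (p t x) A) \<longlongrightarrow> measure (p t x) A) (at t within {0..})"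
  proof (cases "t = 0")
    case True
    have "at (0::real) within {0..} = at_right 0"
      by (rule at_within_nhd[of _ "{-1<..<1}"]) auto
    then show ?thesis using R True by simp
  next
    case False
    then have "0 < t" using \<open>t \<in> {0..}\<close> by auto
    have "((\<lambda>t. measure (p t x) A) \<longlongrightarrow> measure (p t x) A) (at_left t)"
      using transition_function_tendsto_left[OF assms \<open>0 < t\<close>, of A]
      unfolding filterlim_at_left_to_right[of _ _ t]
      by (subst filterlim_at_right_to_0) auto
    with R have "((\<lambda>t. measure (p t x) A) \<longlongrightarrow> measure (p t x) A) (at t)"
      by (simp add: filterlim_at_split)
    then show ?thesis by (rule tendsto_within_subset) simp
  qed
qed

text \<open>Divided by s, the error of the finite sum is at most minus the sum over D of the
  difference quotients at 0, which tends to minus the row sum, that is to 0. The base time \<tau> s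
  is t for the right derivative and t - s for the left one.\<close>

lemma transition_function_increment_rate:
  assumes "finite D" "x \<in> D" "D \<subseteq> E" and Q0: "(\<Sum>y\<in>D. Q x y) = 0"
    and lim: "\<And>y. y \<in> D \<Longrightarrow> ((\<lambda>s. measure (p (\<tau> s) y) A) \<longlongrightarrow> measure (p t y) A) (at_right 0)"
    and \<tau>: "\<forall>\<^sub>F s in at_right 0. 0 \<le> \<tau> s"
  shows "((\<lambda>s. (measure (p (s + \<tau> s) x) A - measure (p (\<tau> s) x) A) / s)
     \<longlongrightarrow> (\<Sum>y\<in>D. Q x y * measure (p t y) A)) (at_right 0)"
proof (rule Lim_transform2)
  let ?c = "\<lambda>s y. pmf (p s x) y - of_bool (y = x)"
  have c: "((\<lambda>s. ?c s y / s) \<longlongrightarrow> Q x y) (at_right 0)" if "y \<in> D" for y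
    using that assms by (intro transition_function_derivative_0) auto
  then show "((\<lambda>s. \<Sum>y\<in>D. ?c s y / s * measure (p (\<tau> s) y) A) \<longlongrightarrow> (\<Sum>y\<in>D. Q x y * measure (p t y) A)) (at_right 0)"
    by (intro tendsto_sum tendsto_mult lim)
  have *: "((\<lambda>s. - (\<Sum>y\<in>D. ?c s y / s)) \<longlongrightarrow> - (\<Sum>y\<in>D. Q x y)) (at_right 0)"
    by (intro tendsto_minus tendsto_sum c)
  have "\<forall>\<^sub>F s in at_right 0. norm ((\<Sum>y\<in>D. ?c s y / s * measure (p (\<tau> s) y) A)
        - (measure (p (s + \<tau> s) x) A - measure (p (\<tau> s) x) A) / s) \<le> - (\<Sum>y\<in>D. ?c s y / s)"
    using \<tau> eventually_at_right_less[of "0::real"]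
  proof eventually_elim
    case (elim s)
    let ?S = "\<Sum>y\<in>D. ?c s y * measure (p (\<tau> s) y) A" and ?d = "measure (p (s + \<tau> s) x) A - measure (p (\<tau> s) x) A"
    have 1: "\<bar>?d - ?S\<bar> \<le> 1 - (\<Sum>y\<in>D. pmf (p s x) y)"
      using elim assms by (intro transition_function_increment) auto
    have "(\<Sum>y\<in>D. ?c s y) = (\<Sum>y\<in>D. pmf (p s x) y) - (\<Sum>y\<in>D. of_bool (y = x))"
      by (simp add: sum_subtractf)
    also have "(\<Sum>y\<in>D. of_bool (y = x)) = (1::real)"
      using assms sum.delta[of D x "\<lambda>_. 1::real"] by (simp add: of_bool_def)
    finally have 2: "- (\<Sum>y\<in>D. ?c s y) = 1 - (\<Sum>y\<in>D. pmf (p s x) y)" by simp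
    have "norm ((\<Sum>y\<in>D. ?c s y / s * measure (p (\<tau> s) y) A) - ?d / s) = \<bar>?S / s - ?d / s\<bar>"
      by (simp add: sum_divide_distrib)
    also have "\<dots> = \<bar>?d - ?S\<bar> / s"
      using elim by (simp add: diff_divide_distrib [symmetric] abs_minus_commute)
    also have "\<dots> \<le> - (\<Sum>y\<in>D. ?c s y) / s"
      unfolding 2 using 1 elim by (intro divide_right_mono) auto
    finally show ?case by (simp add: sum_divide_distrib)
  qed
  then show "((\<lambda>s. (\<Sum>y\<in>D. ?c s y / s * measure (p (\<tau> s) y) A)
        - (measure (p (s + \<tau> s) x) A - measure (p (\<tau> s) x) A) / s) \<longlongrightarrow> 0) (at_right 0)"
    by (rule Lim_null_comparison) (use * Q0 in simp)
qed

lemma transition_function_backward: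
  assumes D: "finite D" "x \<in> D" "D \<subseteq> E" "(\<Sum>y\<in>D. Q x y) = 0" and "0 < t"
  shows "((\<lambda>t. measure (p t x) A) has_real_derivative (\<Sum>y\<in>D. Q x y * measure (p t y) A)) (at t)"
  unfolding has_field_derivative_iff filterlim_at_split
proof
  have "((\<lambda>s. (measure (p (s + t) x) A - measure (p t x) A) / s)
     \<longlongrightarrow> (\<Sum>y\<in>D. Q x y * measure (p t y) A)) (at_right 0)"
    using D \<open>0 < t\<close> by (intro transition_function_increment_rate[where \<tau> = "\<lambda>_. t"]) auto
  then show "((\<lambda>y. (measure (p y x) A - measure (p t x) A) / (y - t)) \<longlongrightarrow> (\<Sum>y\<in>D. Q x y * measure (p t y) A)) (at_right t)"
    by (subst filterlim_at_right_to_0) simp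
  have "\<forall>\<^sub>F s in at_right 0. 0 \<le> t - s"
    unfolding eventually_at_right_field using \<open>0 < t\<close> by (intro exI[of _ t]) auto
  then have "((\<lambda>s. (measure (p (s + (t - s)) x) A - measure (p (t - s) x) A) / s)
     \<longlongrightarrow> (\<Sum>y\<in>D. Q x y * measure (p t y) A)) (at_right 0)"
    using D \<open>0 < t\<close> by (intro transition_function_increment_rate transition_function_tendsto_left) auto
  then show "((\<lambda>y. (measure (p y x) A - measure (p t x) A) / (y - t)) \<longlongrightarrow> (\<Sum>y\<in>D. Q x y * measure (p t y) A)) (at_left t)"
    unfolding filterlim_at_left_to_right[of _ _ t]
  proof (subst filterlim_at_right_to_0, elim filterlim_mono_eventually[OF _ order_refl order_refl], intro always_eventually allI)
    fix s
    show "(measure (p (s + (t - s)) x) A - measure (p (t - s) x) A) / s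
        = (measure (p (- (s + - t)) x) A - measure (p t x) A) / (- (s + - t) - t)"
      by (cases "s = 0") (auto simp: field_simps)
  qed
qed

end

text \<open>A bound B on g over a short interval bounds the derivative by 2 \<Lambda> B, because the
  rates out of each state sum to at most \<Lambda>; integrating from a time at which g vanishes
  improves B to B / 2. Iteration gives g = 0 there, and finitely many such intervals reach
  T.\<close>

lemma backward_equation_unique:
  fixes g :: "real \<Rightarrow> 's \<Rightarrow> complex" and r :: "'s \<Rightarrow> 'z \<Rightarrow> real"
  assumes J: "\<And>x z. x \<in> A \<Longrightarrow> z \<in> Z x \<Longrightarrow> J x z \<in> A"
    and r: "\<And>x z. x \<in> A \<Longrightarrow> z \<in> Z x \<Longrightarrow> 0 \<le> r x z" "\<And>x. x \<in> A \<Longrightarrow> (\<Sum>z\<in>Z x. r x z) \<le> \<Lambda>"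
    and cont: "\<And>x. x \<in> A \<Longrightarrow> continuous_on {0..} (\<lambda>t. g t x)"
    and der: "\<And>x t. x \<in> A \<Longrightarrow> 0 < t \<Longrightarrow> ((\<lambda>t. g t x) has_vector_derivative
        (\<Sum>z\<in>Z x. of_real (r x z) * (g t (J x z) - g t x))) (at t)"
    and g0: "\<And>x. x \<in> A \<Longrightarrow> g 0 x = 0"
    and G: "\<And>t x. x \<in> A \<Longrightarrow> 0 \<le> t \<Longrightarrow> t \<le> T \<Longrightarrow> norm (g t x) \<le> G"
    and \<Lambda>: "0 < \<Lambda>" and x: "x \<in> A" and t: "0 \<le> t" "t \<le> T"
  shows "g t x = 0"
proof -
  \<comment> \<open>This length makes the increment 2 \<Lambda> B h equal to B / 2.\<close>
  define h where "h = 1 / (4 * \<Lambda>)"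
  have h: "0 < h" "4 * \<Lambda> * h = 1" using \<Lambda> by (auto simp: h_def)
  have step: "\<forall>x\<in>A. g b x = 0" if a: "0 \<le> a" "\<forall>x\<in>A. g a x = 0" and b: "a \<le> b" "b \<le> a + h" "b \<le> T" for a b
  proof -
    have bound: "\<forall>x\<in>A. \<forall>t\<in>{a..b}. norm (g t x) \<le> G * (1/2) ^ k" for k
    proof (induction k)
      case 0
      then show ?case using G a b by auto
    next
      case (Suc k)
      show ?case
      proof (intro ballI)
        fix x t assume x: "x \<in> A" and t: "t \<in> {a..b}"
        define B where "B = G * (1/2) ^ k"
        have B0: "0 \<le> B" using Suc.IH x t norm_ge_zero[of "g t x"] unfolding B_def by (meson order_trans)
        show "norm (g t x) \<le> G * (1/2) ^ Suc k"
        proof (cases "t = a")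
          case True
          then show ?thesis using a x B0 by (simp add: B_def)
        next
          case False
          then have "a < t" using t by auto
          have "norm (g t x - g a x) \<le> (2 * \<Lambda> * B) * t - (2 * \<Lambda> * B) * a"
          proof (rule differentiable_bound_general[OF \<open>a < t\<close>])
            show "continuous_on {a..t} (\<lambda>t. g t x)"
              by (rule continuous_on_subset[OF cont[OF x]]) (use a in auto)
            fix s assume s: "a < s" "s < t"
            show "((\<lambda>t. g t x) has_vector_derivative
               (\<Sum>z\<in>Z x. of_real (r x z) * (g s (J x z) - g s x))) (at s)"
              using s a x by (intro der) auto
            have gs: "norm (g s y) \<le> B" if "y \<in> A" for y
              using Suc.IH that s t unfolding B_def by auto
            have "norm (\<Sum>z\<in>Z x. of_real (r x z) * (g s (J x z) - g s x)) \<le> (\<Sum>z\<in>Z x. r x z * (2 * B))"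
            proof (rule sum_norm_le)
              fix z assume z: "z \<in> Z x"
              have "norm (g s (J x z) - g s x) \<le> 2 * B"
                using norm_triangle_ineq4[of "g s (J x z)" "g s x"] gs[OF x] gs[OF J[OF x z]] by linarith
              then show "norm (of_real (r x z) * (g s (J x z) - g s x)) \<le> r x z * (2 * B)"
                using r(1)[OF x z] by (simp add: norm_mult mult_left_mono)
            qed
            also have "\<dots> = (\<Sum>z\<in>Z x. r x z) * (2 * B)" by (simp add: sum_distrib_right)
            also have "\<dots> \<le> \<Lambda> * (2 * B)" using r(2)[OF x] B0 by (intro mult_right_mono) auto
            finally show "norm (\<Sum>z\<in>Z x. of_real (r x z) * (g s (J x z) - g s x)) \<le> 2 * \<Lambda> * B" by simp
          qed (auto intro!: derivative_eq_intros continuous_intros simp: has_vector_derivative_def)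
          also have "\<dots> = 2 * \<Lambda> * B * (t - a)" by (simp add: algebra_simps)
          also have "\<dots> \<le> 2 * \<Lambda> * B * h" using \<Lambda> B0 t b by (intro mult_left_mono) auto
          also have "\<dots> = (4 * \<Lambda> * h) * B / 2" by simp
          finally show ?thesis using a x unfolding h B_def by simp
        qed
      qed
    qed
    show ?thesis
    proof
      fix x assume x: "x \<in> A"
      have "(\<lambda>k. G * (1/2) ^ k) \<longlonglongrightarrow> G * 0"
        by (intro tendsto_intros LIMSEQ_power_zero) auto
      moreover have "norm (g b x) \<le> G * (1/2) ^ k" for k
        using bound[of k] x b by auto
      ultimately have "norm (g b x) \<le> 0"
        by (intro LIMSEQ_le_const[of _ _ "norm (g b x)"]) auto
      then show "g b x = 0" by simp
    qed
  qed
  have main: "\<forall>x\<in>A. g s x = 0" if "0 \<le> s" "s \<le> T" "s \<le> real m * h" for s m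
    using that
  proof (induction m arbitrary: s)
    case 0
    then show ?case using g0 by auto
  next
    case (Suc m)
    show ?case
    proof (cases "s \<le> real m * h")
      case True
      then show ?thesis using Suc by auto
    next
      case False
      have mh: "0 \<le> real m * h" using h by simp
      show ?thesis
      proof (rule step)
        show "\<forall>x\<in>A. g (real m * h) x = 0" using Suc.IH[of "real m * h"] Suc.prems False mh by auto
      qed (use Suc.prems False mh in \<open>auto simp: algebra_simps\<close>)
    qed
  qed
  obtain m where "T / h \<le> real m" using real_arch_simple by blast
  then have "T \<le> real m * h" using h by (simp add: divide_le_eq)
  then show ?thesis using main[of t m] t x by auto
qed

section \<open>The q-TAZRP\<close>

text \<open>The Markov equation with the single time 0 and state y gives the point probabilities, as
  X 0 = y almost surely. Since E is countable, summing over points gives the probabilities of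
  events.\<close>

lemma markov_jump_process_marginal:
  assumes mj: "markov_jump_process E Q y P X" and "countable E" "y \<in> E"
  obtains p where "transition_function E Q p"
    and "\<And>t A. 0 \<le> t \<Longrightarrow> measure P {\<omega> \<in> space P. X t \<omega> \<in> A} = measure (p t y) A"
proof -
  interpret prob_space P using mj by (simp add: markov_jump_process_def)
  have X[measurable]: "X t \<in> measurable P (count_space E)" if "0 \<le> t" for t
    using mj that by (simp add: markov_jump_process_def)
  have X0: "AE \<omega> in P. X 0 \<omega> = y" using mj by (simp add: markov_jump_process_def)
  obtain p where tf: "transition_function E Q p"
    and M: "\<And>(m::nat) t x s z. 0 \<le> t 0 \<Longrightarrow> mono_on {..m} t \<Longrightarrow> x \<in> {..m} \<rightarrow> E \<Longrightarrow> 0 \<le> s \<Longrightarrow> z \<in> E \<Longrightarrow>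
          measure P {\<omega> \<in> space P. (\<forall>i\<le>m. X (t i) \<omega> = x i) \<and> X (t m + s) \<omega> = z} =
          measure P {\<omega> \<in> space P. \<forall>i\<le>m. X (t i) \<omega> = x i} * pmf (p s (x m)) z"
    using mj unfolding markov_jump_process_def by blast
  have sets: "{\<omega> \<in> space P. X t \<omega> \<in> B} \<in> sets P" if "0 \<le> t" "B \<subseteq> E" for t B
    using measurable_sets[OF X[OF that(1)], of B] that(2) by (simp add: vimage_def Int_def conj_commute)
  have single: "measure P {\<omega> \<in> space P. X t \<omega> = z} = pmf (p t y) z" if t: "0 \<le> t" and z: "z \<in> E" for t z
  proof -
    have s0: "{\<omega> \<in> space P. X 0 \<omega> = y} \<in> sets P" and st: "{\<omega> \<in> space P. X t \<omega> = z} \<in> sets P"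
      using sets[of 0 "{y}"] sets[of t "{z}"] t z \<open>y \<in> E\<close> by auto
    have "measure P {\<omega> \<in> space P. X 0 \<omega> = y} = 1"
      using X0 s0 by (subst prob_eq_1) auto
    moreover have "measure P {\<omega> \<in> space P. X 0 \<omega> = y \<and> X t \<omega> = z} = measure P {\<omega> \<in> space P. X t \<omega> = z}"
    proof (rule finite_measure_eq_AE)
      show "{\<omega> \<in> space P. X 0 \<omega> = y \<and> X t \<omega> = z} \<in> sets P"
        using sets.Int[OF s0 st] by (auto simp: Int_def conj_ac cong: conj_cong)
    qed (use X0 st in auto)
    ultimately show ?thesis
      using M[of "\<lambda>_. 0" 0 "\<lambda>_. y" t z] t z \<open>y \<in> E\<close> by (simp add: mono_on_def)
  qed
  have "measure P {\<omega> \<in> space P. X t \<omega> \<in> A} = measure (p t y) A" if t: "0 \<le> t" for t A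
  proof -
    let ?A = "A \<inter> E" and ?D = "distr P (count_space E) (X t)"
    have cnt: "countable ?A" using \<open>countable E\<close> by auto
    have D: "emeasure ?D B = emeasure P {\<omega> \<in> space P. X t \<omega> \<in> B}" if "B \<subseteq> E" for B
      using that t by (subst emeasure_distr) (auto intro!: arg_cong[where f = "emeasure P"])
    have "emeasure P {\<omega> \<in> space P. X t \<omega> \<in> ?A} = emeasure ?D ?A" by (rule D[symmetric]) simp
    also have "\<dots> = (\<integral>\<^sup>+z. emeasure ?D {z} \<partial>count_space ?A)"
      using cnt by (intro emeasure_countable_singleton) auto
    also have "\<dots> = (\<integral>\<^sup>+z. emeasure (p t y) {z} \<partial>count_space ?A)"
    proof (rule nn_integral_cong)
      fix z assume "z \<in> space (count_space ?A)"
      then have "z \<in> E" by simp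
      then show "emeasure ?D {z} = emeasure (p t y) {z}"
        using single[OF t, of z] by (simp add: D emeasure_eq_measure emeasure_pmf_single)
    qed
    also have "\<dots> = emeasure (p t y) ?A"
      using cnt by (intro emeasure_countable_singleton[symmetric]) auto
    finally have "measure P {\<omega> \<in> space P. X t \<omega> \<in> ?A} = measure (p t y) ?A"
      by (simp add: measure_def)
    moreover have "{\<omega> \<in> space P. X t \<omega> \<in> ?A} = {\<omega> \<in> space P. X t \<omega> \<in> A}"
      using measurable_space[OF X[OF t]] by auto
    moreover have "measure (p t y) ?A = measure (p t y) A"
    proof -
      have "set_pmf (p t y) \<subseteq> E" using tf t \<open>y \<in> E\<close> by (auto simp: transition_function_def)
      then have "?A \<inter> set_pmf (p t y) = A \<inter> set_pmf (p t y)" by auto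
      then show ?thesis by (metis measure_Int_set_pmf)
    qed
    ultimately show ?thesis by simp
  qed
  with tf show ?thesis by (rule that)
qed

lemma countable_weyl_chamber: "countable (weyl_chamber N)"
  unfolding weyl_chamber_def
  by (rule countable_subset[of _ "{1..N} \<rightarrow>\<^sub>E UNIV"]) (auto intro!: countable_PiE)

lemma Min_labels_at:
  assumes "z \<in> Y ` {1..N}"
  shows "Min (labels_at N Y z) \<in> {1..N}" "Y (Min (labels_at N Y z)) = z"
proof -
  have "labels_at N Y z \<noteq> {}" "finite (labels_at N Y z)" using assms by (auto simp: labels_at_def)
  then have "Min (labels_at N Y z) \<in> labels_at N Y z" by (rule Min_in[rotated])
  then show "Min (labels_at N Y z) \<in> {1..N}" "Y (Min (labels_at N Y z)) = z"
    by (auto simp: labels_at_def)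
qed

text \<open>Labels below the smallest one at z sit at z + 1 or further right, so raising that one by
  1 keeps the order.\<close>

lemma jump_from_weyl_chamber:
  assumes Y: "Y \<in> weyl_chamber N" and z: "z \<in> Y ` {1..N}"
  shows "jump_from N Y z \<in> weyl_chamber N"
proof -
  let ?m = "Min (labels_at N Y z)"
  note m = Min_labels_at[OF z]
  have mono: "\<And>i j. i \<in> {1..N} \<Longrightarrow> j \<in> {1..N} \<Longrightarrow> i \<le> j \<Longrightarrow> Y j \<le> Y i"
    using Y by (auto simp: weyl_chamber_def)
  have less: "z + 1 \<le> Y i" if "i \<in> {1..N}" "i < ?m" for i
  proof -
    have "finite (labels_at N Y z)" by (simp add: labels_at_def)
    then have "i \<notin> labels_at N Y z" using that(2) by (meson Min_le leD)
    then have "Y i \<noteq> z" using that by (simp add: labels_at_def)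
    moreover have "z \<le> Y i" using mono[of i ?m] that m by auto
    ultimately show ?thesis by simp
  qed
  have Y1: "Y \<in> {1..N} \<rightarrow>\<^sub>E UNIV" using Y by (simp add: weyl_chamber_def)
  have "jump_from N Y z j \<le> jump_from N Y z i" if "i \<in> {1..N}" "j \<in> {1..N}" "i \<le> j" for i j
    using mono[OF that] mono[of ?m j] mono[of i ?m] less[of i] that m
    by (auto simp: jump_from_def)
  then show ?thesis
    using Y1 m(1) by (auto simp: weyl_chamber_def jump_from_def PiE_def extensional_def)
qed

text \<open>Row Y of the generator lives on Y and its jump targets. The case f = 1 is the vanishing
  row sum that \<open>transition_function_backward\<close> asks for.\<close>

lemma qtazrp_generator_sum:
  assumes "finite D" "Y \<in> D" "jump_from N Y ` Y ` {1..N} \<subseteq> D"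
  shows "(\<Sum>y\<in>D. qtazrp_generator q a N Y y * f y)
     = (\<Sum>z\<in>Y ` {1..N}. jump_rate q a N Y z * (f (jump_from N Y z) - f Y))"
proof -
  have delta: "(\<Sum>y\<in>D. of_bool (y = x) * f y) = f x" if "x \<in> D" for x
    using that assms(1) sum.delta[of D x f] by (simp add: of_bool_def if_distrib[where f = "\<lambda>c. c * _"] cong: if_cong)
  have "(\<Sum>y\<in>D. qtazrp_generator q a N Y y * f y)
     = (\<Sum>y\<in>D. \<Sum>z\<in>Y ` {1..N}. jump_rate q a N Y z * (of_bool (y = jump_from N Y z) * f y - of_bool (y = Y) * f y))"
    unfolding qtazrp_generator_def sum_distrib_right by (simp add: algebra_simps)
  also have "\<dots> = (\<Sum>z\<in>Y ` {1..N}. jump_rate q a N Y z * (\<Sum>y\<in>D. of_bool (y = jump_from N Y z) * f y - of_bool (y = Y) * f y))"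
    by (subst sum.swap) (simp add: sum_distrib_left)
  also have "\<dots> = (\<Sum>z\<in>Y ` {1..N}. jump_rate q a N Y z * (f (jump_from N Y z) - f Y))"
  proof (intro sum.cong refl)
    fix z assume "z \<in> Y ` {1..N}"
    then have "jump_from N Y z \<in> D" using assms(3) by auto
    then show "jump_rate q a N Y z * (\<Sum>y\<in>D. of_bool (y = jump_from N Y z) * f y - of_bool (y = Y) * f y)
        = jump_rate q a N Y z * (f (jump_from N Y z) - f Y)"
      using assms(2) by (simp only: sum_subtractf delta)
  qed
  finally show ?thesis .
qed

lemma qtazrp_backward:
  assumes tf: "transition_function (weyl_chamber N) (qtazrp_generator q a N) p"
    and Y: "Y \<in> weyl_chamber N" and t: "0 < t"
  shows "((\<lambda>t. measure (p t Y) A) has_real_derivative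
     (\<Sum>z\<in>Y ` {1..N}. jump_rate q a N Y z * (measure (p t (jump_from N Y z)) A - measure (p t Y) A))) (at t)"
proof -
  define D where "D = insert Y (jump_from N Y ` Y ` {1..N})"
  have D: "finite D" "Y \<in> D" "jump_from N Y ` Y ` {1..N} \<subseteq> D" "D \<subseteq> weyl_chamber N"
    using Y jump_from_weyl_chamber[OF Y] by (auto simp: D_def)
  have "(\<Sum>y\<in>D. qtazrp_generator q a N Y y) = 0"
    using qtazrp_generator_sum[OF D(1-3), of q a "\<lambda>_. 1"] by simp
  from transition_function_backward[OF tf D(1,2,4) this t, of A] show ?thesis
    by (simp add: qtazrp_generator_sum[OF D(1-3)])
qed

section \<open>Nested contour integrals\<close>

definition cross_factor :: "real \<Rightarrow> complex \<Rightarrow> complex \<Rightarrow> complex" where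
  "cross_factor q z w = (z - w) / (of_real q * z - w)"

lemma B_fun_Nil [simp]: "B_fun q [] = 1"
  by (simp add: B_fun_def)

lemma B_fun_Cons: "B_fun q (z # w) = (\<Prod>i<length w. cross_factor q z (w ! i)) * B_fun q w"
  unfolding B_fun_def cross_factor_def
  by (simp add: prod.lessThan_Suc_shift prod.distrib[symmetric] del: prod.lessThan_Suc)

text \<open>Fixing the outermost variable z turns its cross factors with the later variables into
  functions of one variable each. Absorbing them keeps the integrand of the form
  \<open>B_fun\<close> times a product, so induction over the variables only has to carry a list of
  functions.\<close>

primrec nested_integral :: "real \<Rightarrow> (real \<Rightarrow> complex) list \<Rightarrow> (complex \<Rightarrow> complex) list \<Rightarrow> complex" where
  "nested_integral q [] fs = 1"
| "nested_integral q (\<gamma> # \<gamma>s) fs = 1 / (2 * of_real pi * \<i>) *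
     contour_integral \<gamma> (\<lambda>z. hd fs z / z * nested_integral q \<gamma>s (map (\<lambda>g w. cross_factor q z w * g w) (tl fs)))"

text \<open>Both sides are 0 when f is not integrable along the curve. Hence constants can be moved
  through iterated integrals whose inner integrals are not known to be integrable.\<close>

lemma contour_integral_mult_left: "contour_integral \<gamma> (\<lambda>z. c * f z) = c * contour_integral \<gamma> f"
  by (simp add: contour_integral_integral mult.assoc)

lemma iterated_contour_integral_cong:
  "(\<And>w. length w = length \<gamma>s \<Longrightarrow> f w = g w) \<Longrightarrow>
    iterated_contour_integral \<gamma>s f = iterated_contour_integral \<gamma>s g"
proof (induction \<gamma>s arbitrary: f g)
  case (Cons \<gamma> \<gamma>s)
  have "iterated_contour_integral \<gamma>s (\<lambda>zs. f (z # zs)) = iterated_contour_integral \<gamma>s (\<lambda>zs. g (z # zs))" for z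
    using Cons.prems by (intro Cons.IH) simp
  then show ?case by simp
qed simp

lemma iterated_contour_integral_mult_left:
  "iterated_contour_integral \<gamma>s (\<lambda>w. c * f w) = c * iterated_contour_integral \<gamma>s f"
  by (induction \<gamma>s arbitrary: f) (simp_all add: contour_integral_mult_left)

lemma log_contour_integral_eq_nested_integral:
  assumes "length fs = length \<gamma>s"
  shows "log_contour_integral \<gamma>s (\<lambda>w. B_fun q w * (\<Prod>i<length fs. (fs ! i) (w ! i))) = nested_integral q \<gamma>s fs"
  using assms
proof (induction \<gamma>s arbitrary: fs)
  case Nil
  then show ?case by (simp add: log_contour_integral_def)
next
  case (Cons \<gamma> \<gamma>s)
  obtain f fs' where fs: "fs = f # fs'" and len: "length fs' = length \<gamma>s"
    using Cons.prems by (cases fs) auto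
  let ?G = "\<lambda>fs w. (\<Prod>i<length fs. 1 / w ! i) * (B_fun q w * (\<Prod>i<length fs. (fs ! i) (w ! i)))"
  let ?fs = "\<lambda>z. map (\<lambda>g w. cross_factor q z w * g w) fs'"
  have G: "?G (f # fs') (z # w) = f z / z * ?G (?fs z) w" if "length w = length \<gamma>s" for z w
    using that len
    by (simp add: prod.lessThan_Suc_shift B_fun_Cons prod.distrib del: prod.lessThan_Suc)
  have IH: "iterated_contour_integral \<gamma>s (?G (?fs z)) = (2 * of_real pi * \<i>) ^ length \<gamma>s * nested_integral q \<gamma>s (?fs z)" for z
  proof -
    let ?c = "(2 * of_real pi * \<i>) ^ length \<gamma>s :: complex" and ?I = "iterated_contour_integral \<gamma>s (?G (?fs z))"
    have len': "length (?fs z) = length \<gamma>s" using len by simp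
    have "1 / ?c * ?I = nested_integral q \<gamma>s (?fs z)"
      using Cons.IH[OF len'] unfolding log_contour_integral_def len' .
    moreover have "?I = ?c * (1 / ?c * ?I)" by simp
    ultimately show ?thesis by simp
  qed
  have "iterated_contour_integral (\<gamma> # \<gamma>s) (?G fs)
     = contour_integral \<gamma> (\<lambda>z. iterated_contour_integral \<gamma>s (\<lambda>w. f z / z * ?G (?fs z) w))"
    unfolding fs iterated_contour_integral.simps
    by (intro arg_cong[where f = "contour_integral \<gamma>"] ext iterated_contour_integral_cong G)
  also have "\<dots> = contour_integral \<gamma> (\<lambda>z. (2 * of_real pi * \<i>) ^ length \<gamma>s * (f z / z * nested_integral q \<gamma>s (?fs z)))"
    unfolding iterated_contour_integral_mult_left IH by (simp only: mult_ac)
  also have "\<dots> = (2 * of_real pi * \<i>) ^ length \<gamma>s * contour_integral \<gamma> (\<lambda>z. f z / z * nested_integral q \<gamma>s (?fs z))"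
    by (rule contour_integral_mult_left)
  finally show ?case
    using Cons.prems by (simp add: log_contour_integral_def fs)
qed

section \<open>Means over a circle, where dw / (2 pi i w) is the uniform measure dx\<close>

definition circle_mean :: "real \<Rightarrow> (complex \<Rightarrow> complex) \<Rightarrow> complex" where
  "circle_mean R f = integral {0..1} (\<lambda>x. f (circlepath 0 R x))"

lemma norm_circlepath_0 [simp]: "0 < R \<Longrightarrow> norm (circlepath 0 R x) = R"
  by (simp add: circlepath norm_mult)

lemma circle_mean_cong: "0 < R \<Longrightarrow> (\<And>z. norm z = R \<Longrightarrow> f z = g z) \<Longrightarrow> circle_mean R f = circle_mean R g"
  unfolding circle_mean_def by (intro integral_cong) simp

lemma circle_mean_mult_left: "circle_mean R (\<lambda>z. c * f z) = c * circle_mean R f"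
  by (simp add: circle_mean_def)

lemma continuous_on_circlepath [continuous_intros]:
  "continuous_on A f \<Longrightarrow> continuous_on A (\<lambda>x. circlepath 0 R (f x))"
  unfolding circlepath by (intro continuous_intros)

lemma continuous_on_sphere_circlepath:
  assumes "0 < R" "continuous_on (sphere 0 R) f" "continuous_on A g"
  shows "continuous_on A (\<lambda>x. f (circlepath 0 R (g x)))"
  by (rule continuous_on_compose2[OF assms(2)]) (use assms in \<open>auto intro!: continuous_intros\<close>)

lemma circle_mean_integrable:
  fixes f :: "complex \<Rightarrow> complex"
  assumes "0 < R" "continuous_on (sphere 0 R) f"
  shows "(\<lambda>x. f (circlepath 0 R x)) integrable_on {0..1}"
proof (rule integrable_continuous_real)
  show "continuous_on {0..1} (\<lambda>x. f (circlepath 0 R x))"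
    using continuous_on_sphere_circlepath[OF assms continuous_on_id'] by auto
qed

lemma contour_integral_circle_mean:
  assumes "0 < R"
  shows "contour_integral (circlepath 0 R) (\<lambda>z. f z / z) = 2 * of_real pi * \<i> * circle_mean R f"
proof -
  have "f (circlepath 0 R x) / circlepath 0 R x * vector_derivative (circlepath 0 R) (at x)
      = 2 * of_real pi * \<i> * f (circlepath 0 R x)" for x
    unfolding vector_derivative_circlepath using assms by (simp add: circlepath field_simps)
  then show ?thesis
    by (simp add: contour_integral_integral circle_mean_def)
qed

lemma circle_mean_holomorphic:
  assumes R: "0 < R" and f: "f holomorphic_on cball 0 R"
  shows "circle_mean R f = f 0"
proof -
  have "((\<lambda>u. f u / (u - 0)) has_contour_integral (2 * of_real pi * \<i> * f 0)) (circlepath 0 R)"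
    using R f by (intro Cauchy_integral_circlepath holomorphic_on_imp_continuous_on) (auto intro: holomorphic_on_subset)
  then have "contour_integral (circlepath 0 R) (\<lambda>u. f u / u) = 2 * of_real pi * \<i> * f 0"
    by (simp add: contour_integral_unique)
  then show ?thesis by (simp add: contour_integral_circle_mean[OF R])
qed

text \<open>This is the residue at infinity. Inversion maps the circle of radius R to that of radius
  1 / R with reversed direction; conjugation restores the direction, and the mean value property
  applies to the reflection of G in the real axis.\<close>

lemma circle_mean_exterior:
  assumes R: "0 < R" "1 / R < \<rho>" and G: "G holomorphic_on ball 0 \<rho>"
  shows "circle_mean R (\<lambda>w. G (1 / w)) = G 0"
proof -
  have inv: "1 / circlepath 0 R x = cnj (circlepath 0 (1 / R) x)" for x
    using R by (simp add: circlepath exp_cnj exp_minus field_simps)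
  have "circle_mean R (\<lambda>w. G (1 / w)) = cnj (circle_mean (1 / R) (\<lambda>w. cnj (G (cnj w))))"
    unfolding circle_mean_def inv by (simp add: integral_cnj)
  also have "circle_mean (1 / R) (\<lambda>w. cnj (G (cnj w))) = cnj (G (cnj 0))"
  proof (rule circle_mean_holomorphic)
    have "cnj ` ball 0 \<rho> = ball 0 \<rho>"
      by (force simp: image_iff intro: bexI[of _ "cnj z" for z])
    then have "(\<lambda>w. cnj (G (cnj w))) holomorphic_on ball 0 \<rho>"
      using G holomorphic_on_compose_cnj_cnj[of G "ball 0 \<rho>"] by (simp add: o_def)
    then show "(\<lambda>w. cnj (G (cnj w))) holomorphic_on cball 0 (1 / R)"
      by (rule holomorphic_on_subset) (use R in auto)
  qed (use R in simp)
  finally show ?thesis by simp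
qed

section \<open>Means over a torus: continuity, linearity and differentiation under the
  integral\<close>

definition torus_mean :: "real \<Rightarrow> real \<Rightarrow> (complex \<Rightarrow> complex) list \<Rightarrow> complex" where
  "torus_mean q R fs = nested_integral q (replicate (length fs) (circlepath 0 R)) fs"

lemma torus_mean_Nil [simp]: "torus_mean q R [] = 1"
  by (simp add: torus_mean_def)

lemma torus_mean_Cons:
  assumes "0 < R"
  shows "torus_mean q R (f # fs) = circle_mean R (\<lambda>z. f z * torus_mean q R (map (\<lambda>g w. cross_factor q z w * g w) fs))"
  using contour_integral_circle_mean[OF assms, of "\<lambda>z. f z * torus_mean q R (map (\<lambda>g w. cross_factor q z w * g w) fs)"]
  by (simp add: torus_mean_def field_simps)

text \<open>Integrands on a torus are treated as functions of the angles \<open>\<theta>\<close>: these range over a full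
  function space, so that continuity needs no side conditions.\<close>

definition angle_mean :: "nat \<Rightarrow> ((nat \<Rightarrow> real) \<Rightarrow> complex) \<Rightarrow> (nat \<Rightarrow> real) \<Rightarrow> complex" where
  "angle_mean i F \<theta> = integral {0..1} (\<lambda>x. F (\<theta>(i := x)))"

declare continuous_on_coordinatewise_then_product [continuous_intros del]

lemma continuous_on_fun_upd [continuous_intros]:
  fixes f :: "'a::topological_space \<Rightarrow> nat \<Rightarrow> real"
  assumes "continuous_on A f" "continuous_on A g"
  shows "continuous_on A (\<lambda>x. (f x)(i := g x))"
proof (rule continuous_on_coordinatewise_then_product)
  fix j
  show "continuous_on A (\<lambda>x. ((f x)(i := g x)) j)"
    using assms continuous_on_product_then_coordinatewise[OF assms(1), of j] by (cases "j = i") auto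
qed

lemma angle_mean_continuous:
  fixes F :: "'a::topological_space \<Rightarrow> (nat \<Rightarrow> real) \<Rightarrow> complex"
  assumes "continuous_on (U \<times> UNIV) (\<lambda>(u, \<theta>). F u \<theta>)"
  shows "continuous_on (U \<times> UNIV) (\<lambda>(u, \<theta>). angle_mean i (F u) \<theta>)"
proof -
  have "continuous_on ((U \<times> UNIV) \<times> cbox 0 1) (\<lambda>(p, x::real). F (fst p) ((snd p)(i := x)))"
    unfolding split_beta
    by (rule continuous_on_compose2[OF assms, of _ "\<lambda>y. (fst (fst y), (snd (fst y))(i := snd y))", unfolded split_beta fst_conv snd_conv])
       (auto intro!: continuous_intros)
  from integral_continuous_on_param[OF this] show ?thesis
    by (simp add: angle_mean_def split_beta)
qed

lemma angle_mean_integrable: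
  fixes F :: "(nat \<Rightarrow> real) \<Rightarrow> complex"
  assumes "continuous_on UNIV F"
  shows "(\<lambda>x. F (\<theta>(i := x))) integrable_on cbox 0 (1::real)"
proof (rule integrable_continuous)
  show "continuous_on (cbox 0 1) (\<lambda>x. F (\<theta>(i := x)))"
    by (rule continuous_on_compose2[OF assms]) (auto intro!: continuous_intros)
qed

lemma continuous_on_slice:
  assumes "continuous_on (U \<times> UNIV) (\<lambda>(u, \<theta>). F u \<theta>)" "u \<in> U"
  shows "continuous_on UNIV (F u)"
  by (rule continuous_on_compose2[OF assms(1), of _ "\<lambda>\<theta>. (u, \<theta>)", unfolded split_beta fst_conv snd_conv])
     (use assms(2) in \<open>auto intro!: continuous_intros\<close>)

lemma angle_mean_derivative:
  fixes F :: "complex \<Rightarrow> (nat \<Rightarrow> real) \<Rightarrow> complex"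
  assumes F: "continuous_on (U \<times> UNIV) (\<lambda>(u, \<theta>). F u \<theta>)"
    and F': "continuous_on (U \<times> UNIV) (\<lambda>(u, \<theta>). F' u \<theta>)"
    and der: "\<And>u \<theta>. u \<in> U \<Longrightarrow> ((\<lambda>u. F u \<theta>) has_field_derivative F' u \<theta>) (at u within U)"
    and U: "convex U" "u \<in> U"
  shows "((\<lambda>u. angle_mean i (F u) \<theta>) has_field_derivative angle_mean i (F' u) \<theta>) (at u within U)"
  unfolding angle_mean_def box_real(2)[symmetric]
proof (rule leibniz_rule_field_derivative[where f = "\<lambda>u x. F u (\<theta>(i := x))" and fx = "\<lambda>u x. F' u (\<theta>(i := x))"])
  show "(\<lambda>x. F u (\<theta>(i := x))) integrable_on cbox 0 1" if "u \<in> U" for u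
    by (rule angle_mean_integrable[OF continuous_on_slice[OF F that]])
  show "continuous_on (U \<times> cbox 0 1) (\<lambda>(u, x). F' u (\<theta>(i := x)))"
    unfolding split_beta
    by (rule continuous_on_compose2[OF F', of _ "\<lambda>y. (fst y, \<theta>(i := snd y))", unfolded split_beta fst_conv snd_conv])
       (auto intro!: continuous_intros)
qed (use der U in auto)

lemma foldr_angle_mean_continuous:
  fixes F :: "'a::topological_space \<Rightarrow> (nat \<Rightarrow> real) \<Rightarrow> complex"
  assumes "continuous_on (U \<times> UNIV) (\<lambda>(u, \<theta>). F u \<theta>)"
  shows "continuous_on (U \<times> UNIV) (\<lambda>(u, \<theta>). foldr angle_mean is (F u) \<theta>)"
  using assms by (induction "is") (auto intro: angle_mean_continuous)

lemma foldr_angle_mean_derivative: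
  fixes F :: "complex \<Rightarrow> (nat \<Rightarrow> real) \<Rightarrow> complex"
  assumes F: "continuous_on (U \<times> UNIV) (\<lambda>(u, \<theta>). F u \<theta>)"
    and F': "continuous_on (U \<times> UNIV) (\<lambda>(u, \<theta>). F' u \<theta>)"
    and der: "\<And>u \<theta>. u \<in> U \<Longrightarrow> ((\<lambda>u. F u \<theta>) has_field_derivative F' u \<theta>) (at u within U)"
    and U: "convex U" "u \<in> U"
  shows "((\<lambda>u. foldr angle_mean is (F u) \<theta>) has_field_derivative foldr angle_mean is (F' u) \<theta>) (at u within U)"
  using U(2)
proof (induction "is" arbitrary: u \<theta>)
  case (Cons i "is")
  show ?case
    unfolding foldr.simps o_def
    by (rule angle_mean_derivative[OF foldr_angle_mean_continuous[OF F] foldr_angle_mean_continuous[OF F']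
          Cons.IH U(1) Cons.prems])
qed (simp add: der)

lemma foldr_angle_mean_mult_left: "foldr angle_mean is (\<lambda>\<eta>. c * F \<eta>) \<theta> = c * foldr angle_mean is F \<theta>"
  by (induction "is" arbitrary: \<theta>) (simp_all add: angle_mean_def)

lemma foldr_angle_mean_continuous1:
  assumes "continuous_on UNIV F"
  shows "continuous_on UNIV (foldr angle_mean is F)"
proof -
  have "continuous_on ({True} \<times> UNIV) (\<lambda>(u, \<theta>). F \<theta>)"
    unfolding split_beta by (rule continuous_on_compose2[OF assms]) (auto intro!: continuous_intros)
  from continuous_on_slice[OF foldr_angle_mean_continuous[OF this]] show ?thesis by auto
qed

lemma angle_mean_add:
  assumes "continuous_on UNIV F" "continuous_on UNIV G"
  shows "angle_mean i (\<lambda>\<eta>. F \<eta> + G \<eta>) \<theta> = angle_mean i F \<theta> + angle_mean i G \<theta>"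
  unfolding angle_mean_def
  using angle_mean_integrable[OF assms(1)] angle_mean_integrable[OF assms(2)] by (intro integral_add) auto

lemma foldr_angle_mean_add:
  assumes "continuous_on UNIV F" "continuous_on UNIV G"
  shows "foldr angle_mean is (\<lambda>\<eta>. F \<eta> + G \<eta>) \<theta> = foldr angle_mean is F \<theta> + foldr angle_mean is G \<theta>"
proof (induction "is" arbitrary: \<theta>)
  case (Cons i "is")
  then have "foldr angle_mean is (\<lambda>\<eta>. F \<eta> + G \<eta>) = (\<lambda>\<eta>. foldr angle_mean is F \<eta> + foldr angle_mean is G \<eta>)"
    by (intro ext)
  then show ?case
    by (simp add: angle_mean_add foldr_angle_mean_continuous1 assms)
qed simp

lemma foldr_angle_mean_sum:
  assumes "finite I" "\<And>i. i \<in> I \<Longrightarrow> continuous_on UNIV (F i)"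
  shows "foldr angle_mean is (\<lambda>\<eta>. \<Sum>i\<in>I. F i \<eta>) \<theta> = (\<Sum>i\<in>I. foldr angle_mean is (F i) \<theta>)"
  using assms
proof (induction I)
  case empty
  show ?case using foldr_angle_mean_mult_left[of "is" 0 "\<lambda>_. 0" \<theta>] by simp
next
  case (insert i I)
  then have "continuous_on UNIV (\<lambda>\<eta>. \<Sum>i\<in>I. F i \<eta>)" by (intro continuous_on_sum) auto
  then show ?case using insert by (simp add: foldr_angle_mean_add)
qed

text \<open>Peels off angle 0: averaging over later angles keeps it fixed, so it can be prepended to
  the sequence of the others. This matches the recursion of \<open>torus_mean\<close>.\<close>

lemma foldr_angle_mean_shift:
  "foldr angle_mean (map Suc is) F \<theta> = foldr angle_mean is (\<lambda>\<eta>. F (case_nat (\<theta> 0) \<eta>)) (\<theta> \<circ> Suc)"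
proof (induction "is" arbitrary: \<theta>)
  case Nil
  have "case_nat (\<theta> 0) (\<theta> \<circ> Suc) = \<theta>" by (auto simp: fun_eq_iff split: nat.split)
  then show ?case by (simp add: o_def)
next
  case (Cons i "is")
  have upd: "(\<theta>(Suc i := x)) \<circ> Suc = (\<theta> \<circ> Suc)(i := x)" for x by (auto simp: fun_eq_iff)
  show ?case
    unfolding list.map foldr.simps comp_apply[of "angle_mean _"] angle_mean_def[of "Suc i"] angle_mean_def[of i] Cons.IH upd
    by simp
qed

definition torus_integrand ::
    "real \<Rightarrow> real \<Rightarrow> (complex \<Rightarrow> complex) list \<Rightarrow> (nat \<Rightarrow> real) \<Rightarrow> complex" where
  "torus_integrand q R fs \<theta> =
     B_fun q (map (\<lambda>i. circlepath 0 R (\<theta> i)) [0..<length fs]) * (\<Prod>i<length fs. (fs ! i) (circlepath 0 R (\<theta> i)))"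

lemma torus_integrand_Cons:
  "torus_integrand q R (f # fs) (case_nat x \<eta>) = f (circlepath 0 R x) *
     torus_integrand q R (map (\<lambda>g w. cross_factor q (circlepath 0 R x) w * g w) fs) \<eta>"
proof -
  have "map (\<lambda>i. circlepath 0 R (case_nat x \<eta> i)) [0..<Suc (length fs)]
     = circlepath 0 R x # map (\<lambda>i. circlepath 0 R (\<eta> i)) [0..<length fs]"
    by (simp add: upt_conv_Cons map_Suc_upt[symmetric] del: upt_Suc)
  then show ?thesis
    by (simp add: torus_integrand_def B_fun_Cons prod.lessThan_Suc_shift prod.distrib del: prod.lessThan_Suc upt_Suc)
qed

text \<open>The recursion of \<open>torus_mean\<close> changes the functions with each variable,
  whereas here one fixed integrand is averaged over its angles; linearity and the dependence on
  parameters are treated in this form. Every angle that the integrand reads is averaged over, so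
  \<theta> is arbitrary.\<close>

lemma torus_mean_eq_foldr:
  assumes "0 < R"
  shows "torus_mean q R fs = foldr angle_mean [0..<length fs] (torus_integrand q R fs) \<theta>"
proof (induction "length fs" arbitrary: fs \<theta>)
  case 0
  then show ?case by (simp add: torus_integrand_def)
next
  case (Suc r)
  then obtain f fs' where fs: "fs = f # fs'" "length fs' = r" by (cases fs) auto
  let ?fs = "\<lambda>x. map (\<lambda>g w. cross_factor q (circlepath 0 R x) w * g w) fs'"
  have upt: "[0..<Suc r] = 0 # map Suc [0..<r]"
    by (simp add: upt_conv_Cons map_Suc_upt del: upt_Suc)
  have "foldr angle_mean [0..<length fs] (torus_integrand q R fs) \<theta>
     = angle_mean 0 (foldr angle_mean (map Suc [0..<r]) (torus_integrand q R (f # fs'))) \<theta>"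
    using fs(2) by (simp only: list.size(4) add_Suc_right add_0_right upt foldr.simps comp_apply fs(1))
  also have "\<dots> = integral {0..1} (\<lambda>x. foldr angle_mean [0..<r] (\<lambda>\<eta>. torus_integrand q R (f # fs') (case_nat x \<eta>)) (\<theta>(0 := x) \<circ> Suc))"
    unfolding angle_mean_def[of 0] foldr_angle_mean_shift by simp
  also have "\<dots> = integral {0..1} (\<lambda>x. f (circlepath 0 R x) * torus_mean q R (?fs x))"
  proof (rule integral_cong)
    fix x :: real
    have "torus_mean q R (?fs x) = foldr angle_mean [0..<r] (torus_integrand q R (?fs x)) (\<theta>(0 := x) \<circ> Suc)"
      using Suc.hyps(1)[of "?fs x" "\<theta>(0 := x) \<circ> Suc"] fs(2) by simp
    then show "foldr angle_mean [0..<r] (\<lambda>\<eta>. torus_integrand q R (f # fs') (case_nat x \<eta>)) (\<theta>(0 := x) \<circ> Suc)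
        = f (circlepath 0 R x) * torus_mean q R (?fs x)"
      unfolding torus_integrand_Cons foldr_angle_mean_mult_left by simp
  qed
  also have "\<dots> = torus_mean q R fs"
    unfolding fs(1) torus_mean_Cons[OF assms] circle_mean_def ..
  finally show ?case by simp
qed

text \<open>As a function of z the cross factor has its pole at w / q, of norm R / q. The common
  circle of radius R thus avoids all cross poles, with room to spare in the earlier
  variable.\<close>

lemma cross_factor_denominator:
  assumes "0 < q" "q < 1" "norm z < R / q" "norm w = R"
  shows "of_real q * z - w \<noteq> (0::complex)"
proof
  assume "of_real q * z - w = 0"
  then have "w = of_real q * z" by simp
  then have "norm w = q * norm z" using assms by (simp add: norm_mult)
  then show False using assms by (simp add: field_simps)
qed

lemma cross_factor_denominator_sphere:
  assumes "0 < q" "q < 1" "0 < R" "norm z = R" "norm w = R"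
  shows "of_real q * z - w \<noteq> (0::complex)"
  using assms by (intro cross_factor_denominator[where R = R]) (auto simp: field_simps)

lemma continuous_on_component [continuous_intros]:
  fixes f :: "'a::topological_space \<Rightarrow> nat \<Rightarrow> real"
  shows "continuous_on A f \<Longrightarrow> continuous_on A (\<lambda>x. f x i)"
  by (rule continuous_on_product_then_coordinatewise)

lemma B_fun_map_upt:
  "B_fun q (map f [0..<n]) = (\<Prod>j<n. \<Prod>i<j. (f i - f j) / (of_real q * f i - f j))"
  unfolding B_fun_def by (intro prod.cong) auto

lemma torus_integrand_continuous:
  fixes fs :: "('a::topological_space \<Rightarrow> complex \<Rightarrow> complex) list"
  assumes q: "0 < q" "q < 1" and R: "0 < R"
    and fs: "\<And>f. f \<in> set fs \<Longrightarrow> continuous_on (U \<times> sphere 0 R) (\<lambda>(u, w). f u w)"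
  shows "continuous_on (U \<times> UNIV) (\<lambda>(u, \<theta>). torus_integrand q R (map (\<lambda>f. f u) fs) \<theta>)"
proof -
  have "continuous_on (U \<times> UNIV) (\<lambda>p. (fs ! i) (fst p) (circlepath 0 R (snd p i)))" if "i < length fs" for i
    by (rule continuous_on_compose2[OF fs[of "fs ! i"], of _ "\<lambda>p. (fst p, circlepath 0 R (snd p i))", unfolded split_beta fst_conv snd_conv])
       (use that R in \<open>auto intro!: continuous_intros\<close>)
  then show ?thesis
    unfolding torus_integrand_def split_beta B_fun_map_upt length_map
    by (intro continuous_intros) (use cross_factor_denominator_sphere[OF q R] R in auto)
qed

context
  fixes q R :: real
  assumes q: "0 < q" "q < 1" and R: "0 < R"
begin

lemma torus_integrand_continuous1:
  assumes "\<And>f. f \<in> set fs \<Longrightarrow> continuous_on (sphere 0 R) f"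
  shows "continuous_on UNIV (torus_integrand q R fs)"
proof -
  have "continuous_on ({True} \<times> UNIV) (\<lambda>(u, \<theta>). torus_integrand q R (map (\<lambda>f. f u) (map (\<lambda>f _. f) fs)) \<theta>)"
  proof (rule torus_integrand_continuous[OF q R])
    fix f :: "bool \<Rightarrow> complex \<Rightarrow> complex" assume "f \<in> set (map (\<lambda>f _. f) fs)"
    then obtain g where "g \<in> set fs" "f = (\<lambda>_. g)" by auto
    then show "continuous_on ({True} \<times> sphere 0 R) (\<lambda>(u, w). f u w)"
      unfolding split_beta by (auto intro!: continuous_on_compose2[OF assms, of g] continuous_intros)
  qed
  from continuous_on_slice[OF this] show ?thesis by (auto simp: o_def)
qed

lemma torus_mean_continuous:
  fixes fs :: "('a::topological_space \<Rightarrow> complex \<Rightarrow> complex) list"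
  assumes fs: "\<And>f. f \<in> set fs \<Longrightarrow> continuous_on (U \<times> sphere 0 R) (\<lambda>(u, w). f u w)"
  shows "continuous_on U (\<lambda>u. torus_mean q R (map (\<lambda>f. f u) fs))"
proof -
  have "continuous_on (U \<times> UNIV) (\<lambda>(u, \<theta>). foldr angle_mean [0..<length fs] (torus_integrand q R (map (\<lambda>f. f u) fs)) \<theta>)"
    by (intro foldr_angle_mean_continuous torus_integrand_continuous q R fs)
  moreover have "foldr angle_mean [0..<length fs] (torus_integrand q R (map (\<lambda>f. f u) fs)) \<theta> = torus_mean q R (map (\<lambda>f. f u) fs)" for u \<theta>
    using torus_mean_eq_foldr[OF R, of q "map (\<lambda>f. f u) fs" \<theta>] by simp
  ultimately have "continuous_on (U \<times> UNIV) (\<lambda>p::'a \<times> (nat \<Rightarrow> real). torus_mean q R (map (\<lambda>f. f (fst p)) fs))"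
    by (simp add: split_beta)
  from continuous_on_compose2[OF this continuous_on_Pair[OF continuous_on_id' continuous_on_const[of U "\<lambda>_. 0"]]] show ?thesis
    by auto
qed

lemma torus_integrand_cross_factor:
  "torus_integrand q R (map (\<lambda>g w. cross_factor q z w * g w) fs) \<theta>
    = (\<Prod>i<length fs. cross_factor q z (circlepath 0 R (\<theta> i))) * torus_integrand q R fs \<theta>"
  by (simp add: torus_integrand_def prod.distrib)

text \<open>The derivative in z can be taken under the integral as long as z stays off the poles w /
  q. The disc of radius R / q contains the closed disc of radius R, so residues in the outer
  variable see no contribution from the inner integrals.\<close>

lemma torus_mean_holomorphic:
  assumes fs: "\<And>f. f \<in> set fs \<Longrightarrow> continuous_on (sphere 0 R) f"
  shows "(\<lambda>z. torus_mean q R (map (\<lambda>g w. cross_factor q z w * g w) fs)) holomorphic_on ball 0 (R / q)"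
proof -
  let ?c = "\<lambda>z w. cross_factor q z w" and ?e = "circlepath 0 R" and ?r = "length fs"
  \<comment> \<open>The derivative of the cross factor in z, by the quotient rule.\<close>
  let ?c' = "\<lambda>z w. (of_real q - 1) * w / (of_real q * z - w)\<^sup>2 :: complex"
  let ?F = "\<lambda>z \<theta>. (\<Prod>i<?r. ?c z (?e (\<theta> i))) * torus_integrand q R fs \<theta>"
  let ?F' = "\<lambda>z \<theta>. (\<Sum>i<?r. ?c' z (?e (\<theta> i)) * (\<Prod>j\<in>{..<?r} - {i}. ?c z (?e (\<theta> j)))) * torus_integrand q R fs \<theta>"
  let ?U = "ball (0::complex) (R / q)"
  have nz: "of_real q * z - ?e x \<noteq> 0" if "z \<in> ?U" for z x
    using that R by (intro cross_factor_denominator[OF q]) auto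
  have I: "continuous_on (?U \<times> UNIV) (\<lambda>p. torus_integrand q R fs (snd p))"
    by (rule continuous_on_compose2[OF torus_integrand_continuous1[OF fs]]) (auto intro!: continuous_intros)
  have F: "continuous_on (?U \<times> UNIV) (\<lambda>(z, \<theta>). ?F z \<theta>)" and F': "continuous_on (?U \<times> UNIV) (\<lambda>(z, \<theta>). ?F' z \<theta>)"
    unfolding split_beta cross_factor_def by (intro continuous_intros I; use nz in auto)+
  have der: "((\<lambda>z. ?F z \<theta>) has_field_derivative ?F' z \<theta>) (at z within ?U)" if z: "z \<in> ?U" for z \<theta>
  proof (rule has_field_derivative_at_within, rule DERIV_cmult_right, rule has_field_derivative_prod)
    fix i
    have "((\<lambda>z. ?c z (?e (\<theta> i))) has_field_derivative
        (1 * (of_real q * z - ?e (\<theta> i)) - (z - ?e (\<theta> i)) * of_real q) / ((of_real q * z - ?e (\<theta> i)) * (of_real q * z - ?e (\<theta> i)))) (at z)"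
      unfolding cross_factor_def using nz[OF z] by (intro DERIV_divide) (auto intro!: derivative_eq_intros simp: mult.commute)
    also have "1 * (of_real q * z - ?e (\<theta> i)) - (z - ?e (\<theta> i)) * of_real q = (of_real q - 1) * ?e (\<theta> i)"
      by (simp add: algebra_simps)
    finally show "((\<lambda>z. ?c z (?e (\<theta> i))) has_field_derivative ?c' z (?e (\<theta> i))) (at z)"
      by (simp add: power2_eq_square)
  qed
  have "(\<lambda>z. foldr angle_mean [0..<?r] (?F z) (\<lambda>_. 0)) holomorphic_on ?U"
    unfolding holomorphic_on_def field_differentiable_def
    using foldr_angle_mean_derivative[OF F F' der convex_ball] by blast
  moreover have "torus_mean q R (map (\<lambda>g w. ?c z w * g w) fs) = foldr angle_mean [0..<?r] (?F z) (\<lambda>_. 0)" for z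
    by (subst torus_mean_eq_foldr[OF R, of _ _ "\<lambda>_. 0"])
       (simp add: torus_integrand_cross_factor[abs_def])
  ultimately show ?thesis by simp
qed

lemma torus_integrand_update:
  assumes "k < length fs"
  shows "torus_integrand q R (fs[k := h]) \<theta> = h (circlepath 0 R (\<theta> k)) *
     (B_fun q (map (\<lambda>i. circlepath 0 R (\<theta> i)) [0..<length fs]) * (\<Prod>i\<in>{..<length fs} - {k}. (fs ! i) (circlepath 0 R (\<theta> i))))"
proof -
  have "(\<Prod>i<length fs. (fs[k := h] ! i) (circlepath 0 R (\<theta> i)))
     = (fs[k := h] ! k) (circlepath 0 R (\<theta> k)) * (\<Prod>i\<in>{..<length fs} - {k}. (fs[k := h] ! i) (circlepath 0 R (\<theta> i)))"
    using assms by (intro prod.remove) auto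
  also have "(\<Prod>i\<in>{..<length fs} - {k}. (fs[k := h] ! i) (circlepath 0 R (\<theta> i))) = (\<Prod>i\<in>{..<length fs} - {k}. (fs ! i) (circlepath 0 R (\<theta> i)))"
    by (intro prod.cong) auto
  finally show ?thesis using assms by (simp add: torus_integrand_def)
qed

lemma set_list_update_continuous:
  assumes "\<And>f. f \<in> set fs \<Longrightarrow> continuous_on (sphere 0 R) f" "continuous_on (sphere 0 R) h" "f \<in> set (fs[k := h])"
  shows "continuous_on (sphere 0 R) f"
  using assms set_update_subset_insert[of fs k h] by auto

lemma torus_mean_update_add:
  assumes k: "k < length fs" and fs: "\<And>f. f \<in> set fs \<Longrightarrow> continuous_on (sphere 0 R) f"
    and g: "continuous_on (sphere 0 R) g" and h: "continuous_on (sphere 0 R) h"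
  shows "torus_mean q R (fs[k := \<lambda>w. g w + c * h w]) = torus_mean q R (fs[k := g]) + c * torus_mean q R (fs[k := h])"
proof -
  have "torus_integrand q R (fs[k := \<lambda>w. g w + c * h w])
      = (\<lambda>\<theta>. torus_integrand q R (fs[k := g]) \<theta> + c * torus_integrand q R (fs[k := h]) \<theta>)"
    by (simp add: fun_eq_iff torus_integrand_update[OF k] algebra_simps)
  moreover have "continuous_on UNIV (torus_integrand q R (fs[k := g]))"
      "continuous_on UNIV (\<lambda>\<theta>. c * torus_integrand q R (fs[k := h]) \<theta>)"
    using set_list_update_continuous[OF fs g] set_list_update_continuous[OF fs h]
    by (auto intro!: torus_integrand_continuous1 continuous_on_mult_left)
  ultimately show ?thesis
    unfolding torus_mean_eq_foldr[OF R, of _ _ "\<lambda>_. 0"]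
    by (simp add: foldr_angle_mean_add foldr_angle_mean_mult_left)
qed

text \<open>The exponentials combine to one with the sum of all variables in the exponent, so its
  derivative is a sum over the variables. Time is complex here, so that the field derivative of
  parameter integrals applies.\<close>

lemma torus_mean_exp_derivative:
  assumes fs: "\<And>f. f \<in> set fs \<Longrightarrow> continuous_on (sphere 0 R) f"
  shows "((\<lambda>t. torus_mean q R (map (\<lambda>f w. f w * exp (- w * t)) fs)) has_field_derivative
     (\<Sum>k<length fs. torus_mean q R ((map (\<lambda>f w. f w * exp (- w * t)) fs)[k := \<lambda>w. - w * ((fs ! k) w * exp (- w * t))]))) (at t)"
proof -
  let ?e = "circlepath 0 R" and ?r = "length fs"
  let ?fs = "\<lambda>t. map (\<lambda>f w. f w * exp (- w * t)) fs"
  let ?F = "\<lambda>t \<theta>. exp (- (\<Sum>i<?r. ?e (\<theta> i)) * t) * torus_integrand q R fs \<theta>"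
  let ?F' = "\<lambda>t \<theta>. (- (\<Sum>i<?r. ?e (\<theta> i)) * exp (- (\<Sum>i<?r. ?e (\<theta> i)) * t)) * torus_integrand q R fs \<theta>"
  have int: "torus_integrand q R (?fs t) = ?F t" for t
  proof
    fix \<theta>
    have "exp (- (\<Sum>i<?r. ?e (\<theta> i)) * t) = (\<Prod>i<?r. exp (- ?e (\<theta> i) * t))"
      by (simp add: exp_sum[symmetric] sum_negf sum_distrib_right)
    then show "torus_integrand q R (?fs t) \<theta> = ?F t \<theta>"
      by (simp add: torus_integrand_def prod.distrib mult_ac)
  qed
  have upd: "torus_integrand q R ((?fs t)[k := \<lambda>w. - w * ((fs ! k) w * exp (- w * t))]) = (\<lambda>\<theta>. - ?e (\<theta> k) * ?F t \<theta>)"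
    if k: "k < ?r" for t k
  proof
    fix \<theta>
    have "(?fs t)[k := (?fs t) ! k] = ?fs t" by simp
    then have "?F t \<theta> = torus_integrand q R ((?fs t)[k := (?fs t) ! k]) \<theta>" by (simp only: list_update_id int)
    then show "torus_integrand q R ((?fs t)[k := \<lambda>w. - w * ((fs ! k) w * exp (- w * t))]) \<theta> = - ?e (\<theta> k) * ?F t \<theta>"
      using k by (simp add: torus_integrand_update)
  qed
  have I: "continuous_on (UNIV \<times> UNIV) (\<lambda>p::complex \<times> (nat \<Rightarrow> real). torus_integrand q R fs (snd p))"
    by (rule continuous_on_compose2[OF torus_integrand_continuous1[OF fs]]) (auto intro!: continuous_intros)
  have "((\<lambda>t. foldr angle_mean [0..<?r] (?F t) (\<lambda>_. 0)) has_field_derivative foldr angle_mean [0..<?r] (?F' t) (\<lambda>_. 0)) (at t within UNIV)"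
  proof (rule foldr_angle_mean_derivative)
    show "continuous_on (UNIV \<times> UNIV) (\<lambda>(t, \<theta>). ?F t \<theta>)" "continuous_on (UNIV \<times> UNIV) (\<lambda>(t, \<theta>). ?F' t \<theta>)"
      unfolding split_beta by (intro continuous_intros I)+
    fix t \<theta>
    show "((\<lambda>t. ?F t \<theta>) has_field_derivative ?F' t \<theta>) (at t within UNIV)"
      by (rule DERIV_cmult_right) (auto intro!: derivative_eq_intros)
  qed auto
  moreover have "?F' t = (\<lambda>\<theta>. \<Sum>k<?r. - ?e (\<theta> k) * ?F t \<theta>)"
    by (simp add: fun_eq_iff sum_negf sum_distrib_right mult.assoc)
  moreover have "foldr angle_mean [0..<?r] (\<lambda>\<theta>. \<Sum>k<?r. - ?e (\<theta> k) * ?F t \<theta>) (\<lambda>_. 0)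
      = (\<Sum>k<?r. foldr angle_mean [0..<?r] (\<lambda>\<theta>. - ?e (\<theta> k) * ?F t \<theta>) (\<lambda>_. 0))"
    by (rule foldr_angle_mean_sum) (auto intro!: continuous_intros torus_integrand_continuous1 fs)
  moreover have "torus_mean q R ((?fs t)[k := \<lambda>w. - w * ((fs ! k) w * exp (- w * t))])
      = foldr angle_mean [0..<?r] (\<lambda>\<theta>. - ?e (\<theta> k) * ?F t \<theta>) (\<lambda>_. 0)" if "k < ?r" for k
    by (subst torus_mean_eq_foldr[OF R, of _ _ "\<lambda>_. 0"]) (simp only: upd[OF that] length_list_update length_map)
  moreover have "torus_mean q R (?fs t) = foldr angle_mean [0..<?r] (?F t) (\<lambda>_. 0)" for t
    by (subst torus_mean_eq_foldr[OF R, of _ _ "\<lambda>_. 0"]) (simp only: int length_map)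
  ultimately show ?thesis by simp
qed

end

section \<open>Evaluation at 0 and at infinity, and the exchange of two adjacent variables\<close>

lemma torus_mean_cong:
  assumes "0 < R" "length fs = length gs"
    and "\<And>i w. i < length gs \<Longrightarrow> norm w = R \<Longrightarrow> (fs ! i) w = (gs ! i) w"
  shows "torus_mean q R fs = torus_mean q R gs"
proof -
  have "torus_integrand q R fs = torus_integrand q R gs"
    using assms by (auto simp: fun_eq_iff torus_integrand_def)
  then show ?thesis
    using assms(2) by (simp add: torus_mean_eq_foldr[OF assms(1), of _ _ "\<lambda>_. 0"])
qed

text \<open>\<open>g\<close> extends from the circle to a holomorphic function of \<open>1 / w\<close> outside it that vanishes at infinity.\<close>

definition exterior_null :: "real \<Rightarrow> (complex \<Rightarrow> complex) \<Rightarrow> bool" where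
  "exterior_null R g \<longleftrightarrow> (\<exists>G \<rho>. 1 / R < \<rho> \<and> G holomorphic_on ball 0 \<rho> \<and> G 0 = 0 \<and> (\<forall>w. norm w = R \<longrightarrow> g w = G (1 / w)))"

context
  fixes q R :: real
  assumes q: "0 < q" "q < 1" and R: "0 < R"
begin

text \<open>The mean value property in the outermost variable; at z = 0 every cross factor with a
  later variable equals 1.\<close>

lemma torus_mean_Cons_holomorphic:
  assumes f: "f holomorphic_on cball 0 R" and fs: "\<And>g. g \<in> set fs \<Longrightarrow> continuous_on (sphere 0 R) g"
  shows "torus_mean q R (f # fs) = f 0 * torus_mean q R fs"
proof -
  have "R < R / q" using q R by (simp add: field_simps)
  then have "cball 0 R \<subseteq> ball (0::complex) (R / q)" by auto
  then have "(\<lambda>z. torus_mean q R (map (\<lambda>g w. cross_factor q z w * g w) fs)) holomorphic_on cball 0 R"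
    using torus_mean_holomorphic[OF q R fs] holomorphic_on_subset by blast
  then have "circle_mean R (\<lambda>z. f z * torus_mean q R (map (\<lambda>g w. cross_factor q z w * g w) fs))
     = f 0 * torus_mean q R (map (\<lambda>g w. cross_factor q 0 w * g w) fs)"
    by (intro circle_mean_holomorphic R holomorphic_intros f)
  also have "torus_mean q R (map (\<lambda>g w. cross_factor q 0 w * g w) fs) = torus_mean q R fs"
    using R by (intro torus_mean_cong) (auto simp: cross_factor_def)
  finally show ?thesis by (simp add: torus_mean_Cons[OF R])
qed

lemma torus_mean_append_holomorphic:
  assumes "\<And>f. f \<in> set fs \<Longrightarrow> f holomorphic_on cball 0 R \<and> f 0 = 1"
    and "\<And>g. g \<in> set gs \<Longrightarrow> continuous_on (sphere 0 R) g"
  shows "torus_mean q R (fs @ gs) = torus_mean q R gs"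
  using assms(1)
proof (induction fs)
  case (Cons f fs)
  have "continuous_on (sphere 0 R) g" if "g \<in> set (fs @ gs)" for g
  proof (cases "g \<in> set gs")
    case False
    then have "g holomorphic_on cball 0 R" using that Cons.prems by auto
    then show ?thesis
      using holomorphic_on_imp_continuous_on continuous_on_subset sphere_cball by blast
  qed (use assms in auto)
  then have "torus_mean q R (f # (fs @ gs)) = f 0 * torus_mean q R (fs @ gs)"
    using Cons.prems by (intro torus_mean_Cons_holomorphic) auto
  then show ?case using Cons by simp
qed simp

text \<open>In terms of u = 1 / w the cross factor is (z u - 1) / (q z u - 1). Its pole has norm 1 /
  (q R), which exceeds 1 / R, and multiplying by it preserves the zero at u = 0.\<close>

lemma exterior_null_cross_factor:
  assumes z: "norm z = R" and g: "exterior_null R g"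
  shows "exterior_null R (\<lambda>w. cross_factor q z w * g w)"
proof -
  obtain G \<rho> where G: "1 / R < \<rho>" "G holomorphic_on ball 0 \<rho>" "G 0 = 0" "\<And>w. norm w = R \<Longrightarrow> g w = G (1 / w)"
    using g unfolding exterior_null_def by blast
  let ?\<rho> = "min \<rho> (1 / (q * R))"
  let ?G = "\<lambda>u. (z * u - 1) / (of_real q * z * u - 1) * G u"
  have "1 / R < 1 / (q * R)" using q R by (simp add: field_simps)
  moreover have "?G holomorphic_on ball 0 ?\<rho>"
  proof (intro holomorphic_intros)
    show "G holomorphic_on ball 0 ?\<rho>" by (rule holomorphic_on_subset[OF G(2)]) auto
    show "of_real q * z * u - 1 \<noteq> 0" if "u \<in> ball 0 ?\<rho>" for u
    proof
      assume "of_real q * z * u - 1 = 0"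
      then have "norm (of_real q * z * u) = 1" by simp
      then have "q * R * norm u = 1" using q z by (simp add: norm_mult)
      then show False using that q R by (simp add: field_simps)
    qed
  qed
  moreover have "cross_factor q z w * g w = ?G (1 / w)" if "norm w = R" for w
  proof -
    have "w \<noteq> 0" using that R by auto
    then have "(z - w) / (of_real q * z - w) = (z * (1 / w) - 1) / (of_real q * z * (1 / w) - 1)"
      using cross_factor_denominator_sphere[OF q R z that] by (simp add: field_simps)
    then show ?thesis by (simp add: cross_factor_def G(4)[OF that])
  qed
  ultimately show ?thesis
    unfolding exterior_null_def using G by (intro exI[of _ ?G] exI[of _ ?\<rho>]) auto
qed

text \<open>The outer variables change the last function only by cross factors, which preserve
  \<open>exterior_null\<close>. The innermost integral is then a value at infinity, hence 0.\<close>

lemma torus_mean_snoc_exterior_null: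
  assumes "exterior_null R g"
  shows "torus_mean q R (fs @ [g]) = 0"
  using assms
proof (induction "length fs" arbitrary: fs g)
  case 0
  then obtain G \<rho> where G: "1 / R < \<rho>" "G holomorphic_on ball 0 \<rho>" "G 0 = 0" "\<And>w. norm w = R \<Longrightarrow> g w = G (1 / w)"
    unfolding exterior_null_def by blast
  have "torus_mean q R [g] = circle_mean R (\<lambda>w. G (1 / w))"
    unfolding torus_mean_Cons[OF R] by (intro circle_mean_cong R) (simp add: G)
  then show ?case using 0 circle_mean_exterior[OF R G(1,2)] G(3) by simp
next
  case (Suc n)
  then obtain f fs' where fs: "fs = f # fs'" "length fs' = n" by (cases fs) auto
  have "torus_mean q R (fs @ [g]) = circle_mean R (\<lambda>z. 0)"
    unfolding fs append_Cons torus_mean_Cons[OF R]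
  proof (intro circle_mean_cong R)
    fix z :: complex assume "norm z = R"
    then show "f z * torus_mean q R (map (\<lambda>g w. cross_factor q z w * g w) (fs' @ [g])) = 0"
      using Suc.hyps(1)[of "map (\<lambda>g w. cross_factor q z w * g w) fs'" "\<lambda>w. cross_factor q z w * g w"] fs
        exterior_null_cross_factor Suc.prems by simp
  qed
  then show ?case by (simp add: circle_mean_def)
qed

lemma cross_factor_continuous_sphere:
  assumes "norm z = R" "continuous_on (sphere 0 R) g"
  shows "continuous_on (sphere 0 R) (\<lambda>w. cross_factor q z w * g w)"
  unfolding cross_factor_def
  by (intro continuous_intros assms(2)) (use cross_factor_denominator_sphere[OF q R assms(1)] in auto)

text \<open>The difference of the two sides has an integrand with the factor \<open>w - q z\<close>, which cancels
  the denominator of \<open>cross_factor q z w\<close> and leaves an antisymmetric function of \<open>(z, w)\<close>.\<close>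

lemma torus_mean_Cons_Cons_exchange:
  assumes g: "continuous_on (sphere 0 R) g" and fs: "\<And>f. f \<in> set fs \<Longrightarrow> continuous_on (sphere 0 R) f"
  shows "torus_mean q R (g # (\<lambda>w. w * g w) # fs) = of_real q * torus_mean q R ((\<lambda>w. w * g w) # g # fs)"
proof -
  let ?e = "circlepath 0 R" and ?c = "cross_factor q"
  \<comment> \<open>The integral over all further variables. It contains the cross factors of both
    outer variables and is therefore symmetric in the two angles.\<close>
  define K where "K = (\<lambda>p::real \<times> real. torus_mean q R (map (\<lambda>h u. ?c (?e (snd p)) u * (?c (?e (fst p)) u * h u)) fs))"
  have den: "of_real q * ?e x - w \<noteq> 0" if "norm w = R" for x w
    using that R by (intro cross_factor_denominator_sphere[OF q R]) auto
  have K: "continuous_on UNIV K"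
  proof -
    have "continuous_on UNIV (\<lambda>p. torus_mean q R (map (\<lambda>f. f p) (map (\<lambda>h p u. ?c (?e (snd p)) u * (?c (?e (fst p)) u * h u)) fs)))"
    proof (rule torus_mean_continuous[OF q R])
      fix F :: "real \<times> real \<Rightarrow> complex \<Rightarrow> complex"
      assume "F \<in> set (map (\<lambda>h p u. ?c (?e (snd p)) u * (?c (?e (fst p)) u * h u)) fs)"
      then obtain h where h: "h \<in> set fs" "F = (\<lambda>p u. ?c (?e (snd p)) u * (?c (?e (fst p)) u * h u))" by auto
      have "continuous_on (UNIV \<times> sphere 0 R) (\<lambda>x::(real \<times> real) \<times> complex. h (snd x))"
        by (rule continuous_on_compose2[OF fs[OF h(1)]]) (auto intro!: continuous_intros)
      then show "continuous_on (UNIV \<times> sphere 0 R) (\<lambda>(p, u). F p u)"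
        unfolding h(2) split_beta cross_factor_def
        by (intro continuous_intros) (use den in auto)
    qed
    then show ?thesis by (simp add: K_def o_def)
  qed
  have K_sym: "K (y, x) = K (x, y)" for x y
    by (simp add: K_def mult.left_commute)
  define a1 a2 where "a1 = (\<lambda>p. g (?e (fst p)) * (?c (?e (fst p)) (?e (snd p)) * (?e (snd p) * g (?e (snd p))) * K p))"
    and "a2 = (\<lambda>p. (?e (fst p) * g (?e (fst p))) * (?c (?e (fst p)) (?e (snd p)) * g (?e (snd p)) * K p))"
  have ge: "continuous_on UNIV (\<lambda>p::real \<times> real. g (?e (fst p)))" "continuous_on UNIV (\<lambda>p::real \<times> real. g (?e (snd p)))"
    by (rule continuous_on_sphere_circlepath[OF R g]; intro continuous_intros)+
  have "continuous_on UNIV a1" "continuous_on UNIV a2"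
    unfolding a1_def a2_def cross_factor_def
    by (intro continuous_intros K ge; use den R in auto)+
  then have a: "continuous_on (cbox (0,0) (1,1)) a1" "continuous_on (cbox (0,0) (1,1)) a2"
    using continuous_on_subset by blast+
  let ?D = "\<lambda>p. a1 p - of_real q * a2 p"
  have Dc: "continuous_on (cbox (0,0) (1,1)) ?D" by (intro continuous_intros a)
  have D: "?D (x, y) = - ((?e x - ?e y) * g (?e x) * g (?e y) * K (x, y))" for x y
  proof -
    have "?D (x, y) = ((?e x - ?e y) * (?e y - of_real q * ?e x) / (of_real q * ?e x - ?e y)) * g (?e x) * g (?e y) * K (x, y)"
      unfolding a1_def a2_def cross_factor_def by (simp add: divide_simps) (simp add: algebra_simps)
    also have "(?e x - ?e y) * (?e y - of_real q * ?e x) / (of_real q * ?e x - ?e y) = - (?e x - ?e y)"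
      using den[of "?e y" x] R by (simp add: divide_eq_eq) (simp add: algebra_simps)
    finally show ?thesis by (simp add: algebra_simps)
  qed
  have anti: "?D (x, y) = - ?D (y, x)" for x y
    unfolding D by (simp add: K_sym[of y x] algebra_simps)
  \<comment> \<open>Exchanging the order of integration and then using antisymmetry shows that the
    double integral equals its own negative.\<close>
  have "integral (cbox (0,0) (1,1)) ?D = integral (cbox 0 1) (\<lambda>x. integral (cbox 0 1) (\<lambda>y. ?D (x, y)))"
    by (rule integral_prod_continuous[OF Dc])
  also have "\<dots> = integral (cbox 0 1) (\<lambda>y. integral (cbox 0 1) (\<lambda>x. ?D (x, y)))"
    using Dc by (intro integral_swap_continuous) simp
  also have "\<dots> = integral (cbox 0 1) (\<lambda>y. - integral (cbox 0 1) (\<lambda>x. ?D (y, x)))"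
  proof (rule integral_cong)
    fix y :: real
    show "integral (cbox 0 1) (\<lambda>x. ?D (x, y)) = - integral (cbox 0 1) (\<lambda>x. ?D (y, x))"
      unfolding integral_neg[symmetric] by (rule integral_cong) (rule anti)
  qed
  also have "\<dots> = - integral (cbox (0,0) (1,1)) ?D"
    by (simp add: integral_prod_continuous[OF Dc])
  finally have "integral (cbox (0,0) (1,1)) ?D = 0" by simp
  moreover have "integral (cbox (0,0) (1,1)) ?D = integral (cbox (0,0) (1,1)) a1 - of_real q * integral (cbox (0,0) (1,1)) a2"
    using integrable_continuous[OF a(1)] integrable_continuous[OF continuous_on_mult_left[OF a(2)]]
    by (subst integral_diff) auto
  moreover have "torus_mean q R (g # (\<lambda>w. w * g w) # fs) = integral (cbox (0,0) (1,1)) a1"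
    by (subst integral_prod_continuous[OF a(1)])
       (simp add: a1_def K_def torus_mean_Cons[OF R] circle_mean_def o_def)
  moreover have "torus_mean q R ((\<lambda>w. w * g w) # g # fs) = integral (cbox (0,0) (1,1)) a2"
    by (subst integral_prod_continuous[OF a(2)])
       (simp add: a2_def K_def torus_mean_Cons[OF R] circle_mean_def o_def)
  ultimately show ?thesis by simp
qed

text \<open>An outer variable multiplies both adjacent functions by the same cross factor, so the
  pair keeps the shape g, w g and the case without outer variables applies.\<close>

lemma torus_mean_exchange:
  assumes "continuous_on (sphere 0 R) g" and "\<And>f. f \<in> set fs \<Longrightarrow> continuous_on (sphere 0 R) f"
  shows "torus_mean q R (hs @ g # (\<lambda>w. w * g w) # fs) = of_real q * torus_mean q R (hs @ (\<lambda>w. w * g w) # g # fs)"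
  using assms
proof (induction "length hs" arbitrary: hs g fs)
  case 0
  then show ?case by (simp add: torus_mean_Cons_Cons_exchange)
next
  case (Suc n)
  then obtain h hs' where hs: "hs = h # hs'" "length hs' = n" by (cases hs) auto
  show ?case
    unfolding hs append_Cons torus_mean_Cons[OF R] circle_mean_mult_left[symmetric]
  proof (intro circle_mean_cong R)
    fix z :: complex assume z: "norm z = R"
    let ?m = "map (\<lambda>g w. cross_factor q z w * g w)"
    have c: "continuous_on (sphere 0 R) (\<lambda>w. cross_factor q z w * f w)" if "continuous_on (sphere 0 R) f" for f
      using cross_factor_continuous_sphere[OF z that] .
    have "torus_mean q R (?m hs' @ (\<lambda>w. cross_factor q z w * g w) # (\<lambda>w. w * (cross_factor q z w * g w)) # ?m fs)
      = of_real q * torus_mean q R (?m hs' @ (\<lambda>w. w * (cross_factor q z w * g w)) # (\<lambda>w. cross_factor q z w * g w) # ?m fs)"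
    proof (rule Suc.hyps(1))
      show "continuous_on (sphere 0 R) f" if "f \<in> set (?m fs)" for f
        using that c Suc.prems(2) by auto
    qed (use hs(2) c[OF Suc.prems(1)] in simp_all)
    then show "h z * torus_mean q R (?m (hs' @ g # (\<lambda>w. w * g w) # fs))
       = of_real q * (h z * torus_mean q R (?m (hs' @ (\<lambda>w. w * g w) # g # fs)))"
      by (simp add: mult_ac)
  qed
qed

end

section \<open>The contour integrals of the q-TAZRP\<close>

definition site_fun :: "(int \<Rightarrow> real) \<Rightarrow> int \<Rightarrow> int \<Rightarrow> real \<Rightarrow> complex \<Rightarrow> complex" where
  "site_fun b M y t w = ext_prod y M (\<lambda>k. of_real (b k) / (of_real (b k) - w)) * exp (- w * of_real t)"

definition site_funs :: "(int \<Rightarrow> real) \<Rightarrow> int \<Rightarrow> (nat \<Rightarrow> int) \<Rightarrow> real \<Rightarrow> nat set \<Rightarrow> (complex \<Rightarrow> complex) list" where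
  "site_funs b M Y t S = map (\<lambda>s. site_fun b M (Y s) t) (sorted_list_of_set S)"

lemma length_site_funs [simp]: "length (site_funs b M Y t S) = card S"
  by (simp add: site_funs_def)

lemma log_contour_integral_I_fun:
  assumes "length \<gamma>s = card S"
  shows "log_contour_integral \<gamma>s (I_fun q b Y S M t) = nested_integral q \<gamma>s (site_funs b M Y t S)"
proof -
  have "I_fun q b Y S M t = (\<lambda>w. B_fun q w * (\<Prod>i<length (site_funs b M Y t S). (site_funs b M Y t S ! i) (w ! i)))"
    by (simp add: fun_eq_iff I_fun_def Let_def site_funs_def site_fun_def)
  then show ?thesis
    using log_contour_integral_eq_nested_integral[of "site_funs b M Y t S" \<gamma>s q] assms by simp
qed

text \<open>The extended product is defined with reciprocals exactly so that this recursion holds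
  for all y, also across M.\<close>

lemma ext_prod_shift:
  assumes "f y \<noteq> 0"
  shows "ext_prod (y + 1) M f = ext_prod y M f / f y"
proof -
  consider "y < M" | "y = M" | "y = M + 1" | "M + 1 < y" by linarith
  then show ?thesis
  proof cases
    case 1
    then have "{y..M} = insert y {y + 1..M}" by auto
    then show ?thesis using 1 assms by (simp add: ext_prod_def)
  next
    case 4
    then have "{M + 1..y} = insert y {M + 1..y - 1}" by auto
    then show ?thesis using 4 assms by (simp add: ext_prod_def)
  qed (use assms in \<open>auto simp: ext_prod_def add.commute[of 1]\<close>)
qed

lemma ext_prod_gt:
  assumes "M < y"
  shows "ext_prod y M f = (\<Prod>k=M+1..y-1. 1 / f k)"
  using assms by (auto simp: ext_prod_def)

text \<open>For y > M the extended product inverts its factors and leaves a polynomial in w with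
  value 1 at 0, so the singularities at the b k disappear.\<close>

lemma site_fun_entire:
  assumes "M < y" "\<And>k. b k \<noteq> 0"
  shows "site_fun b M y t holomorphic_on A" "site_fun b M y t 0 = 1"
proof -
  have "site_fun b M y t = (\<lambda>w. (\<Prod>k=M+1..y-1. (of_real (b k) - w) / of_real (b k)) * exp (- w * of_real t))"
    by (simp add: fun_eq_iff site_fun_def ext_prod_gt[OF assms(1)])
  then show "site_fun b M y t holomorphic_on A" "site_fun b M y t 0 = 1"
    using assms(2) by (auto intro!: holomorphic_intros)
qed

lemma sorted_list_of_set_Un:
  fixes A B :: "'a::linorder set"
  assumes "finite A" "finite B" "\<And>a b. a \<in> A \<Longrightarrow> b \<in> B \<Longrightarrow> a < b"
  shows "sorted_list_of_set (A \<union> B) = sorted_list_of_set A @ sorted_list_of_set B"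
proof -
  have "sorted (sorted_list_of_set A @ sorted_list_of_set B)"
    using assms by (auto simp: sorted_append less_imp_le)
  moreover have "distinct (sorted_list_of_set A @ sorted_list_of_set B)"
    using assms by fastforce
  moreover have "set (sorted_list_of_set A @ sorted_list_of_set B) = A \<union> B" using assms by simp
  ultimately show ?thesis
    by (metis sorted_list_of_set.idem_if_sorted_distinct)
qed

lemma site_funs_Un:
  assumes "finite A" "finite B" "\<And>a b. a \<in> A \<Longrightarrow> b \<in> B \<Longrightarrow> a < b"
  shows "site_funs b M Y t (A \<union> B) = site_funs b M Y t A @ site_funs b M Y t B"
  using sorted_list_of_set_Un[OF assms] by (simp add: site_funs_def)

lemma sorted_list_of_set_image_strict_mono:
  fixes f :: "'a::linorder \<Rightarrow> 'b::linorder"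
  assumes "finite A" "strict_mono_on A f"
  shows "sorted_list_of_set (f ` A) = map f (sorted_list_of_set A)"
proof -
  have mono: "f x \<le> f y" if "x \<in> A" "y \<in> A" "x \<le> y" for x y
    using assms(2) that by (metis dual_order.order_iff_strict strict_mono_onD)
  have "sorted (map f (sorted_list_of_set A))"
    unfolding sorted_map
    by (rule sorted_wrt_mono_rel[OF _ sorted_sorted_list_of_set[of A]]) (use assms(1) mono in auto)
  moreover have "distinct (map f (sorted_list_of_set A))"
    using assms strict_mono_on_imp_inj_on by (auto simp: distinct_map)
  moreover have "set (map f (sorted_list_of_set A)) = f ` A" using assms by simp
  ultimately show ?thesis
    by (metis sorted_list_of_set.idem_if_sorted_distinct)
qed

text \<open>With u = 1 / w each factor becomes b u / (b u - 1), which vanishes at u = 0 and has its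
  pole at 1 / b > 1 / R. Because y <= M there is at least one factor.\<close>

lemma exterior_null_ext_prod:
  assumes "y \<le> M" "0 < R" and b: "\<And>k. 0 < b k \<and> b k < R"
  shows "exterior_null R (\<lambda>w. ext_prod y M (\<lambda>k. of_real (b k) / (of_real (b k) - w)))"
proof -
  define \<rho> where "\<rho> = Min ((\<lambda>k. 1 / b k) ` {y..M})"
  let ?G = "\<lambda>u::complex. \<Prod>k=y..M. of_real (b k) * u / (of_real (b k) * u - 1)"
  have \<rho>: "1 / R < \<rho>"
    unfolding \<rho>_def using assms by (subst Min_gr_iff) (auto simp: field_simps)
  have "?G holomorphic_on ball 0 \<rho>"
  proof (intro holomorphic_intros)
    fix k u assume k: "k \<in> {y..M}" and u: "u \<in> ball (0::complex) \<rho>"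
    have "\<rho> \<le> 1 / b k" unfolding \<rho>_def using k by (intro Min_le) auto
    show "of_real (b k) * u - 1 \<noteq> 0"
    proof
      assume "of_real (b k) * u - 1 = 0"
      then have "norm (of_real (b k) * u) = 1" by simp
      then have "b k * norm u = 1" using b[of k] by (simp add: norm_mult)
      then have "norm u = 1 / b k" using b[of k] by (simp add: field_simps)
      then show False using u \<open>\<rho> \<le> 1 / b k\<close> by simp
    qed
  qed
  moreover have "?G 0 = 0" using assms(1) by (auto intro!: prod_zero bexI[of _ y])
  moreover have "ext_prod y M (\<lambda>k. of_real (b k) / (of_real (b k) - w)) = ?G (1 / w)" if "norm w = R" for w
  proof -
    have "w \<noteq> 0" using that assms by auto
    have e: "of_real (b k) / (of_real (b k) - w) = of_real (b k) * (1 / w) / (of_real (b k) * (1 / w) - 1)" for k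
    proof -
      have "of_real (b k) * (1 / w) - 1 = (of_real (b k) - w) / w"
        using \<open>w \<noteq> 0\<close> by (simp add: field_simps)
      then show ?thesis using \<open>w \<noteq> 0\<close> by simp
    qed
    have "(\<Prod>k=y..M. of_real (b k) / (of_real (b k) - w)) = ?G (1 / w)" by (rule prod.cong[OF refl e])
    then show ?thesis using assms(1) by (simp only: ext_prod_def if_True)
  qed
  ultimately show ?thesis unfolding exterior_null_def using \<rho> by (intro exI[of _ ?G] exI[of _ \<rho>]) auto
qed

locale qtazrp_contour =
  fixes q R :: real and a b :: "int \<Rightarrow> real" and N :: nat and M :: int
  assumes q: "0 < q" "q < 1" and R: "0 < R" and b: "\<And>k. 0 < b k \<and> b k < R"
    and ab: "\<And>k. b k = (1 - q) * a k"
begin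

abbreviation "site_mean Y t S \<equiv> torus_mean q R (site_funs b M Y t S)"

lemma b_minus_nonzero: "norm w = R \<Longrightarrow> of_real (b k) - w \<noteq> (0::complex)"
  using b[of k] by auto

lemma ext_prod_continuous: "continuous_on (sphere 0 R) (\<lambda>w. ext_prod y M (\<lambda>k. of_real (b k) / (of_real (b k) - w)))"
proof -
  have "b k \<noteq> 0" for k using b[of k] by simp
  then show ?thesis
    unfolding ext_prod_def using b_minus_nonzero
    by (cases "y \<le> M"; cases "M = y - 1") (auto intro!: continuous_intros)
qed

lemma site_fun_continuous: "continuous_on (sphere 0 R) (site_fun b M y t)"
  unfolding site_fun_def by (intro continuous_intros ext_prod_continuous)

lemma site_funs_continuous: "f \<in> set (site_funs b M Y t S) \<Longrightarrow> continuous_on (sphere 0 R) f"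
  using site_fun_continuous by (auto simp: site_funs_def)

lemma site_fun_shift:
  fixes w :: complex
  assumes "norm w = R"
  shows "site_fun b M (y + 1) t w = site_fun b M y t w + (- 1 / of_real (b y)) * (w * site_fun b M y t w)"
proof -
  have "of_real (b y) - w \<noteq> 0" "b y \<noteq> 0" using b_minus_nonzero[OF assms] b[of y] by auto
  then have "ext_prod (y + 1) M (\<lambda>k. of_real (b k) / (of_real (b k) - w))
     = ext_prod y M (\<lambda>k. of_real (b k) / (of_real (b k) - w)) * ((of_real (b y) - w) / of_real (b y))"
    by (subst ext_prod_shift) auto
  also have "\<dots> = ext_prod y M (\<lambda>k. of_real (b k) / (of_real (b k) - w))
     + (- 1 / of_real (b y)) * (w * ext_prod y M (\<lambda>k. of_real (b k) / (of_real (b k) - w)))"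
    using \<open>b y \<noteq> 0\<close> by (simp add: field_simps)
  finally show ?thesis
    unfolding site_fun_def by (simp only:) (simp add: algebra_simps)
qed

lemma site_mean_shift:
  assumes "finite S" "k < card S" and s: "s = sorted_list_of_set S ! k"
  shows "site_mean (Y(s := Y s + 1)) t S - site_mean Y t S
     = (- 1 / of_real (b (Y s))) * torus_mean q R ((site_funs b M Y t S)[k := \<lambda>w. w * site_fun b M (Y s) t w])"
proof -
  let ?l = "sorted_list_of_set S" and ?g = "site_fun b M (Y s) t"
  have dist: "i = k" if "i < card S" "?l ! i = s" for i
    using that assms nth_eq_iff_index_eq[of ?l i k] by simp
  have "site_mean (Y(s := Y s + 1)) t S
      = torus_mean q R ((site_funs b M Y t S)[k := \<lambda>w. ?g w + (- 1 / of_real (b (Y s))) * (w * ?g w)])"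
  proof (rule torus_mean_cong[OF R])
    fix i and w :: complex assume i: "i < length ((site_funs b M Y t S)[k := \<lambda>w. ?g w + (- 1 / of_real (b (Y s))) * (w * ?g w)])"
      and w: "norm w = R"
    show "(site_funs b M (Y(s := Y s + 1)) t S ! i) w = ((site_funs b M Y t S)[k := \<lambda>w. ?g w + (- 1 / of_real (b (Y s))) * (w * ?g w)] ! i) w"
      using i dist[of i] s site_fun_shift[OF w] by (cases "i = k") (auto simp: site_funs_def nth_list_update)
  qed simp
  also have "\<dots> = torus_mean q R ((site_funs b M Y t S)[k := ?g])
      + (- 1 / of_real (b (Y s))) * torus_mean q R ((site_funs b M Y t S)[k := \<lambda>w. w * ?g w])"
    using assms(2) by (intro torus_mean_update_add[OF q R] continuous_intros site_fun_continuous)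
      (auto intro: site_funs_continuous)
  also have "(site_funs b M Y t S)[k := ?g] = site_funs b M Y t S"
    using assms by (intro list_update_same_conv[THEN iffD2]) (auto simp: site_funs_def)
  finally show ?thesis by (simp only: add_diff_cancel_left')
qed

lemma site_mean_shift_notin: "s \<notin> S \<Longrightarrow> finite S \<Longrightarrow> site_mean (Y(s := y)) t S = site_mean Y t S"
  by (auto simp: site_funs_def intro!: arg_cong[where f = "torus_mean q R"])

lemma torus_mean_update_0:
  assumes "k < length fs" "\<And>f. f \<in> set fs \<Longrightarrow> continuous_on (sphere 0 R) f"
  shows "torus_mean q R (fs[k := \<lambda>_. 0]) = 0"
  using torus_mean_update_add[OF q R assms, of "\<lambda>_. 0" "\<lambda>_. 0" 1] by simp

text \<open>Differentiation inserts -w into each variable in turn, and by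
  \<open>site_mean_shift\<close> this is b (Y s) times the increment in the coordinate s. Labels
  outside S have increment 0, so the sum may run over all labels.\<close>

lemma site_mean_derivative:
  assumes "S \<subseteq> {1..N}"
  shows "((\<lambda>t. site_mean Y t S) has_vector_derivative
     (\<Sum>s=1..N. of_real (b (Y s)) * (site_mean (Y(s := Y s + 1)) t S - site_mean Y t S))) (at t)"
proof -
  have fin: "finite S" using assms finite_subset by auto
  let ?l = "sorted_list_of_set S"
  let ?fs = "map (\<lambda>s w. ext_prod (Y s) M (\<lambda>k. of_real (b k) / (of_real (b k) - w))) ?l"
  let ?W = "\<lambda>t::complex. torus_mean q R (map (\<lambda>f w. f w * exp (- w * t)) ?fs)"
  let ?D = "\<Sum>k<length ?fs. torus_mean q R ((map (\<lambda>f w. f w * exp (- w * of_real t)) ?fs)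
      [k := \<lambda>w. - w * ((?fs ! k) w * exp (- w * of_real t))])"
  have sf: "map (\<lambda>f w. f w * exp (- w * of_real t)) ?fs = site_funs b M Y t S" for t
    by (simp add: site_funs_def site_fun_def[abs_def])
  have "continuous_on (sphere 0 R) f" if "f \<in> set ?fs" for f
    using that ext_prod_continuous by auto
  then have "(?W has_field_derivative ?D) (at (of_real t))"
    by (rule torus_mean_exp_derivative[OF q R])
  then have "((?W \<circ> of_real) has_vector_derivative (1 * ?D)) (at t)"
    by (intro field_vector_diff_chain_at) (auto intro!: derivative_eq_intros simp: has_vector_derivative_def scaleR_conv_of_real)
  moreover have "?W \<circ> of_real = (\<lambda>t. site_mean Y t S)"
    unfolding o_def sf ..
  moreover have "?D = (\<Sum>s=1..N. of_real (b (Y s)) * (site_mean (Y(s := Y s + 1)) t S - site_mean Y t S))"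
  proof -
    have "?D = (\<Sum>k<card S. of_real (b (Y (?l ! k))) * (site_mean (Y(?l ! k := Y (?l ! k) + 1)) t S - site_mean Y t S))"
    proof (rule sum.cong)
      fix k assume "k \<in> {..<card S}"
      then have k: "k < card S" "k < length ?l" by auto
      let ?g = "site_fun b M (Y (?l ! k)) t"
      \<comment> \<open>The factor -w is written as 0 + (-1) w, so that linearity in the k-th
        function draws out the sign.\<close>
      have "torus_mean q R ((site_funs b M Y t S)[k := \<lambda>w. 0 + (- 1) * (w * ?g w)])
         = torus_mean q R ((site_funs b M Y t S)[k := \<lambda>_. 0]) + (- 1) * torus_mean q R ((site_funs b M Y t S)[k := \<lambda>w. w * ?g w])"
        using k by (intro torus_mean_update_add[OF q R] continuous_intros site_fun_continuous) (auto intro: site_funs_continuous)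
      also have "torus_mean q R ((site_funs b M Y t S)[k := \<lambda>_. 0]) = 0"
        using k by (intro torus_mean_update_0) (auto intro: site_funs_continuous)
      finally have "torus_mean q R ((site_funs b M Y t S)[k := \<lambda>w. - w * ?g w])
        = - torus_mean q R ((site_funs b M Y t S)[k := \<lambda>w. w * ?g w])" by simp
      also have "\<dots> = of_real (b (Y (?l ! k))) * (site_mean (Y(?l ! k := Y (?l ! k) + 1)) t S - site_mean Y t S)"
        unfolding site_mean_shift[OF fin k(1) refl] using b[of "Y (?l ! k)"] by simp
      finally show "torus_mean q R ((map (\<lambda>f w. f w * exp (- w * of_real t)) ?fs)
          [k := \<lambda>w. - w * ((?fs ! k) w * exp (- w * of_real t))])
         = of_real (b (Y (?l ! k))) * (site_mean (Y(?l ! k := Y (?l ! k) + 1)) t S - site_mean Y t S)"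
        unfolding sf using k(2) by (simp add: site_fun_def[abs_def])
    qed simp
    also have "\<dots> = (\<Sum>s\<in>S. of_real (b (Y s)) * (site_mean (Y(s := Y s + 1)) t S - site_mean Y t S))"
    proof -
      have "bij_betw ((!) ?l) {..<card S} S"
        using fin by (intro bij_betw_nth) auto
      then show ?thesis by (rule sum.reindex_bij_betw)
    qed
    also have "\<dots> = (\<Sum>s=1..N. of_real (b (Y s)) * (site_mean (Y(s := Y s + 1)) t S - site_mean Y t S))"
      using assms fin by (intro sum.mono_neutral_left) (auto simp: site_mean_shift_notin)
    finally show ?thesis .
  qed
  ultimately show ?thesis by simp
qed

text \<open>At equal positions the two adjacent variables carry the same function g. The two
  increments insert w at the second or at the first of them, which is what
  \<open>torus_mean_exchange\<close> compares.\<close>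

lemma site_mean_increment_both:
  assumes "finite S" "s \<in> S" "Suc s \<in> S" and eq: "Y s = Y (Suc s)"
  shows "site_mean (Y(Suc s := Y (Suc s) + 1)) t S - site_mean Y t S
     = of_real q * (site_mean (Y(s := Y s + 1)) t S - site_mean Y t S)"
proof -
  let ?A = "{i \<in> S. i < s}" and ?B = "{i \<in> S. Suc s < i}" and ?g = "site_fun b M (Y s) t"
  have S: "S = ?A \<union> ({s, Suc s} \<union> ?B)" using assms by auto
  have "sorted_list_of_set S = sorted_list_of_set (?A \<union> ({s, Suc s} \<union> ?B))"
    by (rule arg_cong[OF S])
  also have "\<dots> = sorted_list_of_set ?A @ sorted_list_of_set ({s, Suc s} \<union> ?B)"
    by (rule sorted_list_of_set_Un) (use assms(1) in auto)
  also have "sorted_list_of_set ({s, Suc s} \<union> ?B) = sorted_list_of_set {s, Suc s} @ sorted_list_of_set ?B"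
    by (rule sorted_list_of_set_Un) (use assms(1) in auto)
  finally have l: "sorted_list_of_set S = sorted_list_of_set ?A @ [s, Suc s] @ sorted_list_of_set ?B"
    by simp
  define hs fs where "hs = site_funs b M Y t ?A" and "fs = site_funs b M Y t ?B"
  let ?k = "length hs"
  have len: "length (sorted_list_of_set ?A) = ?k" by (simp add: hs_def)
  have sf: "site_funs b M Y t S = hs @ ?g # ?g # fs"
    unfolding site_funs_def l hs_def fs_def using eq by simp
  have "card S = length (hs @ ?g # ?g # fs)"
    unfolding sf[symmetric] by simp
  then have k: "?k < card S" "Suc ?k < card S" by simp_all
  have nth: "s = sorted_list_of_set S ! ?k" "Suc s = sorted_list_of_set S ! Suc ?k"
    unfolding l len[symmetric] by (simp_all add: nth_append)
  have u: "(site_funs b M Y t S)[?k := h] = hs @ h # ?g # fs" "(site_funs b M Y t S)[Suc ?k := h] = hs @ ?g # h # fs" for h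
    unfolding sf by (simp_all add: list_update_append)
  have 1: "site_mean (Y(s := Y s + 1)) t S - site_mean Y t S
     = (- 1 / of_real (b (Y s))) * torus_mean q R (hs @ (\<lambda>w. w * ?g w) # ?g # fs)"
    using site_mean_shift[OF assms(1) k(1) nth(1), of Y t] unfolding u .
  have 2: "site_mean (Y(Suc s := Y (Suc s) + 1)) t S - site_mean Y t S
     = (- 1 / of_real (b (Y s))) * torus_mean q R (hs @ ?g # (\<lambda>w. w * ?g w) # fs)"
    using site_mean_shift[OF assms(1) k(2) nth(2), of Y t] unfolding u eq[symmetric] .
  show ?thesis
    unfolding 1 2
    by (subst torus_mean_exchange[OF q R]) (auto intro: site_fun_continuous site_funs_continuous simp: fs_def)
qed

text \<open>The right side of the first formula for the circle of radius R, as a function of the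
  initial configuration and time.\<close>

definition contour_prob :: "nat \<Rightarrow> (nat \<Rightarrow> int) \<Rightarrow> real \<Rightarrow> complex" where
  "contour_prob n Y t = (\<Sum>S\<in>Pow {1..N}. of_real (signed_c q n S) * site_mean Y t S)"

lemma contour_prob_derivative:
  "((\<lambda>t. contour_prob n Y t) has_vector_derivative
     (\<Sum>s=1..N. of_real (b (Y s)) * (contour_prob n (Y(s := Y s + 1)) t - contour_prob n Y t))) (at t)"
proof -
  have "((\<lambda>t. contour_prob n Y t) has_vector_derivative
     (\<Sum>S\<in>Pow {1..N}. of_real (signed_c q n S) *
       (\<Sum>s=1..N. of_real (b (Y s)) * (site_mean (Y(s := Y s + 1)) t S - site_mean Y t S)))) (at t)"
    unfolding contour_prob_def
    by (intro has_vector_derivative_sum has_vector_derivative_mult_right site_mean_derivative) auto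
  also have "(\<Sum>S\<in>Pow {1..N}. of_real (signed_c q n S) *
       (\<Sum>s=1..N. of_real (b (Y s)) * (site_mean (Y(s := Y s + 1)) t S - site_mean Y t S)))
     = (\<Sum>s=1..N. of_real (b (Y s)) * (contour_prob n (Y(s := Y s + 1)) t - contour_prob n Y t))"
    unfolding contour_prob_def sum_distrib_left sum_subtractf[symmetric]
    by (subst sum.swap) (simp add: algebra_simps)
  finally show ?thesis .
qed

text \<open>If \<open>S\<close> contains only one of \<open>s\<close> and \<open>s + 1\<close>, exchanging the two labels multiplies the
  coefficient by \<open>q\<close> and leaves the integral unchanged.\<close>

lemma contour_prob_boundary:
  assumes n: "1 \<le> n" and s: "1 \<le> s" "s < N" and eq: "Y s = Y (Suc s)"
  shows "contour_prob n (Y(Suc s := Y (Suc s) + 1)) t - contour_prob n Y t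
     = of_real q * (contour_prob n (Y(s := Y s + 1)) t - contour_prob n Y t)"
proof -
  let ?\<sigma> = "Transposition.transpose s (Suc s)"
  let ?D = "\<lambda>s S. site_mean (Y(s := Y s + 1)) t S - site_mean Y t S"
  have main: "of_real (signed_c q n (?\<sigma> ` S)) * ?D (Suc s) (?\<sigma> ` S) = of_real q * (of_real (signed_c q n S) * ?D s S)"
    if S: "S \<in> Pow {1..N}" for S
  proof -
    have fin: "finite S" using S finite_subset by auto
    consider "s \<in> S" "Suc s \<in> S" | "s \<in> S" "Suc s \<notin> S" | "s \<notin> S" by blast
    then show ?thesis
    proof cases
      case 1
      \<comment> \<open>The transposition fixes S and with it the coefficient; the factor q comes
        from the integral.\<close>
      then have "?\<sigma> ` S = S" by (auto simp: Transposition.transpose_def image_iff)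
      then show ?thesis using site_mean_increment_both[OF fin 1 eq, of t] by simp
    next
      case 2
      have sm: "strict_mono_on S ?\<sigma>"
      proof (rule strict_mono_onI)
        fix x y assume "x \<in> S" "y \<in> S" "x < y"
        moreover from this 2 have "x \<noteq> Suc s" "y \<noteq> Suc s" by auto
        ultimately show "?\<sigma> x < ?\<sigma> y" by (cases "x = s"; cases "y = s") (simp_all add: Transposition.transpose_def)
      qed
      have l: "sorted_list_of_set (?\<sigma> ` S) = map ?\<sigma> (sorted_list_of_set S)"
        by (rule sorted_list_of_set_image_strict_mono[OF fin sm])
      have "site_funs b M Y t (?\<sigma> ` S) = site_funs b M Y t S"
        unfolding site_funs_def l using eq by (auto simp: Transposition.transpose_def)
      moreover have "site_funs b M (Y(Suc s := Y (Suc s) + 1)) t (?\<sigma> ` S) = site_funs b M (Y(s := Y s + 1)) t S"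
        unfolding site_funs_def l using eq 2 fin by (auto simp: Transposition.transpose_def)
      moreover have "signed_c q n (?\<sigma> ` S) = q * signed_c q n S"
      proof -
        have inj: "inj_on ?\<sigma> S" by (rule strict_mono_on_imp_inj_on[OF sm])
        have "S = insert s (S - {s})" using 2 by auto
        moreover have "?\<sigma> ` (S - {s}) = S - {s}" using 2 by (auto simp: Transposition.transpose_def image_iff)
        ultimately have im: "?\<sigma> ` S = insert (Suc s) (S - {s})" by (metis image_insert transpose_apply_first)
        have "\<Sum>(?\<sigma> ` S) = Suc s + \<Sum>(S - {s})" unfolding im using 2 fin by (subst sum.insert) auto
        moreover have "\<Sum>S = s + \<Sum>(S - {s})" using 2 fin by (simp add: sum.remove)
        ultimately have "\<Sum>(?\<sigma> ` S) = \<Sum>S + 1" by simp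
        then have e: "q powi (int (n * (n - 1) div 2) - int n * int (card S) + int (\<Sum>(?\<sigma> ` S)))
            = q * q powi (int (n * (n - 1) div 2) - int n * int (card S) + int (\<Sum>S))"
          using q by (simp add: power_int_add)
        show ?thesis
          unfolding signed_c_eq[OF q n] card_image[OF inj] e by simp
      qed
      ultimately show ?thesis by simp
    next
      case 3
      \<comment> \<open>Neither integral involves the raised coordinate, so both sides are
        0.\<close>
      then have "Suc s \<notin> ?\<sigma> ` S" by (auto simp: Transposition.transpose_def image_iff)
      then show ?thesis using 3 fin by (simp add: site_mean_shift_notin)
    qed
  qed
  have bij: "bij_betw ((`) ?\<sigma>) (Pow {1..N}) (Pow {1..N})"
  proof (rule bij_betw_Pow)
    show "bij_betw ?\<sigma> {1..N} {1..N}"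
      using s by (intro bij_betw_byWitness[where f' = ?\<sigma>]) (auto simp: Transposition.transpose_def)
  qed
  have P: "contour_prob n (Y(j := Y j + 1)) t - contour_prob n Y t = (\<Sum>S\<in>Pow {1..N}. of_real (signed_c q n S) * ?D j S)" for j
    by (simp add: contour_prob_def sum_subtractf algebra_simps)
  have "(\<Sum>S\<in>Pow {1..N}. of_real (signed_c q n S) * ?D (Suc s) S)
     = (\<Sum>S\<in>Pow {1..N}. of_real (signed_c q n (?\<sigma> ` S)) * ?D (Suc s) (?\<sigma> ` S))"
    by (rule sum.reindex_bij_betw[OF bij, symmetric])
  also have "\<dots> = of_real q * (\<Sum>S\<in>Pow {1..N}. of_real (signed_c q n S) * ?D s S)"
    unfolding sum_distrib_left by (intro sum.cong refl main)
  finally show ?thesis unfolding P .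
qed

end

section \<open>Generator, initial value and bound: identification with the transition
  probabilities\<close>

context qtazrp_contour
begin

lemma weyl_chamberD: "Y \<in> weyl_chamber N \<Longrightarrow> i \<in> {1..N} \<Longrightarrow> j \<in> {1..N} \<Longrightarrow> i \<le> j \<Longrightarrow> Y j \<le> Y i"
  by (auto simp: weyl_chamber_def)

lemma labels_at_interval:
  assumes Y: "Y \<in> weyl_chamber N" and z: "z \<in> Y ` {1..N}"
  shows "labels_at N Y z = {Min (labels_at N Y z)..<Min (labels_at N Y z) + card (labels_at N Y z)}"
proof -
  let ?L = "labels_at N Y z"
  have fin: "finite ?L" and ne: "?L \<noteq> {}" using z by (auto simp: labels_at_def)
  have m: "Min ?L \<in> ?L" "Max ?L \<in> ?L" using fin ne by auto
  have "?L = {Min ?L..Max ?L}"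
  proof
    show "?L \<subseteq> {Min ?L..Max ?L}" using fin by auto
    show "{Min ?L..Max ?L} \<subseteq> ?L"
    proof
      fix i assume i: "i \<in> {Min ?L..Max ?L}"
      then have "i \<in> {1..N}" using m by (auto simp: labels_at_def)
      moreover have "Y i \<le> z" "z \<le> Y i"
        using weyl_chamberD[OF Y, of "Min ?L" i] weyl_chamberD[OF Y, of i "Max ?L"] m i calculation
        by (auto simp: labels_at_def)
      ultimately show "i \<in> ?L" by (simp add: labels_at_def)
    qed
  qed
  moreover have "card {Min ?L..Max ?L} = Suc (Max ?L) - Min ?L" by simp
  moreover have "Min ?L \<le> Max ?L" using fin ne by simp
  ultimately have "Min ?L + card ?L = Suc (Max ?L)" by simp
  then show ?thesis using \<open>?L = {Min ?L..Max ?L}\<close> by (simp add: atLeastLessThanSuc_atLeastAtMost)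
qed

text \<open>The k labels at a site z are consecutive, and their increments form a geometric sequence
  with ratio q starting at the smallest label, the one that jumps. With b z = (1 - q) a z, their sum
  weighted by b z has the factor a z (1 - q^k), the jump rate.\<close>

lemma contour_prob_generator:
  assumes n: "1 \<le> n" and Y: "Y \<in> weyl_chamber N"
  shows "(\<Sum>s=1..N. of_real (b (Y s)) * (contour_prob n (Y(s := Y s + 1)) t - contour_prob n Y t))
     = (\<Sum>z\<in>Y ` {1..N}. of_real (jump_rate q a N Y z) * (contour_prob n (jump_from N Y z) t - contour_prob n Y t))"
proof -
  define \<Delta> where "\<Delta> s = contour_prob n (Y(s := Y s + 1)) t - contour_prob n Y t" for s
  have "(\<Sum>s=1..N. of_real (b (Y s)) * \<Delta> s) = (\<Sum>z\<in>Y ` {1..N}. \<Sum>s\<in>labels_at N Y z. of_real (b (Y s)) * \<Delta> s)"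
    unfolding labels_at_def by (rule sum.image_gen) simp
  also have "\<dots> = (\<Sum>z\<in>Y ` {1..N}. of_real (jump_rate q a N Y z) * (contour_prob n (jump_from N Y z) t - contour_prob n Y t))"
  proof (rule sum.cong)
    fix z assume z: "z \<in> Y ` {1..N}"
    define m k where "m = Min (labels_at N Y z)" and "k = card (labels_at N Y z)"
    have L: "labels_at N Y z = {m..<m + k}"
      using labels_at_interval[OF Y z] by (simp add: m_def k_def)
    have \<Delta>: "\<Delta> (m + i) = of_real q ^ i * \<Delta> m" if "i < k" for i
      using that
    proof (induction i)
      case (Suc i)
      then have "m + i \<in> labels_at N Y z" "Suc (m + i) \<in> labels_at N Y z" unfolding L by auto
      then have "1 \<le> m + i" "m + i < N" "Y (m + i) = Y (Suc (m + i))" by (auto simp: labels_at_def)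
      then have "\<Delta> (Suc (m + i)) = of_real q * \<Delta> (m + i)"
        unfolding \<Delta>_def by (rule contour_prob_boundary[OF n])
      then show ?case using Suc by simp
    qed simp
    have "(\<Sum>s\<in>labels_at N Y z. of_real (b (Y s)) * \<Delta> s) = (\<Sum>s\<in>{m..<m + k}. of_real (b z) * \<Delta> s)"
      unfolding L[symmetric] by (intro sum.cong) (auto simp: labels_at_def)
    also have "\<dots> = (\<Sum>i<k. of_real (b z) * \<Delta> (m + i))"
      using sum.atLeastLessThan_shift_0[of "\<lambda>s. of_real (b z) * \<Delta> s" m "m + k"]
      by (simp add: lessThan_atLeast0 add.commute)
    also have "\<dots> = of_real (b z) * (\<Sum>i<k. of_real q ^ i) * \<Delta> m"
      by (simp add: \<Delta> sum_distrib_left sum_distrib_right mult.assoc)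
    also have "of_real (b z) * (\<Sum>i<k. of_real q ^ i) = (of_real (jump_rate q a N Y z) :: complex)"
    proof -
      have "jump_rate q a N Y z = b z * (\<Sum>i<k. q ^ i)"
        unfolding jump_rate_def k_def[symmetric] ab one_diff_power_eq by simp
      then show ?thesis by simp
    qed
    also have "\<Delta> m = contour_prob n (jump_from N Y z) t - contour_prob n Y t"
      using Min_labels_at(2)[OF z] by (simp add: \<Delta>_def jump_from_def m_def)
    finally show "(\<Sum>s\<in>labels_at N Y z. of_real (b (Y s)) * \<Delta> s)
        = of_real (jump_rate q a N Y z) * (contour_prob n (jump_from N Y z) t - contour_prob n Y t)" .
  qed simp
  finally show ?thesis by (simp add: \<Delta>_def)
qed

text \<open>The particles beyond M have the smallest labels, hence the outermost variables, and
  their functions are entire with value 1 at 0. They can be integrated out one after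
  another.\<close>

lemma site_mean_restrict:
  assumes S: "S \<subseteq> {1..N}" and Y: "\<And>i j. i \<in> {1..N} \<Longrightarrow> j \<in> {1..N} \<Longrightarrow> i \<le> j \<Longrightarrow> Y j \<le> Y i"
  shows "site_mean Y t S = site_mean Y t {s \<in> S. Y s \<le> M}"
proof -
  let ?A = "{s \<in> S. M < Y s}" and ?B = "{s \<in> S. Y s \<le> M}"
  have fin: "finite S" using S finite_subset by auto
  have "site_funs b M Y t (?A \<union> ?B) = site_funs b M Y t ?A @ site_funs b M Y t ?B"
  proof (rule site_funs_Un)
    fix i j assume "i \<in> ?A" "j \<in> ?B"
    then show "i < j" using Y[of j i] S by force
  qed (use fin in auto)
  moreover have "torus_mean q R (site_funs b M Y t ?A @ site_funs b M Y t ?B) = site_mean Y t ?B"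
  proof (rule torus_mean_append_holomorphic[OF q R])
    fix f assume "f \<in> set (site_funs b M Y t ?A)"
    then obtain s where s: "M < Y s" "f = site_fun b M (Y s) t" using fin by (auto simp: site_funs_def)
    have "b k \<noteq> 0" for k using b[of k] by simp
    then show "f holomorphic_on cball 0 R \<and> f 0 = 1" using site_fun_entire[OF s(1)] s(2) by simp
  qed (rule site_funs_continuous)
  moreover have "?A \<union> ?B = S" by auto
  ultimately show ?thesis by simp
qed

text \<open>Particles beyond M contribute nothing wherever they stand, so they can all be put at M +
  1.\<close>

lemma site_mean_clamp:
  assumes S: "S \<subseteq> {1..N}" and Y: "Y \<in> weyl_chamber N"
  shows "site_mean Y t S = site_mean (\<lambda>i\<in>{1..N}. min (Y i) (M + 1)) t S"
proof -
  let ?Y = "\<lambda>i\<in>{1..N}. min (Y i) (M + 1)"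
  have fin: "finite S" using S finite_subset by auto
  have "{s \<in> S. ?Y s \<le> M} = {s \<in> S. Y s \<le> M}" using S by auto
  moreover have "site_funs b M ?Y t {s \<in> S. Y s \<le> M} = site_funs b M Y t {s \<in> S. Y s \<le> M}"
    using S fin by (auto simp: site_funs_def)
  moreover have "site_mean ?Y t S = site_mean ?Y t {s \<in> S. ?Y s \<le> M}"
    using weyl_chamberD[OF Y] by (intro site_mean_restrict S) fastforce
  ultimately show ?thesis
    using site_mean_restrict[OF S weyl_chamberD[OF Y]] by simp
qed

lemma contour_prob_clamp:
  "Y \<in> weyl_chamber N \<Longrightarrow> contour_prob n Y t = contour_prob n (\<lambda>i\<in>{1..N}. min (Y i) (M + 1)) t"
  unfolding contour_prob_def using site_mean_clamp by (intro sum.cong) auto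

text \<open>If a particle of S is not beyond M, the one with the largest label has the innermost
  variable. At time 0 its function is without the exponential, whose singularity at infinity is
  essential, and so it vanishes at infinity.\<close>

lemma site_mean_0:
  assumes S: "S \<subseteq> {1..N}" and Y: "Y \<in> weyl_chamber N"
  shows "site_mean Y 0 S = of_bool (S \<subseteq> {i. M < Y i})"
proof -
  have restrict: "site_mean Y 0 S = site_mean Y 0 {s \<in> S. Y s \<le> M}"
    by (rule site_mean_restrict[OF S]) (rule weyl_chamberD[OF Y])
  show ?thesis
  proof (cases "S \<subseteq> {i. M < Y i}")
    case True
    then have empty: "{s \<in> S. Y s \<le> M} = {}" by auto
    show ?thesis unfolding restrict empty using True by (simp add: site_funs_def)
  next
    case False
    let ?T = "{s \<in> S. Y s \<le> M}"
    have "finite S" using S finite_subset by auto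
    then have fin: "finite ?T" and ne: "?T \<noteq> {}" using False by auto
    let ?m = "Max ?T"
    have m: "?m \<in> ?T" using fin ne by (rule Max_in)
    have "?T = (?T - {?m}) \<union> {?m}" using m by auto
    moreover have "site_funs b M Y 0 ((?T - {?m}) \<union> {?m}) = site_funs b M Y 0 (?T - {?m}) @ site_funs b M Y 0 {?m}"
    proof (rule site_funs_Un)
      fix i j assume "i \<in> ?T - {?m}" "j \<in> {?m}"
      then show "i < j" using Max_ge[OF fin, of i] by auto
    qed (use fin in auto)
    moreover have "site_funs b M Y 0 {?m} = [\<lambda>w. ext_prod (Y ?m) M (\<lambda>k. of_real (b k) / (of_real (b k) - w))]"
      by (simp add: site_funs_def site_fun_def[abs_def])
    ultimately have "site_mean Y 0 ?T = torus_mean q R (site_funs b M Y 0 (?T - {?m})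
        @ [\<lambda>w. ext_prod (Y ?m) M (\<lambda>k. of_real (b k) / (of_real (b k) - w))])"
      by simp
    also have "\<dots> = 0"
      using m by (intro torus_mean_snoc_exterior_null[OF q R] exterior_null_ext_prod R b) auto
    finally show ?thesis using restrict False by simp
  qed
qed

lemma contour_prob_0:
  assumes n: "1 \<le> n" "n \<le> N" and Y: "Y \<in> weyl_chamber N"
  shows "contour_prob n Y 0 = of_bool (M < Y n)"
proof -
  let ?Z = "{i \<in> {1..N}. M < Y i}"
  obtain m where m: "?Z = {1..m}"
  proof (cases "?Z = {}")
    case True
    then show ?thesis using that[of 0] by simp
  next
    case False
    have "finite ?Z" by simp
    then have mx: "Max ?Z \<in> ?Z" using False by (rule Max_in)
    have "?Z = {1..Max ?Z}"
    proof
      show "?Z \<subseteq> {1..Max ?Z}" using Max_ge[OF \<open>finite ?Z\<close>] by auto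
      show "{1..Max ?Z} \<subseteq> ?Z"
      proof
        fix i assume "i \<in> {1..Max ?Z}"
        then show "i \<in> ?Z" using mx weyl_chamberD[OF Y, of i "Max ?Z"] by auto
      qed
    qed
    then show ?thesis by (rule that)
  qed
  have mem: "i \<in> {1..N} \<and> M < Y i \<longleftrightarrow> i \<in> {1..m}" for i using m by blast
  have "contour_prob n Y 0 = (\<Sum>S\<in>Pow {1..m}. of_real (signed_c q n S))"
    unfolding contour_prob_def
  proof (rule sum.mono_neutral_cong_right)
    show "Pow {1..m} \<subseteq> Pow {1..N}" using m by blast
    show "\<forall>S\<in>Pow {1..N} - Pow {1..m}. of_real (signed_c q n S) * site_mean Y 0 S = 0"
    proof
      fix S assume S: "S \<in> Pow {1..N} - Pow {1..m}"
      then have "\<not> S \<subseteq> {i. M < Y i}" using mem by blast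
      then show "of_real (signed_c q n S) * site_mean Y 0 S = 0"
        using site_mean_0[OF _ Y, of S] S by simp
    qed
    fix S assume S: "S \<in> Pow {1..m}"
    then have "S \<subseteq> {i. M < Y i}" "S \<subseteq> {1..N}" using mem by blast+
    then show "of_real (signed_c q n S) * site_mean Y 0 S = of_real (signed_c q n S)"
      using site_mean_0[OF _ Y, of S] by simp
  qed simp
  also have "\<dots> = of_real (\<Sum>S\<in>Pow {1..m}. signed_c q n S)" by simp
  also have "\<dots> = of_bool (n \<le> m)" unfolding sum_signed_c[OF q n(1)] by simp
  also have "n \<le> m \<longleftrightarrow> M < Y n" using mem[of n] n by auto
  finally show ?thesis .
qed

lemma contour_prob_continuous: "continuous_on A (\<lambda>t. contour_prob n Y t)"
  using contour_prob_derivative has_vector_derivative_continuous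
  by (meson continuous_at_imp_continuous_on)

text \<open>After truncation at M + 1 only finitely many configurations remain, each giving a
  continuous function on a compact time interval.\<close>

lemma contour_prob_bounded:
  "\<exists>G. \<forall>Y\<in>weyl_chamber N. \<forall>t. (\<forall>i\<in>{1..N}. c \<le> Y i) \<longrightarrow> 0 \<le> t \<longrightarrow> t \<le> T \<longrightarrow> norm (contour_prob n Y t) \<le> G"
proof -
  \<comment> \<open>The minimum with M + 1 is for c > M + 1, when truncation moves coordinates below
    c.\<close>
  let ?Q = "{1..N} \<rightarrow>\<^sub>E {min c (M + 1)..M + 1}"
  have "bounded (\<Union>Y\<in>?Q. (\<lambda>t. contour_prob n Y t) ` {0..T})"
    by (intro bounded_UN ballI finite_PiE compact_imp_bounded compact_continuous_image contour_prob_continuous) auto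
  then obtain G where G: "\<And>Y t. Y \<in> ?Q \<Longrightarrow> t \<in> {0..T} \<Longrightarrow> norm (contour_prob n Y t) \<le> G"
    unfolding bounded_iff by blast
  show ?thesis
  proof (intro exI[of _ G] ballI allI impI)
    fix Y and t :: real assume Y: "Y \<in> weyl_chamber N" "\<forall>i\<in>{1..N}. c \<le> Y i" and t: "0 \<le> t" "t \<le> T"
    have "(\<lambda>i\<in>{1..N}. min (Y i) (M + 1)) \<in> ?Q"
      using Y(2) by (auto simp: min_le_iff_disj)
    then show "norm (contour_prob n Y t) \<le> G"
      unfolding contour_prob_clamp[OF Y(1)] using t by (intro G) auto
  qed
qed

lemma contour_prob_eq_measure:
  assumes tf: "transition_function (weyl_chamber N) (qtazrp_generator q a N) p"
    and n: "1 \<le> n" "n \<le> N" and Y: "Y \<in> weyl_chamber N" and t: "0 \<le> t"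
  shows "of_real (measure (p t Y) {x. M < x n}) = contour_prob n Y t"
proof -
  define c where "c = Min (Y ` {1..N})"
  \<comment> \<open>Jumps go to the right and stay in this set, on which
    \<open>contour_prob_bounded\<close> gives a uniform bound.\<close>
  define A where "A = {X \<in> weyl_chamber N. \<forall>i\<in>{1..N}. c \<le> X i}"
  \<comment> \<open>At most N sites are occupied, and the rate at z is at most a z, where (1 - q) a
    z < R.\<close>
  define \<Lambda> where "\<Lambda> = real N * (R / (1 - q))"
  have YA: "Y \<in> A" using Y by (simp add: A_def c_def)
  obtain G where G: "\<And>X s. X \<in> A \<Longrightarrow> 0 \<le> s \<Longrightarrow> s \<le> t \<Longrightarrow> norm (contour_prob n X s) \<le> G"
    using contour_prob_bounded[of c t n] unfolding A_def by blast
  let ?u = "\<lambda>t X. of_real (measure (p t X) {x. M < x n}) :: complex"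
  have a: "0 < a z" "a z \<le> R / (1 - q)" for z
  proof -
    have "0 < (1 - q) * a z" "(1 - q) * a z < R" using b[of z] ab[of z] by simp_all
    then show "0 < a z" "a z \<le> R / (1 - q)"
      using q by (auto simp: field_simps intro: zero_less_mult_pos[of "1 - q" "a z"])
  qed
  have "?u t Y - contour_prob n Y t = 0"
  proof (rule backward_equation_unique[where A = A and Z = "\<lambda>X. X ` {1..N}" and J = "jump_from N"
        and r = "jump_rate q a N" and \<Lambda> = \<Lambda> and T = t and G = "1 + G" and g = "\<lambda>t X. ?u t X - contour_prob n X t"])
    fix X z assume X: "X \<in> A" and z: "z \<in> X ` {1..N}"
    have "c \<le> jump_from N X z i" if "i \<in> {1..N}" for i
    proof -
      have "c \<le> X i" "c \<le> z" using that X z by (auto simp: A_def)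
      then show ?thesis by (simp add: jump_from_def)
    qed
    then show "jump_from N X z \<in> A" using jump_from_weyl_chamber[OF _ z] X by (simp add: A_def)
    show "0 \<le> jump_rate q a N X z"
      using a[of z] q by (auto simp: jump_rate_def power_le_one)
  next
    fix X assume "X \<in> A"
    have "jump_rate q a N X z \<le> R / (1 - q)" for z
    proof -
      have "a z * (1 - q ^ card (labels_at N X z)) \<le> a z * 1" using a[of z] q by (intro mult_left_mono) auto
      then have "jump_rate q a N X z \<le> a z" by (simp only: jump_rate_def mult_1_right)
      also have "\<dots> \<le> R / (1 - q)" by (rule a(2))
      finally show ?thesis .
    qed
    then have "(\<Sum>z\<in>X ` {1..N}. jump_rate q a N X z) \<le> real (card (X ` {1..N})) * (R / (1 - q))"
      by (intro sum_bounded_above)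
    also have "\<dots> \<le> real N * (R / (1 - q))"
      using card_image_le[of "{1..N}" X] q R by (intro mult_right_mono) auto
    finally show "(\<Sum>z\<in>X ` {1..N}. jump_rate q a N X z) \<le> \<Lambda>" by (simp add: \<Lambda>_def)
  next
    fix X assume "X \<in> A"
    then have "X \<in> weyl_chamber N" by (simp add: A_def)
    then show "continuous_on {0..} (\<lambda>t. ?u t X - contour_prob n X t)"
      by (intro continuous_on_diff continuous_on_of_real contour_prob_continuous transition_function_continuous[OF tf])
  next
    fix X and s :: real assume "X \<in> A" "0 < s"
    then have X: "X \<in> weyl_chamber N" by (simp add: A_def)
    have du: "((\<lambda>t. ?u t X) has_vector_derivative
       of_real (\<Sum>z\<in>X ` {1..N}. jump_rate q a N X z * (measure (p s (jump_from N X z)) {x. M < x n} - measure (p s X) {x. M < x n}))) (at s)"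
      using qtazrp_backward[OF tf X \<open>0 < s\<close>, of "{x. M < x n}"]
      unfolding has_real_derivative_iff_has_vector_derivative
      by (rule bounded_linear.has_vector_derivative[OF bounded_linear_of_real])
    have eq: "of_real (\<Sum>z\<in>X ` {1..N}. jump_rate q a N X z * (measure (p s (jump_from N X z)) {x. M < x n} - measure (p s X) {x. M < x n}))
        - (\<Sum>z\<in>X ` {1..N}. of_real (jump_rate q a N X z) * (contour_prob n (jump_from N X z) s - contour_prob n X s))
      = (\<Sum>z\<in>X ` {1..N}. of_real (jump_rate q a N X z) *
          (?u s (jump_from N X z) - contour_prob n (jump_from N X z) s - (?u s X - contour_prob n X s)))"
      unfolding of_real_sum sum_subtractf[symmetric] by (intro sum.cong refl) (simp add: algebra_simps)
    show "((\<lambda>t. ?u t X - contour_prob n X t) has_vector_derivative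
        (\<Sum>z\<in>X ` {1..N}. of_real (jump_rate q a N X z) *
          (?u s (jump_from N X z) - contour_prob n (jump_from N X z) s - (?u s X - contour_prob n X s)))) (at s)"
      using has_vector_derivative_diff[OF du contour_prob_derivative[of n X s, unfolded contour_prob_generator[OF n(1) X]]]
      unfolding eq .
  next
    fix X assume "X \<in> A"
    then have X: "X \<in> weyl_chamber N" by (simp add: A_def)
    then have "p 0 X = return_pmf X" using tf by (simp add: transition_function_def)
    then show "?u 0 X - contour_prob n X 0 = 0"
      unfolding contour_prob_0[OF n X] by (simp add: indicator_def)
  next
    fix s X assume "X \<in> A" "0 \<le> s" "s \<le> t"
    then have "norm (contour_prob n X s) \<le> G" by (rule G)
    moreover have "norm (?u s X) \<le> 1" by simp
    ultimately show "norm (?u s X - contour_prob n X s) \<le> 1 + G"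
      using norm_triangle_ineq4[of "?u s X" "contour_prob n X s"] by linarith
  next
    show "0 < \<Lambda>" using n q R by (simp add: \<Lambda>_def)
  qed (use YA t in auto)
  then show ?thesis by simp
qed

end

section \<open>Deforming nested curves to a circle\<close>

text \<open>The residue at 0 in the variable \<open>s\<close> picks up a factor \<open>1 / q\<close> from each of the earlier
  variables: those already fixed (\<open>k\<close> many) and those in \<open>S\<close> below \<open>s\<close>.\<close>

definition removal_weight :: "real \<Rightarrow> nat \<Rightarrow> nat set \<Rightarrow> nat set \<Rightarrow> real" where
  "removal_weight q k S T = (\<Prod>s\<in>S - T. - (q powi (- int (k + rank_in S s))))"

text \<open>The list \<open>us\<close> holds the values of the earlier variables: the integrand in
  the current variable is singular on B and at q u for u in \<open>us\<close>. Enclosure is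
  expressed by winding numbers, the form in which the residue theorem uses it.\<close>

fun admissible_contours ::
    "real \<Rightarrow> real \<Rightarrow> complex set \<Rightarrow> complex list \<Rightarrow> (real \<Rightarrow> complex) list \<Rightarrow> bool" where
  "admissible_contours q R B us [] \<longleftrightarrow> True"
| "admissible_contours q R B us (\<gamma> # \<gamma>s) \<longleftrightarrow>
     valid_path \<gamma> \<and> pathfinish \<gamma> = pathstart \<gamma> \<and> path_image \<gamma> \<subseteq> ball 0 R \<and>
     0 \<notin> path_image \<gamma> \<and> winding_number \<gamma> 0 = 0 \<and>
     (\<forall>p \<in> B \<union> (\<lambda>u. of_real q * u) ` set us. p \<notin> path_image \<gamma> \<and> winding_number \<gamma> p = 1) \<and>
     (\<forall>z\<in>path_image \<gamma>. admissible_contours q R B (z # us) \<gamma>s)"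

context
  fixes q R :: real
  assumes q: "0 < q" "q < 1" and R: "0 < R"
begin

text \<open>Inside the disc the singularities are 0 and the points of B. The circle winds once
  around all of them, the curve around B only, so the two integrals differ by the residue at 0. H
  will be a circle integral over later variables, hence holomorphic beyond the circle.\<close>

lemma contour_integral_residue_0:
  assumes "finite B" "B \<subseteq> ball 0 R" "0 \<notin> B"
    and f: "f holomorphic_on - B" and H: "H holomorphic_on ball 0 (R / q)"
    and \<gamma>: "valid_path \<gamma>" "pathfinish \<gamma> = pathstart \<gamma>" "path_image \<gamma> \<subseteq> ball 0 R"
      "0 \<notin> path_image \<gamma>" "winding_number \<gamma> 0 = 0" "\<forall>p\<in>B. p \<notin> path_image \<gamma> \<and> winding_number \<gamma> p = 1"
  shows "(\<lambda>z. f z / z * H z) contour_integrable_on \<gamma>"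
    and "1 / (2 * of_real pi * \<i>) * contour_integral \<gamma> (\<lambda>z. f z / z * H z) = circle_mean R (\<lambda>z. f z * H z) - f 0 * H 0"
proof -
  let ?U = "ball (0::complex) (R / q)" and ?G = "\<lambda>z. f z / z * H z" and ?c = "circlepath 0 R"
  let ?pts = "insert 0 B"
  have RU: "R < R / q" using q R by (simp add: field_simps)
  have G: "?G holomorphic_on ?U - ?pts"
    by (intro holomorphic_intros holomorphic_on_subset[OF f] holomorphic_on_subset[OF H]) auto
  have im: "path_image \<gamma> \<subseteq> ?U - ?pts" using \<gamma> RU by auto
  have "open (?U - ?pts)" using assms(1) by (intro open_Diff finite_imp_closed) auto
  then show "?G contour_integrable_on \<gamma>"
    using contour_integrable_holomorphic_simple[OF G _ \<gamma>(1) im] by simp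
  have out: "\<forall>z. z \<notin> ?U \<longrightarrow> winding_number g z = 0"
    if "valid_path g" "pathfinish g = pathstart g" "path_image g \<subseteq> ?U" for g
    using that valid_path_imp_path winding_number_zero_outside[of g ?U] by auto
  have out\<gamma>: "\<forall>z. z \<notin> ?U \<longrightarrow> winding_number \<gamma> z = 0"
    using im by (intro out \<gamma>) auto
  have "contour_integral \<gamma> ?G = 2 * pi * \<i> * (\<Sum>p\<in>?pts. winding_number \<gamma> p * residue ?G p)"
    using assms(1) by (intro Residue_theorem[OF _ _ _ G \<gamma>(1,2) im out\<gamma>]) auto
  also have "(\<Sum>p\<in>?pts. winding_number \<gamma> p * residue ?G p) = (\<Sum>p\<in>B. residue ?G p)"
    using assms(1,3) \<gamma>(5,6) by (simp add: sum.insert)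
  finally have 1: "contour_integral \<gamma> ?G = 2 * pi * \<i> * (\<Sum>p\<in>B. residue ?G p)" .
  have cim: "path_image ?c \<subseteq> ?U - ?pts"
    using R RU assms(2) by auto
  have outc: "\<forall>z. z \<notin> ?U \<longrightarrow> winding_number ?c z = 0"
    using cim by (intro out) auto
  have "contour_integral ?c ?G = 2 * pi * \<i> * (\<Sum>p\<in>?pts. winding_number ?c p * residue ?G p)"
    using assms(1) by (intro Residue_theorem[OF _ _ _ G _ _ cim outc]) auto
  also have "(\<Sum>p\<in>?pts. winding_number ?c p * residue ?G p) = (\<Sum>p\<in>?pts. residue ?G p)"
  proof (rule sum.cong)
    fix p assume "p \<in> ?pts"
    then have "norm (p - 0) < R" using assms(2) R by auto
    then show "winding_number ?c p * residue ?G p = residue ?G p"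
      by (simp add: winding_number_circlepath)
  qed simp
  also have "\<dots> = residue ?G 0 + (\<Sum>p\<in>B. residue ?G p)"
    using assms(1,3) by simp
  also have "residue ?G 0 = f 0 * H 0"
  proof -
    have "(\<lambda>z. f z * H z) holomorphic_on ?U - B"
      by (intro holomorphic_intros holomorphic_on_subset[OF f] holomorphic_on_subset[OF H]) auto
    moreover have "open (?U - B)" using assms(1) by (intro open_Diff finite_imp_closed) auto
    moreover have "0 \<in> ?U - B" using assms(3) R q by auto
    ultimately have "residue (\<lambda>z. (f z * H z) / (z - 0)) 0 = f 0 * H 0"
      by (intro residue_simple)
    then show ?thesis by (simp add: mult.commute)
  qed
  finally have "contour_integral ?c ?G = 2 * pi * \<i> * (f 0 * H 0 + (\<Sum>p\<in>B. residue ?G p))" .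
  moreover have "contour_integral ?c ?G = 2 * of_real pi * \<i> * circle_mean R (\<lambda>z. f z * H z)"
    using contour_integral_circle_mean[OF R, of "\<lambda>z. f z * H z"] by simp
  ultimately have "2 * of_real pi * \<i> * circle_mean R (\<lambda>z. f z * H z) = 2 * of_real pi * \<i> * (f 0 * H 0 + (\<Sum>p\<in>B. residue ?G p))"
    by simp
  then have "circle_mean R (\<lambda>z. f z * H z) = f 0 * H 0 + (\<Sum>p\<in>B. residue ?G p)"
    by (subst (asm) mult_cancel_left) auto
  then show "1 / (2 * of_real pi * \<i>) * contour_integral \<gamma> ?G = circle_mean R (\<lambda>z. f z * H z) - f 0 * H 0"
    unfolding 1 by simp
qed

text \<open>In the later variable w the cross factor with u has its pole at q u. This is why a curve
  must enclose q times each earlier curve.\<close>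

lemma cross_factors_holomorphic:
  assumes "g holomorphic_on - B"
  shows "(\<lambda>w. (\<Prod>u\<leftarrow>us. cross_factor q u w) * g w) holomorphic_on - (B \<union> (\<lambda>u. of_real q * u) ` set us)"
proof (induction us)
  case Nil
  then show ?case using assms by simp
next
  case (Cons u us)
  have "(\<lambda>w. cross_factor q u w * ((\<Prod>u\<leftarrow>us. cross_factor q u w) * g w)) holomorphic_on - (B \<union> (\<lambda>u. of_real q * u) ` set (u # us))"
    unfolding cross_factor_def[of q u]
    by (intro holomorphic_intros holomorphic_on_subset[OF Cons.IH]) auto
  then show ?case by (simp add: mult.assoc)
qed

text \<open>A valid path need not be rectifiable, so integrals over the given curves are never
  differentiated or interchanged: in each step only integrals over circles depend on the
  variable of the outermost curve, and these are holomorphic in it.\<close>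

lemma nested_integral_eq_torus_means:
  assumes "finite B" "B \<subseteq> ball 0 R" "0 \<notin> B"
    and g: "\<And>s. s \<in> S \<Longrightarrow> g s holomorphic_on - B \<and> g s 0 = 1"
    and "finite S" "length \<gamma>s = card S" "set us \<subseteq> ball 0 R - {0}" "admissible_contours q R B us \<gamma>s"
  shows "nested_integral q \<gamma>s (map (\<lambda>s w. (\<Prod>u\<leftarrow>us. cross_factor q u w) * g s w) (sorted_list_of_set S))
    = (\<Sum>T\<in>Pow S. of_real (removal_weight q (length us) S T) *
         torus_mean q R (map (\<lambda>s w. (\<Prod>u\<leftarrow>us. cross_factor q u w) * g s w) (sorted_list_of_set T)))"
  using assms(4-)
proof (induction \<gamma>s arbitrary: S us)
  case Nil
  then have "S = {}" by simp
  then show ?case by (simp add: removal_weight_def)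
next
  case (Cons \<gamma> \<gamma>s)
  let ?f = "\<lambda>us s w. (\<Prod>u\<leftarrow>us. cross_factor q u w) * g s w"
  let ?B = "B \<union> (\<lambda>u. of_real q * u) ` set us"
  define m where "m = Min S"
  have "S \<noteq> {}" using Cons.prems by auto
  then have m: "m \<in> S" unfolding m_def using Cons.prems(2) by (intro Min_in)
  define S' where "S' = S - {m}"
  have S': "finite S'" "m \<notin> S'" "S = insert m S'" "card S' = length \<gamma>s"
    using m Cons.prems(2,3) by (auto simp: S'_def)
  have less: "m < s" if "s \<in> S'" for s
  proof -
    have "m \<le> s" "s \<noteq> m" using that Cons.prems(2) by (auto simp: S'_def m_def)
    then show ?thesis by simp
  qed
  have sorted: "sorted_list_of_set (insert m T) = m # sorted_list_of_set T" if "T \<subseteq> S'" for T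
  proof -
    have "finite T" using that S' finite_subset by auto
    then show ?thesis using sorted_list_of_set_Un[of "{m}" T] that less by auto
  qed
  have adm: "valid_path \<gamma>" "pathfinish \<gamma> = pathstart \<gamma>" "path_image \<gamma> \<subseteq> ball 0 R"
     "0 \<notin> path_image \<gamma>" "winding_number \<gamma> 0 = 0" "\<forall>p\<in>?B. p \<notin> path_image \<gamma> \<and> winding_number \<gamma> p = 1"
    and adm': "\<And>z. z \<in> path_image \<gamma> \<Longrightarrow> admissible_contours q R B (z # us) \<gamma>s"
    using Cons.prems(5) by auto
  have B: "finite ?B" "?B \<subseteq> ball 0 R" "0 \<notin> ?B"
  proof -
    have "norm (of_real q * u) < R" if "norm u < R" for u :: complex
    proof -
      have "q * norm u \<le> 1 * norm u" using q by (intro mult_right_mono) auto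
      then show ?thesis using that q by (simp add: norm_mult)
    qed
    then show "finite ?B" "?B \<subseteq> ball 0 R" "0 \<notin> ?B"
      using assms(1-3) Cons.prems(4) q by auto
  qed
  have hol: "?f us s holomorphic_on - ?B" if "s \<in> S" for s
    using cross_factors_holomorphic Cons.prems(1)[OF that] by blast
  have cont: "continuous_on (sphere 0 R) (?f us s)" if "s \<in> S" for s
    by (rule continuous_on_subset[OF holomorphic_on_imp_continuous_on[OF hol[OF that]]]) (use B in auto)
  define H where "H T z = torus_mean q R (map (\<lambda>h w. cross_factor q z w * h w) (map (?f us) (sorted_list_of_set T)))" for T z
  have H: "H T holomorphic_on ball 0 (R / q)" if "T \<subseteq> S'" for T
    unfolding H_def
  proof (rule torus_mean_holomorphic[OF q R])
    have "finite T" using that S' finite_subset by auto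
    then show "continuous_on (sphere 0 R) h" if "h \<in> set (map (?f us) (sorted_list_of_set T))" for h
      using that \<open>T \<subseteq> S'\<close> S' cont by auto
  qed
  have H0: "H T 0 = torus_mean q R (map (?f us) (sorted_list_of_set T))" for T
    unfolding H_def by (rule torus_mean_cong[OF R]) (use R in \<open>auto simp: cross_factor_def\<close>)
  \<comment> \<open>At 0 each cross factor with a fixed u is u / (q u) = 1 / q.\<close>
  have f0: "?f us m 0 = of_real (q powi (- int (length us)))"
  proof -
    have "(\<Prod>u\<leftarrow>us. cross_factor q u 0) = inverse (of_real q) ^ length us" if "set us \<subseteq> ball 0 R - {0}"
      using that by (induction us) (use q in \<open>auto simp: cross_factor_def field_simps\<close>)
    then show ?thesis using Cons.prems(1)[OF m] Cons.prems(4) by (simp add: power_int_minus power_inverse)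
  qed
  have res: "(\<lambda>z. ?f us m z / z * H T z) contour_integrable_on \<gamma>"
    "1 / (2 * of_real pi * \<i>) * contour_integral \<gamma> (\<lambda>z. ?f us m z / z * H T z)
     = torus_mean q R (map (?f us) (sorted_list_of_set (insert m T)))
       - of_real (q powi (- int (length us))) * torus_mean q R (map (?f us) (sorted_list_of_set T))"
    if "T \<in> Pow S'" for T
  proof -
    have T: "T \<subseteq> S'" using that by simp
    note r = contour_integral_residue_0[OF B hol[OF m] H[OF T] adm]
    show "(\<lambda>z. ?f us m z / z * H T z) contour_integrable_on \<gamma>" by (rule r(1))
    have "circle_mean R (\<lambda>z. ?f us m z * H T z) = torus_mean q R (map (?f us) (sorted_list_of_set (insert m T)))"
      unfolding sorted[OF T] list.map torus_mean_Cons[OF R] H_def ..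
    then show "1 / (2 * of_real pi * \<i>) * contour_integral \<gamma> (\<lambda>z. ?f us m z / z * H T z)
     = torus_mean q R (map (?f us) (sorted_list_of_set (insert m T)))
       - of_real (q powi (- int (length us))) * torus_mean q R (map (?f us) (sorted_list_of_set T))"
      using r(2) unfolding f0 H0 by simp
  qed
  have IH: "nested_integral q \<gamma>s (map (\<lambda>h w. cross_factor q z w * h w) (map (?f us) (sorted_list_of_set S')))
     = (\<Sum>T\<in>Pow S'. of_real (removal_weight q (Suc (length us)) S' T) * H T z)" if z: "z \<in> path_image \<gamma>" for z
  proof -
    have "set (z # us) \<subseteq> ball 0 R - {0}" using z adm Cons.prems(4) by auto
    from Cons.IH[of S', OF _ S'(1) S'(4)[symmetric] this adm'[OF z]]
    show ?thesis using Cons.prems(1) S'(3) by (simp add: H_def o_def mult.assoc)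
  qed
  \<comment> \<open>Fixing m raises the number of fixed variables by one and lowers the other ranks
    by one, so the remaining weights agree. If m is itself removed, its own weight, of rank 0, is
    split off.\<close>
  have w1: "removal_weight q (length us) S (insert m T) = removal_weight q (Suc (length us)) S' T"
    and w2: "removal_weight q (length us) S T = - (q powi (- int (length us))) * removal_weight q (Suc (length us)) S' T"
    if "T \<in> Pow S'" for T
  proof -
    have fin: "finite S'" by (rule S'(1))
    have rk: "rank_in S s = Suc (rank_in S' s)" if "s \<in> S'" for s
    proof -
      have "{a \<in> S. a < s} = insert m {a \<in> S'. a < s}" using S'(3) less[OF that] by auto
      then show ?thesis using S'(2) fin by (simp add: rank_in_def)
    qed
    have rm: "rank_in S m = 0"
    proof -
      have "{a \<in> S. a < m} = {}" using S'(3) less by fastforce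
      then show ?thesis unfolding rank_in_def by simp
    qed
    have p: "(\<Prod>s\<in>S' - T. - (q powi (- int (length us + rank_in S s)))) = removal_weight q (Suc (length us)) S' T"
      unfolding removal_weight_def by (intro prod.cong) (auto simp: rk)
    have "S - insert m T = S' - T" using S'(2,3) that by auto
    then show "removal_weight q (length us) S (insert m T) = removal_weight q (Suc (length us)) S' T"
      unfolding removal_weight_def[of q "length us"] using p by simp
    have "S - T = insert m (S' - T)" using S'(2,3) that by auto
    then show "removal_weight q (length us) S T = - (q powi (- int (length us))) * removal_weight q (Suc (length us)) S' T"
      unfolding removal_weight_def[of q "length us"] using p fin S'(2) rm by simp
  qed
  let ?w = "\<lambda>T. of_real (removal_weight q (Suc (length us)) S' T) :: complex"
  have "nested_integral q (\<gamma> # \<gamma>s) (map (?f us) (sorted_list_of_set S))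
     = 1 / (2 * of_real pi * \<i>) * contour_integral \<gamma> (\<lambda>z. ?f us m z / z *
         nested_integral q \<gamma>s (map (\<lambda>h w. cross_factor q z w * h w) (map (?f us) (sorted_list_of_set S'))))"
    unfolding S'(3) sorted[OF order_refl] by simp
  also have "\<dots> = 1 / (2 * of_real pi * \<i>) * contour_integral \<gamma> (\<lambda>z. \<Sum>T\<in>Pow S'. ?w T * (?f us m z / z * H T z))"
    by (intro arg_cong2[where f = "(*)"] contour_integral_cong refl)
       (simp only: IH sum_distrib_left mult.left_commute)
  also have "\<dots> = (\<Sum>T\<in>Pow S'. ?w T * (1 / (2 * of_real pi * \<i>) * contour_integral \<gamma> (\<lambda>z. ?f us m z / z * H T z)))"
  proof -
    have "contour_integral \<gamma> (\<lambda>z. \<Sum>T\<in>Pow S'. ?w T * (?f us m z / z * H T z))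
       = (\<Sum>T\<in>Pow S'. contour_integral \<gamma> (\<lambda>z. ?w T * (?f us m z / z * H T z)))"
      using S'(1) by (intro contour_integral_sum contour_integrable_lmul res(1)) auto
    then show ?thesis
      unfolding contour_integral_mult_left sum_distrib_left
      by (simp only: sum_distrib_left mult.left_commute)
  qed
  also have "\<dots> = (\<Sum>T\<in>Pow S'. ?w T * (torus_mean q R (map (?f us) (sorted_list_of_set (insert m T)))
       - of_real (q powi (- int (length us))) * torus_mean q R (map (?f us) (sorted_list_of_set T))))"
    by (intro sum.cong refl) (simp only: res(2))
  also have "\<dots> = (\<Sum>T\<in>Pow S'. of_real (removal_weight q (length us) S T) * torus_mean q R (map (?f us) (sorted_list_of_set T)))
     + (\<Sum>T\<in>Pow S'. of_real (removal_weight q (length us) S (insert m T)) * torus_mean q R (map (?f us) (sorted_list_of_set (insert m T))))"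
    unfolding sum.distrib[symmetric] by (intro sum.cong refl) (simp add: w1 w2 algebra_simps)
  also have "\<dots> = (\<Sum>T\<in>Pow (insert m S'). of_real (removal_weight q (length us) S T) * torus_mean q R (map (?f us) (sorted_list_of_set T)))"
    by (rule sum_Pow_insert[OF S'(1,2), symmetric])
  finally show ?case unfolding S'(3)[symmetric] .
qed

end

section \<open>Assembly of the two formulas\<close>

lemma sum_Pow_Pow:
  assumes "finite A"
  shows "(\<Sum>S\<in>Pow A. \<Sum>T\<in>Pow S. h S T) = (\<Sum>T\<in>Pow A. \<Sum>U\<in>Pow (A - T). h (T \<union> U) T)"
proof -
  have fin: "finite S" if "S \<in> Pow A" for S using that assms finite_subset by auto
  have "(\<Sum>S\<in>Pow A. \<Sum>T\<in>Pow S. h S T) = (\<Sum>(S, T)\<in>Sigma (Pow A) Pow. h S T)"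
    using assms fin by (intro sum.Sigma) auto
  also have "\<dots> = (\<Sum>(T, U)\<in>Sigma (Pow A) (\<lambda>T. Pow (A - T)). h (T \<union> U) T)"
    by (rule sum.reindex_bij_witness[where i = "\<lambda>(T, U). (T \<union> U, T)" and j = "\<lambda>(S, T). (T, S - T)"])
       (auto intro!: arg_cong2[where f = h])
  also have "\<dots> = (\<Sum>T\<in>Pow A. \<Sum>U\<in>Pow (A - T). h (T \<union> U) T)"
    using assms by (intro sum.Sigma[symmetric]) auto
  finally show ?thesis .
qed

lemma sum_card_eq_sum_Pow:
  fixes h :: "nat \<Rightarrow> nat set \<Rightarrow> complex"
  shows "(\<Sum>r=n..N. \<Sum>S | S \<subseteq> {1..N} \<and> card S = r. h r S) = (\<Sum>S\<in>Pow {1..N}. if n \<le> card S then h (card S) S else 0)"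
proof -
  have card: "card S \<le> N" if "S \<subseteq> {1..N}" for S using card_mono[OF _ that] by simp
  have "(\<Sum>r=n..N. \<Sum>S | S \<subseteq> {1..N} \<and> card S = r. h r S)
     = (\<Sum>r=n..N. \<Sum>S\<in>Pow {1..N}. if card S = r then h r S else 0)"
    by (intro sum.cong refl sum.mono_neutral_cong_left) auto
  also have "\<dots> = (\<Sum>S\<in>Pow {1..N}. \<Sum>r=n..N. if card S = r then h r S else 0)"
    by (rule sum.swap)
  also have "\<dots> = (\<Sum>S\<in>Pow {1..N}. if n \<le> card S then h (card S) S else 0)"
    using card by (intro sum.cong refl) (auto simp: sum.delta)
  finally show ?thesis .
qed

lemma admissible_contours_map:
  assumes C: "\<And>j. j \<in> set js \<Longrightarrow> valid_path (C j) \<and> pathfinish (C j) = pathstart (C j) \<and> path_image (C j) \<subseteq> ball 0 R \<and>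
       0 \<notin> path_image (C j) \<and> winding_number (C j) 0 = 0 \<and>
       (\<forall>p \<in> B \<union> (\<lambda>u. of_real q * u) ` set us. p \<notin> path_image (C j) \<and> winding_number (C j) p = 1)"
    and "sorted_wrt (<) js"
    and "\<And>i j z. i \<in> set js \<Longrightarrow> j \<in> set js \<Longrightarrow> i < j \<Longrightarrow> z \<in> path_image (C i) \<Longrightarrow>
       of_real q * z \<notin> path_image (C j) \<and> winding_number (C j) (of_real q * z) = 1"
  shows "admissible_contours q R B us (map C js)"
  using assms
proof (induction js arbitrary: us)
  case (Cons j js)
  have "admissible_contours q R B (z # us) (map C js)" if "z \<in> path_image (C j)" for z
  proof (rule Cons.IH)
    fix k assume k: "k \<in> set js"
    then have "j < k" using Cons.prems(2) by simp
    then have "of_real q * z \<notin> path_image (C k) \<and> winding_number (C k) (of_real q * z) = 1"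
      using Cons.prems(3)[of j k z] k that by simp
    then show "valid_path (C k) \<and> pathfinish (C k) = pathstart (C k) \<and> path_image (C k) \<subseteq> ball 0 R \<and>
       0 \<notin> path_image (C k) \<and> winding_number (C k) 0 = 0 \<and>
       (\<forall>p \<in> B \<union> (\<lambda>u. of_real q * u) ` set (z # us). p \<notin> path_image (C k) \<and> winding_number (C k) p = 1)"
      using Cons.prems(1)[of k] k by simp
  qed (use Cons.prems(2,3) in auto)
  then show ?case using Cons.prems(1)[of j] by auto
qed simp

lemma site_fun_0:
  assumes "\<And>k. b k \<noteq> 0"
  shows "site_fun b M y t 0 = 1"
  using assms by (simp add: site_fun_def ext_prod_def)

lemma site_fun_holomorphic:
  assumes b: "\<And>k. b k \<noteq> 0" and B: "(\<lambda>k. of_real (b k)) ` {y..M} \<subseteq> B"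
  shows "site_fun b M y t holomorphic_on - B"
proof (cases "y \<le> M")
  case True
  have "(\<lambda>w. (\<Prod>k=y..M. of_real (b k) / (of_real (b k) - w)) * exp (- w * of_real t)) holomorphic_on - B"
  proof (intro holomorphic_intros)
    fix k w assume "k \<in> {y..M}" "w \<in> - B"
    moreover from this(1) have "of_real (b k) \<in> B" using B by blast
    ultimately show "of_real (b k) - w \<noteq> 0" by auto
  qed
  then show ?thesis using True by (simp add: site_fun_def[abs_def] ext_prod_def)
qed (use site_fun_entire[of M y b] b in auto)

lemma inside_circlepath:
  assumes "0 < R" "z \<in> inside (path_image (circlepath 0 R))"
  shows "norm z < R"
proof (rule ccontr)
  assume "\<not> norm z < R"
  moreover have "z \<notin> path_image (circlepath 0 R)" using assms(2) inside_no_overlap by blast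
  ultimately have "R < norm z" using assms(1) by simp
  then have "z \<in> outside (cball 0 R)"
    by (subst outside_convex) auto
  moreover have "outside (cball (0::complex) R) \<subseteq> outside (path_image (circlepath 0 R))"
    by (rule outside_mono) (use assms(1) in auto)
  ultimately show False
    using assms(2) inside_Int_outside by blast
qed

context qtazrp_contour
begin

lemma sum_log_contour_integral_circlepath:
  assumes "1 \<le> n"
  shows "(\<Sum>r=n..N. (-1) ^ r * (\<Sum>S | S \<subseteq> {1..N} \<and> card S = r. of_real (coeff_c q n S) *
      log_contour_integral (replicate r (circlepath 0 R)) (I_fun q b Y S M t))) = contour_prob n Y t"
proof -
  have "(\<Sum>r=n..N. (-1) ^ r * (\<Sum>S | S \<subseteq> {1..N} \<and> card S = r. of_real (coeff_c q n S) *
      log_contour_integral (replicate r (circlepath 0 R)) (I_fun q b Y S M t)))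
    = (\<Sum>r=n..N. \<Sum>S | S \<subseteq> {1..N} \<and> card S = r. (-1) ^ r * (of_real (coeff_c q n S) *
      log_contour_integral (replicate r (circlepath 0 R)) (I_fun q b Y S M t)))"
    by (simp add: sum_distrib_left)
  also have "\<dots> = contour_prob n Y t"
    unfolding sum_card_eq_sum_Pow contour_prob_def
    by (intro sum.cong refl) (simp add: signed_c_def log_contour_integral_I_fun torus_mean_def)
  finally show ?thesis .
qed

text \<open>Each nested integral over S expands into circle integrals over the T contained in S. For
  fixed T the coefficients are collected by \<open>sum_scaled_c_tilde\<close>; the empty T yields
  the 1.\<close>

lemma sum_log_contour_integral_nested:
  assumes n: "1 \<le> n" "n \<le> N" and Y: "Y \<in> weyl_chamber N"
    and C: "\<And>j. j \<in> {1..N} \<Longrightarrow> valid_path (C j) \<and> pathfinish (C j) = pathstart (C j) \<and> path_image (C j) \<subseteq> ball 0 R \<and>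
       0 \<notin> path_image (C j) \<and> winding_number (C j) 0 = 0"
    and Cb: "\<And>j k. j \<in> {1..N} \<Longrightarrow> of_real (b k) \<notin> path_image (C j) \<and> winding_number (C j) (of_real (b k)) = 1"
    and Cq: "\<And>i j z. i \<in> {1..N} \<Longrightarrow> j \<in> {1..N} \<Longrightarrow> i < j \<Longrightarrow> z \<in> path_image (C i) \<Longrightarrow>
       of_real q * z \<notin> path_image (C j) \<and> winding_number (C j) (of_real q * z) = 1"
  shows "(\<Sum>r=n..N. of_real (q powi (- int (r * N))) * (\<Sum>S | S \<subseteq> {1..N} \<and> card S = r. of_real (coeff_c_tilde q n S) *
      log_contour_integral (map C [1..<r + 1]) (I_fun q b Y S M t))) = 1 - contour_prob (N - n + 1) Y t"
proof -
  \<comment> \<open>Only sites k with Y s <= k <= M give poles of the integrands, so this set is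
    finite, as required for the residue theorem.\<close>
  define B where "B = (\<Union>s\<in>{1..N}. (\<lambda>k. complex_of_real (b k)) ` {Y s..M})"
  have bnz: "b k \<noteq> 0" for k using b[of k] by simp
  have B: "finite B" "B \<subseteq> ball 0 R" "0 \<notin> B"
    using b bnz by (auto simp: B_def less_imp_le)
  \<comment> \<open>Curves are numbered by position within S and not by label: the i-th smallest
    label is integrated over C i.\<close>
  have nested: "nested_integral q (map C [1..<card S + 1]) (site_funs b M Y t S)
     = (\<Sum>T\<in>Pow S. of_real (removal_weight q 0 S T) * site_mean Y t T)" if S: "S \<subseteq> {1..N}" for S
  proof -
    have fin: "finite S" using S finite_subset by auto
    have "card S \<le> N" using card_mono[OF _ S] by simp
    then have adm: "admissible_contours q R B [] (map C [1..<card S + 1])"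
    proof (intro admissible_contours_map)
      fix j assume "j \<in> set [1..<card S + 1]"
      then have j: "j \<in> {1..N}" using \<open>card S \<le> N\<close> by auto
      show "valid_path (C j) \<and> pathfinish (C j) = pathstart (C j) \<and> path_image (C j) \<subseteq> ball 0 R \<and>
        0 \<notin> path_image (C j) \<and> winding_number (C j) 0 = 0 \<and>
        (\<forall>p \<in> B \<union> (\<lambda>u. of_real q * u) ` set []. p \<notin> path_image (C j) \<and> winding_number (C j) p = 1)"
        using C[OF j] Cb[OF j] by (auto simp only: B_def list.set image_empty)
    next
      fix i j z assume "i \<in> set [1..<card S + 1]" "j \<in> set [1..<card S + 1]" "i < j" "z \<in> path_image (C i)"
      then show "of_real q * z \<notin> path_image (C j) \<and> winding_number (C j) (of_real q * z) = 1"
        using \<open>card S \<le> N\<close> by (intro Cq[of i]) auto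
    qed (rule sorted_wrt_upt)
    have "site_fun b M (Y s) t holomorphic_on - B \<and> site_fun b M (Y s) t 0 = 1" if "s \<in> S" for s
      using that S by (intro conjI site_fun_holomorphic site_fun_0 bnz) (auto simp: B_def)
    from nested_integral_eq_torus_means[OF q R B this fin _ _ adm] show ?thesis
      by (simp add: site_funs_def)
  qed
  have "(\<Sum>r=n..N. of_real (q powi (- int (r * N))) * (\<Sum>S | S \<subseteq> {1..N} \<and> card S = r. of_real (coeff_c_tilde q n S) *
      log_contour_integral (map C [1..<r + 1]) (I_fun q b Y S M t)))
    = (\<Sum>r=n..N. \<Sum>S | S \<subseteq> {1..N} \<and> card S = r. of_real (q powi (- int (r * N))) * (of_real (coeff_c_tilde q n S) *
      log_contour_integral (map C [1..<r + 1]) (I_fun q b Y S M t)))"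
    unfolding sum_distrib_left ..
  also have "\<dots> = (\<Sum>S\<in>Pow {1..N}. of_real (scaled_c_tilde q N n S) * nested_integral q (map C [1..<card S + 1]) (site_funs b M Y t S))"
    unfolding sum_card_eq_sum_Pow
    by (intro sum.cong refl) (simp add: scaled_c_tilde_def log_contour_integral_I_fun del: upt_Suc)
  also have "\<dots> = (\<Sum>S\<in>Pow {1..N}. \<Sum>T\<in>Pow S. of_real (scaled_c_tilde q N n S * removal_weight q 0 S T) * site_mean Y t T)"
    by (intro sum.cong refl) (simp only: nested Pow_iff sum_distrib_left of_real_mult mult.assoc)
  also have "\<dots> = (\<Sum>T\<in>Pow {1..N}. \<Sum>U\<in>Pow ({1..N} - T). of_real (scaled_c_tilde q N n (T \<union> U) * removal_weight q 0 (T \<union> U) T) * site_mean Y t T)"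
    by (rule sum_Pow_Pow) simp
  also have "\<dots> = (\<Sum>T\<in>Pow {1..N}. of_real (of_bool (T = {}) - signed_c q (N - n + 1) T) * site_mean Y t T)"
  proof (rule sum.cong)
    fix T assume T: "T \<in> Pow {1..N}"
    have "removal_weight q 0 (T \<union> U) T = (\<Prod>s\<in>U. - (q powi (- int (rank_in (T \<union> U) s))))" if "U \<in> Pow ({1..N} - T)" for U
    proof -
      have "T \<union> U - T = U" using that by auto
      then show ?thesis by (simp add: removal_weight_def)
    qed
    then have "(\<Sum>U\<in>Pow ({1..N} - T). scaled_c_tilde q N n (T \<union> U) * removal_weight q 0 (T \<union> U) T)
       = of_bool (T = {}) - signed_c q (N - n + 1) T"
      using sum_scaled_c_tilde[OF q n, of T] T by simp
    then show "(\<Sum>U\<in>Pow ({1..N} - T). of_real (scaled_c_tilde q N n (T \<union> U) * removal_weight q 0 (T \<union> U) T) * site_mean Y t T)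
      = of_real (of_bool (T = {}) - signed_c q (N - n + 1) T) * site_mean Y t T"
      unfolding sum_distrib_right[symmetric] of_real_sum[symmetric] by simp
  qed simp
  also have "\<dots> = (\<Sum>T\<in>Pow {1..N}. (if T = {} then site_mean Y t T else 0)) - contour_prob (N - n + 1) Y t"
    unfolding contour_prob_def sum_subtractf[symmetric]
    by (intro sum.cong refl) (simp add: left_diff_distrib)
  also have "(\<Sum>T\<in>Pow {1..N}. (if T = {} then site_mean Y t T else 0)) = 1"
    by (subst sum.delta) (auto simp: site_funs_def)
  finally show ?thesis .
qed

end

theorem theorem1p2:
  fixes q t :: real and a b :: "int \<Rightarrow> real" and N n :: nat and M :: int
    and Y :: "nat \<Rightarrow> int" and P :: "'w measure" and X :: "real \<Rightarrow> 'w \<Rightarrow> nat \<Rightarrow> int"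
    and R :: real and C :: "nat \<Rightarrow> real \<Rightarrow> complex"
  assumes q: "0 < q" "q < 1"
    and a: "\<exists>K. compact K \<and> K \<subseteq> {0<..} \<and> range a \<subseteq> K"
    and b: "\<And>k. b k = (1 - q) * a k"
    and N: "1 \<le> N"
    and Y: "Y \<in> weyl_chamber N"
    and X: "qtazrp q a N Y P X"
    and n: "1 \<le> n" "n \<le> N"
    and t: "0 < t"
  shows "(0 < R \<and> (\<forall>k. of_real (b k) \<in> inside (path_image (circlepath 0 R))) \<longrightarrow>
      of_real (measure P {\<omega> \<in> space P. X t \<omega> n > M}) =
        (\<Sum>r=n..N. (-1) ^ r * (\<Sum>S | S \<subseteq> {1..N} \<and> card S = r.
           of_real (coeff_c q n S) *
           log_contour_integral (replicate r (circlepath 0 R)) (I_fun q b Y S M t))))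
    \<and> ((\<forall>j\<in>{1..N}. positively_oriented_curve (C j) \<and>
           (\<forall>k. of_real (b k) \<in> inside (path_image (C j))) \<and>
           0 \<in> outside (path_image (C j))) \<and>
       (\<forall>i\<in>{1..N}. \<forall>j\<in>{1..N}. i < j \<longrightarrow>
           (\<lambda>z. of_real q * z) ` path_image (C i) \<subseteq> inside (path_image (C j))) \<longrightarrow>
      of_real (measure P {\<omega> \<in> space P. X t \<omega> (N - n + 1) \<le> M}) =
        (\<Sum>r=n..N. of_real (q powi (- int (r * N))) * (\<Sum>S | S \<subseteq> {1..N} \<and> card S = r.
           of_real (coeff_c_tilde q n S) *
           log_contour_integral (map C [1..<r + 1]) (I_fun q b Y S M t))))"
proof -
  have a_pos: "0 < a k" for k using a by (metis greaterThan_iff rangeI subset_iff)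
  have b_pos: "0 < b k" for k using a_pos[of k] q b by simp
  obtain K where K: "\<And>k. a k < K"
  proof -
    obtain S where "compact S" "range a \<subseteq> S" using a by blast
    then have "bounded (range a)" using compact_imp_bounded bounded_subset by blast
    then obtain K where "\<forall>x\<in>range a. norm x \<le> K" unfolding bounded_iff by blast
    then have "norm (a k) \<le> K" for k by blast
    then have "a k < K + 1" for k using abs_ge_self[of "a k"] by (smt (verit) real_norm_def)
    then show ?thesis by (rule that)
  qed
  have countable: "countable (weyl_chamber N)" by (rule countable_weyl_chamber)
  obtain p where tf: "transition_function (weyl_chamber N) (qtazrp_generator q a N) p"
    and p: "\<And>t A. 0 \<le> t \<Longrightarrow> measure P {\<omega> \<in> space P. X t \<omega> \<in> A} = measure (p t Y) A"
    using markov_jump_process_marginal[OF X[unfolded qtazrp_def] countable Y] by blast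
  \<comment> \<open>The radius is left open, since the first formula has a given circle and the
    second one an auxiliary circle.\<close>
  have prob: "of_real (measure P {\<omega> \<in> space P. M < X t \<omega> j}) = qtazrp_contour.contour_prob q r b N M j Y t"
    if "qtazrp_contour q r a b" "1 \<le> j" "j \<le> N" for r j
    using qtazrp_contour.contour_prob_eq_measure[OF that(1) tf that(2,3) Y, of t] p[of t "{x. M < x j}"] t
    by simp
  show ?thesis
  proof (intro conjI impI)
    assume R: "0 < R \<and> (\<forall>k. of_real (b k) \<in> inside (path_image (circlepath 0 R)))"
    have "norm (complex_of_real (b k)) < R" for k
      by (rule inside_circlepath) (use R in blast)+
    then have "b k < R" for k by (metis abs_ge_self le_less_trans norm_of_real)
    then have loc: "qtazrp_contour q R a b"
      using q R b_pos b by unfold_locales auto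
    show "of_real (measure P {\<omega> \<in> space P. X t \<omega> n > M}) =
        (\<Sum>r=n..N. (-1) ^ r * (\<Sum>S | S \<subseteq> {1..N} \<and> card S = r.
           of_real (coeff_c q n S) *
           log_contour_integral (replicate r (circlepath 0 R)) (I_fun q b Y S M t)))"
      unfolding prob[OF loc n] qtazrp_contour.sum_log_contour_integral_circlepath[OF loc n(1)] ..
  next
    assume C: "(\<forall>j\<in>{1..N}. positively_oriented_curve (C j) \<and>
           (\<forall>k. of_real (b k) \<in> inside (path_image (C j))) \<and>
           0 \<in> outside (path_image (C j))) \<and>
       (\<forall>i\<in>{1..N}. \<forall>j\<in>{1..N}. i < j \<longrightarrow>
           (\<lambda>z. of_real q * z) ` path_image (C i) \<subseteq> inside (path_image (C j)))"
    then have pos: "positively_oriented_curve (C j)" if "j \<in> {1..N}" for j using that by blast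
    have curve: "valid_path (C j)" "path (C j)" "pathfinish (C j) = pathstart (C j)"
      and inside: "\<And>z. z \<in> inside (path_image (C j)) \<Longrightarrow> z \<notin> path_image (C j) \<and> winding_number (C j) z = 1"
      if "j \<in> {1..N}" for j
      using pos[OF that] valid_path_imp_path inside_no_overlap[of "path_image (C j)"]
      unfolding positively_oriented_curve_def by blast+
    have "bounded (\<Union>j\<in>{1..N}. path_image (C j))"
      by (intro bounded_UN ballI compact_imp_bounded compact_path_image curve(2)) auto
    then obtain K' where K': "\<And>z. z \<in> (\<Union>j\<in>{1..N}. path_image (C j)) \<Longrightarrow> norm z \<le> K'"
      unfolding bounded_iff by blast
    \<comment> \<open>The auxiliary circle of the deformation: K exceeds all b k because b k <= a k,
      and K' + 1 puts all curves inside the open disc.\<close>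
    define R' where "R' = max K (K' + 1)"
    have K0: "0 < K" using a_pos[of 0] K[of 0] by simp
    have "b k < R'" for k
    proof -
      have "(1 - q) * a k \<le> 1 * a k" using q a_pos[of k] by (intro mult_right_mono) auto
      then show ?thesis using K[of k] by (simp add: b R'_def)
    qed
    then have loc: "qtazrp_contour q R' a b"
      using q b_pos b K0 by unfold_locales (auto simp: R'_def)
    have "(\<Sum>r=n..N. of_real (q powi (- int (r * N))) * (\<Sum>S | S \<subseteq> {1..N} \<and> card S = r.
           of_real (coeff_c_tilde q n S) *
           log_contour_integral (map C [1..<r + 1]) (I_fun q b Y S M t)))
       = 1 - qtazrp_contour.contour_prob q R' b N M (N - n + 1) Y t"
    proof (rule qtazrp_contour.sum_log_contour_integral_nested[OF loc n Y])
      fix j assume j: "j \<in> {1..N}"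
      have "path_image (C j) \<subseteq> ball 0 R'" using K' j by (fastforce simp: R'_def)
      moreover have "0 \<in> outside (path_image (C j))" using C j by blast
      ultimately show "valid_path (C j) \<and> pathfinish (C j) = pathstart (C j) \<and> path_image (C j) \<subseteq> ball 0 R' \<and>
           0 \<notin> path_image (C j) \<and> winding_number (C j) 0 = 0"
        using curve[OF j] winding_number_zero_in_outside[of "C j" 0] outside_no_overlap[of "path_image (C j)"] by blast
      show "of_real (b k) \<notin> path_image (C j) \<and> winding_number (C j) (of_real (b k)) = 1" for k
        using inside[OF j] C j by blast
    next
      fix i j z assume "i \<in> {1..N}" "j \<in> {1..N}" "i < j" "z \<in> path_image (C i)"
      then show "of_real q * z \<notin> path_image (C j) \<and> winding_number (C j) (of_real q * z) = 1"
        using inside[of j] C by blast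
    qed
    also have "qtazrp_contour.contour_prob q R' b N M (N - n + 1) Y t = of_real (measure P {\<omega> \<in> space P. M < X t \<omega> (N - n + 1)})"
      using n by (intro prob[OF loc, symmetric]) auto
    also have "measure P {\<omega> \<in> space P. M < X t \<omega> (N - n + 1)} = 1 - measure P {\<omega> \<in> space P. X t \<omega> (N - n + 1) \<le> M}"
    proof -
      have "{x. M < x (N - n + 1)} = - {x. x (N - n + 1) \<le> M}" by auto
      then have "measure (p t Y) {x. M < x (N - n + 1)} = 1 - measure (p t Y) {x. x (N - n + 1) \<le> M}"
        using measure_pmf.prob_compl[of "{x. x (N - n + 1) \<le> M}" "p t Y"] by (simp add: Compl_eq_Diff_UNIV)
      then show ?thesis
        using p[of t "{x. M < x (N - n + 1)}"] p[of t "{x. x (N - n + 1) \<le> M}"] t by simp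
    qed
    finally show "of_real (measure P {\<omega> \<in> space P. X t \<omega> (N - n + 1) \<le> M}) =
        (\<Sum>r=n..N. of_real (q powi (- int (r * N))) * (\<Sum>S | S \<subseteq> {1..N} \<and> card S = r.
           of_real (coeff_c_tilde q n S) *
           log_contour_integral (map C [1..<r + 1]) (I_fun q b Y S M t)))"
      by simp
  qed
qed

end
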